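(* Let $p\in\left(2+\frac4N,2+\frac8N\right)$ and $\varepsilon>0$. Then $u\in H^2(\mathbb R^N)$ is an energy ground state solution (energy GSS) with critical mass $c_\varepsilon$ if and only if $\|u\|_{L^2(\mathbb R^N)}^2=c_\varepsilon$ and $u$ is an optimizer of the inequality $$\|u\|_{L^p(\mathbb R^N)}^p\leqslant K_{N,p,\varepsilon}\|u\|_{L^2(\mathbb R^N)}^{p-2}\left(\varepsilon\|\Delta u\|_{L^2(\mathbb R^N)}^{2}+\|\nabla u\|_{L^2(\mathbb R^N)}^{2}\right),\qquad u\in H^2(\mathbb R^N).$$ Moreover, $$c_\varepsilon=\left(\frac2pK_{N,p,\varepsilon}\right)^{-\frac2{p-2}}.$$
   Context: $N\geqslant1$ is an integer. For $c>0$ let $S_c:=\{u\in H^2(\mathbb R^N): \int_{\mathbb R^N}|u|^2\,dx=c\}$, and define the energy $$E_\varepsilon(u):=\frac\varepsilon2\int_{\mathbb R^N}|\Delta u|^2\,dx+\frac12\int_{\mathbb R^N}|\nabla u|^2\,dx-\frac1p\int_{\mathbb R^N}|u|^p\,dx,\qquad m_\varepsilon(c):=\inf_{u\in S_c}E_\varepsilon(u).$$ An energy GSS with mass $c$ is a function $u\in S_c$ with $E_\varepsilon(u)=m_\varepsilon(c)$. $K_{N,p,\varepsilon}\in(0,\infty)$ is the best (smallest) constant in the inequality of the claim, i.e. $K_{N,p,\varepsilon}=\sup_{u\in H^2(\mathbb R^N)\setminus\{0\}}\frac{\|u\|_{p}^p}{\|u\|_2^{p-2}(\varepsilon\|\Delta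 u\|_2^2+\|\nabla u\|_2^2)}$. An optimizer is a nonzero $u\in H^2(\mathbb R^N)$ for which equality holds. $C_{N,p}\in(0,\infty)$ is the best constant in the mixed Gagliardo-Nirenberg inequality $$\|u\|_{p}^p\leqslant C_{N,p}\|\Delta u\|_{2}^{\frac{N(p-2)-4}2}\|\nabla u\|_{2}^{\frac{8-N(p-2)}2}\|u\|_{2}^{p-2},\qquad u\in H^2(\mathbb R^N).$$ The critical mass is $$c_\varepsilon:=C_{N,p}^{-\frac2{p-2}}\left[\frac{2p}{N(p-2)-4}\right]^{\frac{N(p-2)-4}{2(p-2)}}\left[\frac{2p}{8-N(p-2)}\right]^{\frac{8-N(p-2)}{2(p-2)}}\varepsilon^{\frac{N(p-2)-4}{2(p-2)}}.$$ *)

theory Defs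
  imports "HOL-Analysis.Analysis"
begin

text \<open>
  The domain \<open>\<real>\<^sup>N\<close> is a Euclidean space \<open>'a\<close> with \<open>N = DIM('a)\<close>; functions take values
  in a Euclidean space \<open>'k\<close> (for the scalar case, the reals or the complex numbers).
  Elements of \<open>L\<^sup>2\<close> and \<open>H\<^sup>2\<close> are represented by Borel functions rather than by classes
  modulo null sets, so ``nonzero'' means ``not almost everywhere zero''. A quantity depending
  on the whole space \<open>H\<^sup>2\<close> takes an argument \<open>TYPE('a \<Rightarrow> 'k)\<close>, which fixes
  the domain and the codomain.
\<close>

primrec Ck :: "nat \<Rightarrow> ('a::euclidean_space \<Rightarrow> real) \<Rightarrow> bool" where
  "Ck 0 f \<longleftrightarrow> continuous_on UNIV f"
| "Ck (Suc k) f \<longleftrightarrow> f differentiable_on UNIV \<and>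
     (\<forall>b\<in>Basis. Ck k (\<lambda>x. frechet_derivative f (at x) b))"

definition test_function :: "('a::euclidean_space \<Rightarrow> real) \<Rightarrow> bool" where
  "test_function \<phi> \<longleftrightarrow> (\<forall>k. Ck k \<phi>) \<and> compact (closure {x. \<phi> x \<noteq> 0})"

definition L2 :: "('a::euclidean_space \<Rightarrow> 'k::euclidean_space) set" where
  "L2 = {u \<in> borel_measurable lborel. integrable lborel (\<lambda>x. (norm (u x))\<^sup>2)}"

text \<open>Used for \<open>u, v \<in> L2\<close> only, so that both integrands are integrable. Real test
  functions suffice for complex-valued \<open>u\<close> by linearity.\<close>

definition weak_partial ::
  "'a \<Rightarrow> ('a::euclidean_space \<Rightarrow> 'k::euclidean_space) \<Rightarrow> ('a \<Rightarrow> 'k) \<Rightarrow> bool" where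
  "weak_partial b u v \<longleftrightarrow>
     (\<forall>\<phi>. test_function \<phi> \<longrightarrow>
        (\<integral>x. frechet_derivative \<phi> (at x) b *\<^sub>R u x \<partial>lborel) = - (\<integral>x. \<phi> x *\<^sub>R v x \<partial>lborel))"

definition H2 :: "('a::euclidean_space \<Rightarrow> 'k::euclidean_space) set" where
  "H2 = {u \<in> L2. \<forall>b\<in>Basis. \<exists>v\<in>L2. weak_partial b u v \<and>
                    (\<forall>b'\<in>Basis. \<exists>w\<in>L2. weak_partial b' v w)}"

text \<open>The weak partial derivative, unique up to a null set when it exists in \<open>L2\<close>.\<close>

definition wpd ::
  "'a \<Rightarrow> ('a::euclidean_space \<Rightarrow> 'k::euclidean_space) \<Rightarrow> 'a \<Rightarrow> 'k" where
  "wpd b u = (SOME v. v \<in> L2 \<and> weak_partial b u v)"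

definition grad_abs :: "('a::euclidean_space \<Rightarrow> 'k::euclidean_space) \<Rightarrow> 'a \<Rightarrow> real" where
  "grad_abs u x = sqrt (\<Sum>b\<in>Basis. (norm (wpd b u x))\<^sup>2)"

definition laplacian :: "('a::euclidean_space \<Rightarrow> 'k::euclidean_space) \<Rightarrow> 'a \<Rightarrow> 'k" where
  "laplacian u x = (\<Sum>b\<in>Basis. wpd b (wpd b u) x)"

definition Lnorm :: "real \<Rightarrow> ('a::euclidean_space \<Rightarrow> 'k::euclidean_space) \<Rightarrow> real" where
  "Lnorm q u = (\<integral>x. norm (u x) powr q \<partial>lborel) powr (1 / q)"

definition energy :: "real \<Rightarrow> real \<Rightarrow> ('a::euclidean_space \<Rightarrow> 'k::euclidean_space) \<Rightarrow> real" where
  "energy \<epsilon> p u =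
     \<epsilon> / 2 * (\<integral>x. (norm (laplacian u x))\<^sup>2 \<partial>lborel)
     + 1 / 2 * (\<integral>x. (grad_abs u x)\<^sup>2 \<partial>lborel)
     - 1 / p * (\<integral>x. norm (u x) powr p \<partial>lborel)"

definition mass_sphere :: "real \<Rightarrow> ('a::euclidean_space \<Rightarrow> 'k::euclidean_space) set" where
  "mass_sphere c = {u \<in> H2. (\<integral>x. (norm (u x))\<^sup>2 \<partial>lborel) = c}"

text \<open>The infimum is taken in \<open>ereal\<close>, so no boundedness of the energy is presupposed.\<close>

definition min_energy ::
  "('a::euclidean_space \<Rightarrow> 'k::euclidean_space) itself \<Rightarrow> real \<Rightarrow> real \<Rightarrow> real \<Rightarrow> ereal" where
  "min_energy T \<epsilon> p c = (INF u \<in> (mass_sphere c :: ('a \<Rightarrow> 'k) set). ereal (energy \<epsilon> p u))"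

definition energy_GSS ::
  "real \<Rightarrow> real \<Rightarrow> real \<Rightarrow> ('a::euclidean_space \<Rightarrow> 'k::euclidean_space) \<Rightarrow> bool" where
  "energy_GSS \<epsilon> p c u \<longleftrightarrow>
     u \<in> mass_sphere c \<and> ereal (energy \<epsilon> p u) = min_energy TYPE('a \<Rightarrow> 'k) \<epsilon> p c"

definition H2_nonzero :: "('a::euclidean_space \<Rightarrow> 'k::euclidean_space) set" where
  "H2_nonzero = {u \<in> H2. \<not> (AE x in lborel. u x = 0)}"

text \<open>For \<open>2 + 4/N < p < 2 + 8/N\<close> and \<open>\<epsilon> > 0\<close> the functions in \<open>H2\<close> are in \<open>L\<^sup>p\<close>,
  the set in \<open>best_K\<close> is bounded above and the set in \<open>mixed_GN\<close> is nonempty, so the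
  real \<open>Sup\<close> and \<open>Inf\<close> are the intended finite values.\<close>

definition best_K ::
  "('a::euclidean_space \<Rightarrow> 'k::euclidean_space) itself \<Rightarrow> real \<Rightarrow> real \<Rightarrow> real" where
  "best_K T p \<epsilon> = (SUP u \<in> (H2_nonzero :: ('a \<Rightarrow> 'k) set).
     Lnorm p u powr p /
     (Lnorm 2 u powr (p - 2) * (\<epsilon> * (Lnorm 2 (laplacian u))\<^sup>2 + (Lnorm 2 (grad_abs u))\<^sup>2)))"

definition is_optimizer ::
  "real \<Rightarrow> real \<Rightarrow> ('a::euclidean_space \<Rightarrow> 'k::euclidean_space) \<Rightarrow> bool" where
  "is_optimizer p \<epsilon> u \<longleftrightarrow> u \<in> H2_nonzero \<and>
     Lnorm p u powr p =
       best_K TYPE('a \<Rightarrow> 'k) p \<epsilon> * Lnorm 2 u powr (p - 2) *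
       (\<epsilon> * (Lnorm 2 (laplacian u))\<^sup>2 + (Lnorm 2 (grad_abs u))\<^sup>2)"

definition mixed_GN ::
  "('a::euclidean_space \<Rightarrow> 'k::euclidean_space) itself \<Rightarrow> real \<Rightarrow> real" where
  "mixed_GN T p = Inf {C. 0 \<le> C \<and> (\<forall>u \<in> (H2 :: ('a \<Rightarrow> 'k) set).
     Lnorm p u powr p \<le>
       C * Lnorm 2 (laplacian u) powr ((real DIM('a) * (p - 2) - 4) / 2)
         * Lnorm 2 (grad_abs u) powr ((8 - real DIM('a) * (p - 2)) / 2)
         * Lnorm 2 u powr (p - 2))}"

definition crit_mass ::
  "('a::euclidean_space \<Rightarrow> 'k::euclidean_space) itself \<Rightarrow> real \<Rightarrow> real \<Rightarrow> real" where
  "crit_mass T p \<epsilon> = (let N = real DIM('a) in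
     mixed_GN T p powr (- 2 / (p - 2))
     * (2 * p / (N * (p - 2) - 4)) powr ((N * (p - 2) - 4) / (2 * (p - 2)))
     * (2 * p / (8 - N * (p - 2))) powr ((8 - N * (p - 2)) / (2 * (p - 2)))
     * \<epsilon> powr ((N * (p - 2) - 4) / (2 * (p - 2))))"

end

theory Submission
  imports Defs
begin

text \<open>
  At the critical mass the sharp inequality makes the energy nonnegative, and spreading a function
  out at fixed mass drives the energy to \<open>0\<close>; hence \<open>m\<^sub>\<epsilon>(c\<^sub>\<epsilon>) = 0\<close>, and a minimiser is exactly
  a function for which the inequality is an equality. The value of \<open>c\<^sub>\<epsilon>\<close> comes from Young's
  inequality applied to the mixed Gagliardo-Nirenberg inequality, which a dilation turns into an equality.

  For the Gagliardo-Nirenberg inequality itself, let \<open>\<rho>\<^sub>a\<close> be a radial bump of width \<open>1/a\<close>.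
  Since \<open>\<rho>\<^sub>a - \<rho>\<^sub>b\<close> is the Laplacian of a test function \<open>G\<close> with \<open>\<parallel>G\<parallel>\<^sub>1 = O(1/a\<^sup>2)\<close> and
  \<open>\<parallel>\<nabla>G\<parallel>\<^sub>1 = O(1/a)\<close>, the error of the approximation of \<open>u\<close> by \<open>\<rho>\<^sub>a * u\<close> in \<open>L\<^sup>2\<close> is
  \<open>O(\<parallel>\<Delta>u\<parallel>/a\<^sup>2)\<close> and \<open>O(\<parallel>\<nabla>u\<parallel>/a)\<close>, while \<open>\<bar>\<rho>\<^sub>a * u\<bar> = O(a\<^bsup>N/2\<^esup> \<parallel>u\<parallel>)\<close> pointwise. Choosing
  \<open>a\<close> according to the level \<open>t\<close> bounds the measure of \<open>{\<bar>u\<bar> \<ge> t}\<close> by multiples of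
  \<open>t\<^bsup>-2-4/N\<^esup>\<close> and of \<open>t\<^bsup>-2-8/N\<^esup>\<close>, and \<open>p\<close> lies strictly between these two exponents.
\<close>

section \<open>Smooth functions\<close>

text \<open>The inequality involves only weak derivatives and, at second order, only the Laplacian,
  so every estimate is moved onto smooth kernels with bounded support. The potential
  \<open>G\<close> comes from differentiating a bump in its scale: for F_t(x) = t^N F(t x) one has
  dF_t/dt = div(x F_t) / t, and for the profile \<open>flat 1 (1 - x \<bullet> x)\<close> the field
  x F is minus one half of the gradient of \<open>flat 0 (1 - x \<bullet> x)\<close>. Hence dF_t/dt
  is a Laplacian, and integration over [a, b] gives \<open>G\<close>. The upper scale b stays finite
  to keep \<open>G\<close> smooth at the origin; all bounds are uniform in b, which tends to
  infinity only afterwards.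

  At the two ends of the range of p only weak-type bounds are obtained. The strict inequalities make
  the layer-cake integrals converge at 0 and at infinity, and cutting at the level where the two
  bounds agree produces exactly the product of powers required.

  The variational part does not presuppose a minimiser: the infimum is 0 whether attained or not,
  and the equivalence compares two equations for a given function.\<close>

lemma Ck_SucI:
  assumes "\<And>x. (f has_derivative f' x) (at x)" and "\<And>b. b \<in> Basis \<Longrightarrow> Ck k (\<lambda>x. f' x b)"
  shows "Ck (Suc k) f"
proof -
  have "frechet_derivative f (at x) = f' x" for x
    using frechet_derivative_at[OF assms(1)] by simp
  then show ?thesis
    using assms by (auto simp: differentiable_on_def differentiable_def intro: has_derivative_at_withinI)
qed

lemma Ck_Suc_has_derivative:
  "Ck (Suc k) f \<Longrightarrow> (f has_derivative frechet_derivative f (at x)) (at x)"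
  by (simp add: differentiable_on_def flip: frechet_derivative_works)

lemma Ck_Suc_partial: "Ck (Suc k) f \<Longrightarrow> b \<in> Basis \<Longrightarrow> Ck k (\<lambda>x. frechet_derivative f (at x) b)"
  by simp

lemma Ck_Suc_imp: "Ck (Suc k) f \<Longrightarrow> Ck k f"
  by (induction k arbitrary: f) (auto intro: differentiable_imp_continuous_on)

lemma Ck_const: "Ck k (\<lambda>x. c)"
proof (induction k arbitrary: c)
  case (Suc k)
  show ?case by (rule Ck_SucI[where f' = "\<lambda>_ _. 0"]) (auto intro: Suc)
qed auto

lemma Ck_inner: "Ck k (\<lambda>x. x \<bullet> c)"
proof (cases k)
  case (Suc n)
  show ?thesis unfolding Suc
    by (rule Ck_SucI[where f' = "\<lambda>_ h. h \<bullet> c"]) (auto intro!: derivative_eq_intros Ck_const)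
qed (auto intro!: continuous_intros)

lemma Ck_add: "Ck k f \<Longrightarrow> Ck k g \<Longrightarrow> Ck k (\<lambda>x. f x + g x)"
proof (induction k arbitrary: f g)
  case (Suc k)
  note d = Ck_Suc_has_derivative[OF Suc.prems(1)] Ck_Suc_has_derivative[OF Suc.prems(2)]
  show ?case
    by (rule Ck_SucI[OF has_derivative_add[OF d]]) (use Suc in auto)
qed (auto intro!: continuous_intros)

lemma Ck_mult: "Ck k f \<Longrightarrow> Ck k g \<Longrightarrow> Ck k (\<lambda>x. f x * g x)"
proof (induction k arbitrary: f g)
  case 0
  then show ?case by (simp add: continuous_on_mult)
next
  case (Suc k)
  note d = Ck_Suc_has_derivative[OF Suc.prems(1)] Ck_Suc_has_derivative[OF Suc.prems(2)]
  show ?case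
  proof (rule Ck_SucI[OF has_derivative_mult[OF d]])
    fix b :: 'a assume "b \<in> Basis"
    then have "Ck k (\<lambda>x. frechet_derivative f (at x) b)" "Ck k (\<lambda>x. frechet_derivative g (at x) b)"
      using Suc.prems by (auto intro: Ck_Suc_partial simp del: Ck.simps)
    then show "Ck k (\<lambda>x. f x * frechet_derivative g (at x) b + frechet_derivative f (at x) b * g x)"
      using Suc.prems[THEN Ck_Suc_imp] by (intro Ck_add Suc.IH)
  qed
qed

lemma Ck_sum: "finite I \<Longrightarrow> (\<And>i. i \<in> I \<Longrightarrow> Ck k (f i)) \<Longrightarrow> Ck k (\<lambda>x. \<Sum>i\<in>I. f i x)"
  by (induction rule: finite_induct) (auto intro: Ck_const Ck_add)

lemma Ck_prod: "finite I \<Longrightarrow> (\<And>i. i \<in> I \<Longrightarrow> Ck k (f i)) \<Longrightarrow> Ck k (\<lambda>x. \<Prod>i\<in>I. f i x)"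
  by (induction rule: finite_induct) (auto intro: Ck_const Ck_mult)

text \<open>A whole sequence of successive derivatives is carried at once, so that smoothness of a
  composition can be proved by induction on the order with the index n left free.\<close>

definition derivative_chain :: "(nat \<Rightarrow> real \<Rightarrow> real) \<Rightarrow> bool" where
  "derivative_chain D \<longleftrightarrow> (\<forall>n t. (D n has_real_derivative D (Suc n) t) (at t))"

lemma derivative_chain_continuous: "derivative_chain D \<Longrightarrow> continuous_on S (D n)"
  unfolding derivative_chain_def
  by (rule continuous_at_imp_continuous_on) (blast intro: DERIV_isCont)

lemma Ck_compose_chain:
  assumes "derivative_chain D" and "\<And>k. Ck k f"
  shows "Ck k (\<lambda>x. D n (f x))"
proof (induction k arbitrary: n)
  case 0
  have "continuous_on UNIV f" using assms(2)[of 0] by simp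
  then show ?case
    by (auto intro: continuous_on_compose2[OF derivative_chain_continuous[OF assms(1)], of UNIV])
next
  case (Suc k)
  have "((\<lambda>x. D n (f x)) has_derivative (\<lambda>h. D (Suc n) (f x) * frechet_derivative f (at x) h)) (at x)" for x
    using DERIV_compose_FDERIV[OF _ Ck_Suc_has_derivative[OF assms(2)[of "Suc 0"]], of "D n" "D (Suc n) (f x)" x]
      assms(1) by (simp add: derivative_chain_def mult.commute)
  moreover have "Ck k (\<lambda>x. D (Suc n) (f x) * frechet_derivative f (at x) b)" if "b \<in> Basis" for b
    using assms(2)[of "Suc k"] that by (intro Ck_mult Suc.IH) auto
  ultimately show ?case by (rule Ck_SucI)
qed

lemma Ck_affine_arg:
  assumes "\<And>k. Ck k f"
  shows "Ck k (\<lambda>x. f (c *\<^sub>R x + a))"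
  using assms
proof (induction k arbitrary: f)
  case 0
  have "continuous_on UNIV f" using 0[of 0] by simp
  moreover have "continuous_on UNIV (\<lambda>x. c *\<^sub>R x + a)" by (intro continuous_intros)
  ultimately show ?case by (auto intro: continuous_on_compose2)
next
  case (Suc k)
  have d: "((\<lambda>x. f (c *\<^sub>R x + a)) has_derivative (\<lambda>h. c * frechet_derivative f (at (c *\<^sub>R x + a)) h)) (at x)" for x
  proof -
    note fd = Ck_Suc_has_derivative[OF Suc.prems[of "Suc 0"], of "c *\<^sub>R x + a"]
    have "((\<lambda>x. f (c *\<^sub>R x + a)) has_derivative (\<lambda>h. frechet_derivative f (at (c *\<^sub>R x + a)) (c *\<^sub>R h))) (at x)"
      by (rule has_derivative_compose[where g = f and f = "\<lambda>x. c *\<^sub>R x + a" and f' = "\<lambda>h. c *\<^sub>R h", OF _ fd]) (auto intro!: derivative_eq_intros)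
    then show ?thesis
      using linear_cmul[OF has_derivative_linear[OF fd]] by simp
  qed
  have "Ck j (\<lambda>x. frechet_derivative f (at x) b)" if "b \<in> Basis" for b j
    using Suc.prems[of "Suc j"] that by simp
  then show ?case
    by (intro Ck_SucI[OF d] Ck_mult Ck_const Suc.IH) auto
qed

text \<open>\<open>flat n\<close> is the \<open>n\<close>-th derivative of the function \<open>exp (- 1 / t)\<close>, extended by \<open>0\<close> to \<open>t \<le> 0\<close>.\<close>

fun flat_poly :: "nat \<Rightarrow> real poly" where
  "flat_poly 0 = 1"
| "flat_poly (Suc n) = [:0, 0, 1:] * (flat_poly n - pderiv (flat_poly n))"

definition flat :: "nat \<Rightarrow> real \<Rightarrow> real" where
  "flat n t = (if t > 0 then poly (flat_poly n) (1 / t) * exp (- (1 / t)) else 0)"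

lemma poly_times_exp_minus_tendsto:
  "((\<lambda>s. poly q s * exp (- s)) \<longlongrightarrow> (0::real)) at_top"
proof -
  have "((\<lambda>s. \<Sum>i\<le>degree q. coeff q i * (s ^ i / exp s)) \<longlongrightarrow> (\<Sum>i\<le>degree q. coeff q i * 0)) at_top"
    by (intro tendsto_intros tendsto_power_div_exp_0)
  then show ?thesis
    by (simp add: poly_altdef sum_distrib_right exp_minus divide_inverse mult.assoc)
qed

lemma flat_at_right_tendsto: "((\<lambda>t. poly q (1 / t) * exp (- (1 / t))) \<longlongrightarrow> (0::real)) (at_right 0)"
  using filterlim_compose[OF poly_times_exp_minus_tendsto filterlim_inverse_at_top_right]
  by (simp add: inverse_eq_divide)

lemma flat_derivative_chain: "derivative_chain flat"
  unfolding derivative_chain_def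
proof (intro allI)
  fix n and t :: real
  consider "t > 0" | "t < 0" | "t = 0" by linarith
  then show "(flat n has_real_derivative flat (Suc n) t) (at t)"
  proof cases
    case 1
    \<comment> \<open>With s = 1 / t, hence ds/dt = - s^2, differentiating q(s) exp(- s) gives s^2
      (q(s) - q'(s)) exp(- s); this is the recursion of \<open>flat_poly\<close>.\<close>
    have "((\<lambda>t. poly (flat_poly n) (1 / t) * exp (- (1 / t))) has_real_derivative flat (Suc n) t) (at t)"
      using 1 by (auto intro!: derivative_eq_intros DERIV_chain2[OF poly_DERIV]
                       simp: flat_def field_simps power2_eq_square)
    then show ?thesis
      by (rule has_field_derivative_transform_within_open[where S = "{0<..}"]) (auto simp: 1 flat_def)
  next
    case 2
    have "((\<lambda>t. 0) has_real_derivative flat (Suc n) t) (at t)" using 2 by (simp add: flat_def)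
    then show ?thesis
      by (rule has_field_derivative_transform_within_open[where S = "{..<0}"]) (auto simp: 2 flat_def)
  next
    case 3
    \<comment> \<open>Division by h multiplies the polynomial in 1 / h by its variable. So for h > 0
      the difference quotient at 0 is again a polynomial in 1 / h times exp(- 1 / h), while for h <
      0 it is 0.\<close>
    have "((\<lambda>h. flat n h / h) \<longlongrightarrow> 0) (at 0)"
    proof (rule filterlim_split_at_real)
      have "((\<lambda>h. poly ([:0, 1:] * flat_poly n) (1 / h) * exp (- (1 / h))) \<longlongrightarrow> (0::real)) (at_right 0)"
        by (rule flat_at_right_tendsto)
      then show "((\<lambda>h. flat n h / h) \<longlongrightarrow> 0) (at_right 0)"
        by (rule Lim_transform_eventually)
           (auto simp: eventually_at_right_field flat_def intro!: exI[of _ 1])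
      show "((\<lambda>h. flat n h / h) \<longlongrightarrow> 0) (at_left 0)"
        by (rule tendsto_eventually) (auto simp: eventually_at_left_field flat_def intro!: exI[of _ "-1"])
    qed
    then show ?thesis
      using 3 by (simp add: DERIV_def flat_def)
  qed
qed

lemma flat_0: "flat 0 t = (if t > 0 then exp (- (1 / t)) else 0)"
  by (simp add: flat_def)

lemma flat_1: "flat 1 t = (if t > 0 then (1 / t)\<^sup>2 * exp (- (1 / t)) else 0)"
  by (simp add: flat_def power2_eq_square)

lemma flat_nonpos: "t \<le> 0 \<Longrightarrow> flat n t = 0"
  by (simp add: flat_def)

section \<open>Closure properties of test functions\<close>

lemma test_function_cut:
  assumes "\<And>k. Ck k f" and "\<And>x. R < norm x \<Longrightarrow> f x = 0"
  shows "test_function f"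
proof -
  have "{x. f x \<noteq> 0} \<subseteq> cball 0 R" using assms(2) by (force simp: not_less[symmetric])
  then have "bounded {x. f x \<noteq> 0}" using bounded_cball bounded_subset by blast
  then show ?thesis using assms(1) by (simp add: test_function_def compact_closure)
qed

lemma test_function_bounded_support:
  assumes "test_function \<phi>" obtains R where "R > 0" "\<And>x. R < norm x \<Longrightarrow> \<phi> x = 0"
proof -
  have "bounded (closure {x. \<phi> x \<noteq> 0})" using assms by (simp add: test_function_def compact_imp_bounded)
  then obtain R where "R > 0" "\<forall>x\<in>closure {x. \<phi> x \<noteq> 0}. norm x \<le> R" by (auto simp: bounded_pos)
  then show ?thesis
    using that[of R] closure_subset[of "{x. \<phi> x \<noteq> 0}"] by force
qed

lemma test_function_has_derivative:
  "test_function \<phi> \<Longrightarrow> (\<phi> has_derivative frechet_derivative \<phi> (at x)) (at x)"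
  by (intro Ck_Suc_has_derivative[of 0]) (simp add: test_function_def del: Ck.simps)

lemma test_function_partial:
  assumes "test_function \<phi>" "b \<in> Basis"
  shows "test_function (\<lambda>x. frechet_derivative \<phi> (at x) b)"
proof -
  obtain R where R: "R > 0" "\<And>x. R < norm x \<Longrightarrow> \<phi> x = 0"
    using test_function_bounded_support[OF assms(1)] by blast
  show ?thesis
  proof (rule test_function_cut)
    show "Ck k (\<lambda>x. frechet_derivative \<phi> (at x) b)" for k
      using assms by (auto simp: test_function_def dest: spec[of _ "Suc k"])
    fix x :: 'a assume "R < norm x"
    have "((\<lambda>_. 0) has_derivative (\<lambda>_. 0)) (at x)" by simp
    then have "(\<phi> has_derivative (\<lambda>_. 0)) (at x)"
      by (rule has_derivative_transform_within_open[where s = "- cball 0 R"]) (use R \<open>R < norm x\<close> in auto)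
    from frechet_derivative_at[OF this, symmetric] show "frechet_derivative \<phi> (at x) b = 0"
      by simp
  qed
qed

lemma test_function_affine_arg:
  assumes "test_function \<phi>" "c \<noteq> 0"
  shows "test_function (\<lambda>x. \<phi> (c *\<^sub>R x + a))"
proof -
  obtain R where R: "R > 0" "\<And>x. R < norm x \<Longrightarrow> \<phi> x = 0"
    using test_function_bounded_support[OF assms(1)] by blast
  show ?thesis
  proof (rule test_function_cut[where R = "(R + norm a) / \<bar>c\<bar>"])
    show "Ck k (\<lambda>x. \<phi> (c *\<^sub>R x + a))" for k
      using assms by (intro Ck_affine_arg) (auto simp: test_function_def)
    fix x :: 'a assume "(R + norm a) / \<bar>c\<bar> < norm x"
    then have "R + norm a < norm (c *\<^sub>R x)" using assms(2) by (simp add: field_simps)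
    also have "\<dots> \<le> norm (c *\<^sub>R x + a) + norm a" by (metis add_diff_cancel_right' norm_triangle_ineq4)
    finally show "\<phi> (c *\<^sub>R x + a) = 0" using R by simp
  qed
qed

lemma frechet_derivative_affine_arg:
  assumes "test_function \<phi>"
  shows "frechet_derivative (\<lambda>x. \<phi> (c *\<^sub>R x + a)) (at x) b = c * frechet_derivative \<phi> (at (c *\<^sub>R x + a)) b"
proof -
  let ?D = "frechet_derivative \<phi> (at (c *\<^sub>R x + a))"
  have fd: "(\<phi> has_derivative ?D) (at (c *\<^sub>R x + a))"
    by (rule test_function_has_derivative[OF assms])
  have "((\<lambda>x. c *\<^sub>R x + a) has_derivative (\<lambda>h. c *\<^sub>R h)) (at x)"
    by (intro has_derivative_add_const has_derivative_scaleR_right has_derivative_ident)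
  then have "((\<lambda>x. \<phi> (c *\<^sub>R x + a)) has_derivative (\<lambda>h. ?D (c *\<^sub>R h))) (at x)"
    using has_derivative_compose[where f = "\<lambda>x. c *\<^sub>R x + a", OF _ fd] by blast
  then have "frechet_derivative (\<lambda>x. \<phi> (c *\<^sub>R x + a)) (at x) = (\<lambda>h. ?D (c *\<^sub>R h))"
    by (rule frechet_derivative_at[symmetric])
  moreover have "?D (c *\<^sub>R b) = c * ?D b"
    using linear_cmul[OF has_derivative_linear[OF fd], of c b] by simp
  ultimately show ?thesis by simp
qed

section \<open>Smooth approximations of box indicators\<close>

lemma flat_0_bounds: "0 \<le> flat 0 t" "flat 0 t \<le> 1"
  by (simp_all add: flat_0)

lemma flat_1_nonneg: "0 \<le> flat 1 t"
  by (simp add: flat_1[unfolded One_nat_def])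

lemma flat_0_scaled_tendsto:
  "(\<lambda>n. flat 0 (real (Suc n) * t)) \<longlonglongrightarrow> (if t > 0 then 1 else 0)"
proof (cases "t > 0")
  case True
  have "(\<lambda>n. exp (- ((1 / t) * inverse (real (Suc n))))) \<longlonglongrightarrow> exp (- ((1 / t) * 0))"
    by (intro tendsto_intros LIMSEQ_inverse_real_of_nat)
  moreover have "flat 0 (real (Suc n) * t) = exp (- ((1 / t) * inverse (real (Suc n))))" for n
    using True by (simp add: flat_0 field_simps del: of_nat_Suc)
  ultimately show ?thesis using True by simp
next
  case False
  then have "flat 0 (real (Suc n) * t) = 0" for n
    by (intro flat_nonpos) (simp add: mult_nonneg_nonpos)
  then show ?thesis using False by simp
qed

text \<open>Each factor tends to 1 where its argument is positive and vanishes elsewhere, so these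
  test functions converge pointwise to the indicator of the open box. Through them an identity for
  test functions reaches integrals over boxes.\<close>

definition box_bump :: "'a \<Rightarrow> 'a \<Rightarrow> nat \<Rightarrow> 'a::euclidean_space \<Rightarrow> real" where
  "box_bump l r n x =
     (\<Prod>b\<in>Basis. flat 0 (real (Suc n) * (x \<bullet> b - l \<bullet> b)) * flat 0 (real (Suc n) * (r \<bullet> b - x \<bullet> b)))"

lemma box_bump_bounds: "0 \<le> box_bump l r n x" "box_bump l r n x \<le> 1"
  unfolding box_bump_def
  by (auto intro!: prod_nonneg prod_le_1 mult_nonneg_nonneg mult_le_one flat_0_bounds)

lemma box_bump_eq_0:
  assumes "x \<notin> box l r"
  shows "box_bump l r n x = 0"
proof -
  obtain b where b: "b \<in> Basis" "x \<bullet> b \<le> l \<bullet> b \<or> r \<bullet> b \<le> x \<bullet> b"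
    using assms by (auto simp: mem_box not_less)
  then have "flat 0 (real (Suc n) * (x \<bullet> b - l \<bullet> b)) = 0 \<or> flat 0 (real (Suc n) * (r \<bullet> b - x \<bullet> b)) = 0"
    by (auto intro!: flat_nonpos mult_nonneg_nonpos)
  then show ?thesis
    unfolding box_bump_def using b(1) by (intro prod_zero) auto
qed

lemma box_bump_tendsto: "(\<lambda>n. box_bump l r n x) \<longlonglongrightarrow> indicator (box l r) x"
proof -
  have "(\<lambda>n. box_bump l r n x) \<longlonglongrightarrow>
     (\<Prod>b\<in>Basis. (if x \<bullet> b - l \<bullet> b > 0 then 1 else 0) * (if r \<bullet> b - x \<bullet> b > 0 then 1 else 0))"
    unfolding box_bump_def by (intro tendsto_intros flat_0_scaled_tendsto)
  moreover have "(\<Prod>b\<in>Basis. (if x \<bullet> b - l \<bullet> b > 0 then 1 else 0) * (if r \<bullet> b - x \<bullet> b > 0 then 1 else 0))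
     = (indicator (box l r) x :: real)"
  proof (cases "x \<in> box l r")
    case True
    then show ?thesis by (auto simp: mem_box intro!: prod.neutral)
  next
    case False
    then obtain b where b: "b \<in> Basis" "x \<bullet> b \<le> l \<bullet> b \<or> r \<bullet> b \<le> x \<bullet> b"
      by (auto simp: mem_box not_less)
    then show ?thesis using False by (auto intro!: bexI[of _ b] simp: prod_zero_iff)
  qed
  ultimately show ?thesis by simp
qed

lemma test_function_box_bump: "test_function (box_bump l r n)"
proof -
  have "bounded (box l r)" by simp
  then obtain R where R: "\<forall>x\<in>box l r. norm x \<le> R" by (auto simp: bounded_iff)
  show ?thesis
  proof (rule test_function_cut)
    fix k
    have lin: "Ck j (\<lambda>x. real (Suc n) * (x \<bullet> b - l \<bullet> b))" "Ck j (\<lambda>x. real (Suc n) * (r \<bullet> b - x \<bullet> b))"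
      for j and b :: 'a
      using Ck_add[OF Ck_mult[OF Ck_const Ck_inner] Ck_const, of j "real (Suc n)" b "- real (Suc n) * (l \<bullet> b)"]
        Ck_add[OF Ck_mult[OF Ck_const Ck_inner] Ck_const, of j "- real (Suc n)" b "real (Suc n) * (r \<bullet> b)"]
      by (simp_all add: algebra_simps)
    show "Ck k (box_bump l r n)"
      unfolding box_bump_def[abs_def]
      by (intro Ck_prod Ck_mult Ck_compose_chain[OF flat_derivative_chain] lin finite_Basis)
  next
    show "box_bump l r n x = 0" if "R < norm x" for x
      using R that by (intro box_bump_eq_0) force
  qed
qed

section \<open>Radial bumps and the potentials of their differences\<close>

definition flat_mean :: "(real \<Rightarrow> real) \<Rightarrow> real \<Rightarrow> real \<Rightarrow> nat \<Rightarrow> real \<Rightarrow> real" where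
  "flat_mean w a b n q = integral {a..b} (\<lambda>t. w t * (- (t\<^sup>2)) ^ n * flat n (1 - t\<^sup>2 * q))"

lemma continuous_on_flat [continuous_intros]:
  "continuous_on S f \<Longrightarrow> continuous_on S (\<lambda>x. flat n (f x))"
  by (rule continuous_on_compose2[OF derivative_chain_continuous[OF flat_derivative_chain, of UNIV]]) auto

text \<open>Differentiation under the integral: each derivative in q raises the index of
  \<open>flat\<close> and brings out a factor - t^2, which is why \<open>flat_mean\<close> carries
  the n-th power of - t^2.\<close>

lemma flat_mean_derivative_chain:
  assumes w: "continuous_on {a..b} w"
  shows "derivative_chain (flat_mean w a b)"
  unfolding derivative_chain_def
proof (intro allI)
  fix n q
  let ?f = "\<lambda>n q t. w t * (- (t\<^sup>2)) ^ n * flat n (1 - t\<^sup>2 * q)"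
  have "((\<lambda>q. integral (cbox a b) (?f n q)) has_field_derivative integral (cbox a b) (?f (Suc n) q)) (at q within UNIV)"
  proof (rule leibniz_rule_field_derivative[where U = UNIV and fx = "?f (Suc n)"])
    fix q t :: real
    have "((\<lambda>q. flat n (1 - t\<^sup>2 * q)) has_real_derivative flat (Suc n) (1 - t\<^sup>2 * q) * (- (t\<^sup>2))) (at q)"
      by (rule DERIV_chain2[where f = "flat n"])
        (use flat_derivative_chain in \<open>auto simp: derivative_chain_def intro!: derivative_eq_intros\<close>)
    from DERIV_cmult[OF this, of "w t * (- (t\<^sup>2)) ^ n"]
    show "((\<lambda>q. ?f n q t) has_field_derivative ?f (Suc n) q t) (at q within UNIV)"
      by (simp add: mult_ac)
  next
    show "?f n q integrable_on cbox a b" for q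
      using w by (auto intro!: integrable_continuous_interval continuous_intros)
  next
    have "continuous_on (UNIV \<times> cbox a b) (\<lambda>z. w (snd z))"
      by (rule continuous_on_compose2[OF w]) (auto intro!: continuous_intros)
    then show "continuous_on (UNIV \<times> cbox a b) (\<lambda>(q, t). ?f (Suc n) q t)"
      unfolding split_beta by (intro continuous_intros)
  qed auto
  then show "(flat_mean w a b n has_real_derivative flat_mean w a b (Suc n) q) (at q)"
    by (simp add: flat_mean_def[abs_def])
qed

text \<open>The factor a^N makes the integral independent of a. This integral is not normalised to
  1; it appears later as \<open>Z\<close>.\<close>

definition bump :: "real \<Rightarrow> 'a::euclidean_space \<Rightarrow> real" where
  "bump a x = a ^ DIM('a) * flat 1 (1 - a\<^sup>2 * (x \<bullet> x))"

text \<open>The weight is t^(N - 3) / 2, written as a quotient because N may be less than 3. It is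
  the factor for which the Laplacian in x of \<open>flat 0\<close> at 1 - t^2 |x|^2 becomes minus
  the t-derivative of \<open>bump t x\<close>.\<close>

definition bump_potential :: "real \<Rightarrow> real \<Rightarrow> 'a::euclidean_space \<Rightarrow> real" where
  "bump_potential a b x = flat_mean (\<lambda>t. t ^ DIM('a) / (2 * t ^ 3)) a b 0 (x \<bullet> x)"

definition bump_potential_partial :: "real \<Rightarrow> real \<Rightarrow> 'a \<Rightarrow> 'a::euclidean_space \<Rightarrow> real" where
  "bump_potential_partial a b e x = flat_mean (\<lambda>t. t ^ DIM('a) / (2 * t ^ 3)) a b 1 (x \<bullet> x) * (2 * (x \<bullet> e))"

context
  fixes a b :: real
  assumes ab: "0 < a" "a \<le> b"
begin

lemma bump_weight_chain: "derivative_chain (flat_mean (\<lambda>t. t ^ N / (2 * t ^ 3)) a b)"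
  using ab by (intro flat_mean_derivative_chain continuous_intros) auto

text \<open>Among the scales t >= a, the scale a has the largest support, so the mean over t is
  supported where a^2 q < 1.\<close>

lemma flat_mean_eq_0:
  assumes "1 \<le> a\<^sup>2 * q"
  shows "flat_mean w a b n q = 0"
proof -
  have "flat n (1 - t\<^sup>2 * q) = 0" if "t \<in> {a..b}" for t
  proof (rule flat_nonpos)
    have q: "q \<ge> 0" using assms ab by (smt (verit) mult_nonneg_nonpos zero_le_power2)
    have "a\<^sup>2 * q \<le> t\<^sup>2 * q" using that ab q by (intro mult_right_mono power_mono) auto
    then show "1 - t\<^sup>2 * q \<le> 0" using assms by linarith
  qed
  then have "integral {a..b} (\<lambda>t. w t * (- (t\<^sup>2)) ^ n * flat n (1 - t\<^sup>2 * q)) = integral {a..b} (\<lambda>_. 0)"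
    by (intro integral_cong) auto
  then show ?thesis by (simp add: flat_mean_def)
qed

lemma one_le_scaled_inner: "1 / a < norm x \<Longrightarrow> 1 \<le> a\<^sup>2 * (x \<bullet> x)"
proof -
  assume "1 / a < norm x"
  then have "1 < a * norm x" using ab by (simp add: field_simps)
  then have "1 \<le> (a * norm x)\<^sup>2" by (simp add: one_le_power)
  then show ?thesis by (simp add: power_mult_distrib power2_norm_eq_inner)
qed

lemma Ck_self_inner: "Ck k (\<lambda>x. x \<bullet> x)"
proof -
  have "Ck k (\<lambda>x. \<Sum>b\<in>Basis. (x \<bullet> b) * (x \<bullet> b))"
    by (intro Ck_sum Ck_mult Ck_inner finite_Basis)
  then show ?thesis by (simp flip: euclidean_inner)
qed

lemma test_function_bump_potential: "test_function (bump_potential a b)"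
  unfolding bump_potential_def[abs_def]
  by (rule test_function_cut[where R = "1 / a"])
     (auto intro!: Ck_compose_chain[OF bump_weight_chain] Ck_self_inner flat_mean_eq_0 one_le_scaled_inner)

lemma test_function_bump_potential_partial: "test_function (bump_potential_partial a b e)"
proof -
  show ?thesis
    unfolding bump_potential_partial_def[abs_def]
    by (intro test_function_cut[where R = "1 / a"] Ck_mult Ck_compose_chain[OF bump_weight_chain]
          Ck_self_inner Ck_const Ck_inner)
       (simp add: flat_mean_eq_0 one_le_scaled_inner)
qed

lemma flat_mean_inner_derivative:
  "((\<lambda>x. flat_mean (\<lambda>t. t ^ N / (2 * t ^ 3)) a b n (x \<bullet> x)) has_derivative
    (\<lambda>h. flat_mean (\<lambda>t. t ^ N / (2 * t ^ 3)) a b (Suc n) (x \<bullet> x) * (2 * (x \<bullet> h)))) (at x)"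
proof -
  have d: "((\<lambda>x. x \<bullet> x) has_derivative (\<lambda>h. 2 * (x \<bullet> h))) (at x)"
    by (auto intro!: derivative_eq_intros simp: inner_commute)
  have "(flat_mean (\<lambda>t. t ^ N / (2 * t ^ 3)) a b n has_real_derivative
      flat_mean (\<lambda>t. t ^ N / (2 * t ^ 3)) a b (Suc n) (x \<bullet> x)) (at (x \<bullet> x))"
    using bump_weight_chain by (simp add: derivative_chain_def)
  from DERIV_compose_FDERIV[OF this d] show ?thesis
    by (simp add: mult.commute)
qed

lemma frechet_derivative_bump_potential:
  "frechet_derivative (bump_potential a b) (at x) e = bump_potential_partial a b e x"
proof -
  have "(bump_potential a b has_derivative (\<lambda>h. bump_potential_partial a b h x)) (at x)"
    unfolding bump_potential_def[abs_def] bump_potential_partial_def One_nat_def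
    by (rule flat_mean_inner_derivative)
  from frechet_derivative_at[OF this, symmetric] show ?thesis by simp
qed

lemma frechet_derivative_bump_potential_partial:
  "frechet_derivative (bump_potential_partial a b e) (at (x :: 'a::euclidean_space)) e =
     4 * (x \<bullet> e)\<^sup>2 * flat_mean (\<lambda>t. t ^ DIM('a) / (2 * t ^ 3)) a b 2 (x \<bullet> x)
     + 2 * (e \<bullet> e) * flat_mean (\<lambda>t. t ^ DIM('a) / (2 * t ^ 3)) a b 1 (x \<bullet> x)"
proof -
  let ?E = "flat_mean (\<lambda>t. t ^ DIM('a) / (2 * t ^ 3)) a b"
  have "((\<lambda>x. 2 * (x \<bullet> e)) has_derivative (\<lambda>h. 2 * (h \<bullet> e))) (at x)"
    by (intro has_derivative_mult_right has_derivative_inner_left has_derivative_ident)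
  note has_derivative_mult[OF flat_mean_inner_derivative this]
  then have "(bump_potential_partial a b e has_derivative
      (\<lambda>h. ?E 1 (x \<bullet> x) * (2 * (h \<bullet> e)) + ?E 2 (x \<bullet> x) * (2 * (x \<bullet> h)) * (2 * (x \<bullet> e)))) (at x)"
    by (simp add: bump_potential_partial_def[abs_def] numeral_2_eq_2)
  from frechet_derivative_at[OF this, symmetric] show ?thesis
    by (simp add: power2_eq_square algebra_simps)
qed

text \<open>The kernel is chosen so that the Laplacian of the potential becomes an exact \<open>t\<close>-derivative.\<close>

lemma laplacian_bump_potential:
  "(\<Sum>e\<in>Basis. frechet_derivative (bump_potential_partial a b e) (at x) e) = bump a x - bump b x"
proof -
  let ?N = "DIM('a)"
  let ?w = "\<lambda>t::real. t ^ ?N / (2 * t ^ 3)"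
  let ?q = "x \<bullet> x"
  let ?f = "\<lambda>n t. ?w t * (- (t\<^sup>2)) ^ n * flat n (1 - t\<^sup>2 * ?q)"
  let ?g = "\<lambda>t. - (t ^ ?N * flat 1 (1 - t\<^sup>2 * ?q))"
  have int: "(?f n has_integral flat_mean ?w a b n ?q) {a..b}" for n
    unfolding flat_mean_def
    by (rule integrable_integral) (use ab in \<open>auto intro!: integrable_continuous_interval continuous_intros\<close>)
  \<comment> \<open>One integrand is integrated in two ways: by linearity in terms of
    \<open>flat_mean\<close>, and by the fundamental theorem of calculus as the derivative of
    \<open>?g\<close>. Uniqueness of the integral gives the identity.\<close>
  have L: "((\<lambda>t. 4 * ?q * ?f 2 t + 2 * ?N * ?f 1 t) has_integral
      4 * ?q * flat_mean ?w a b 2 ?q + 2 * ?N * flat_mean ?w a b 1 ?q) {a..b}"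
    using has_integral_add[OF has_integral_mult_right[OF int[of 2], of "4 * ?q"]
        has_integral_mult_right[OF int[of 1], of "2 * real ?N"]] by simp
  have R: "((\<lambda>t. 4 * ?q * ?f 2 t + 2 * ?N * ?f 1 t) has_integral ?g b - ?g a) {a..b}"
  proof (rule fundamental_theorem_of_calculus)
    fix t assume "t \<in> {a..b}"
    then have t: "t > 0" using ab by auto
    have fl: "((\<lambda>t. flat 1 (1 - t\<^sup>2 * ?q)) has_real_derivative flat 2 (1 - t\<^sup>2 * ?q) * (- (2 * t * ?q))) (at t)"
      by (rule DERIV_chain2[where f = "flat 1"])
        (use flat_derivative_chain in \<open>auto simp: derivative_chain_def numeral_2_eq_2 intro!: derivative_eq_intros\<close>)
    have "t ^ ?N = t * t ^ (?N - 1)" using DIM_positive[where 'a='a] by (simp flip: power_Suc)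
    then have eq: "- (real ?N * t ^ (?N - 1) * flat 1 (1 - t\<^sup>2 * ?q)
         + flat 2 (1 - t\<^sup>2 * ?q) * (- (2 * t * ?q)) * t ^ ?N) = 4 * ?q * ?f 2 t + 2 * ?N * ?f 1 t"
      using t by (simp add: field_simps power2_eq_square power3_eq_cube)
    have "(?g has_real_derivative 4 * ?q * ?f 2 t + 2 * ?N * ?f 1 t) (at t)"
      unfolding eq[symmetric]
      by (rule DERIV_minus) (rule derivative_eq_intros fl refl | simp)+
    then show "(?g has_vector_derivative 4 * ?q * ?f 2 t + 2 * ?N * ?f 1 t) (at t within {a..b})"
      by (simp add: has_real_derivative_iff_has_vector_derivative has_vector_derivative_at_within)
  qed (use ab in auto)
  have "4 * ?q * flat_mean ?w a b 2 ?q + 2 * ?N * flat_mean ?w a b 1 ?q = bump a x - bump b x"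
    using has_integral_unique[OF L R] by (simp only: bump_def)
  moreover have "(\<Sum>e\<in>Basis. frechet_derivative (bump_potential_partial a b e) (at x) e)
      = 4 * ?q * flat_mean ?w a b 2 ?q + 2 * ?N * flat_mean ?w a b 1 ?q"
  proof -
    have "?q = (\<Sum>e\<in>Basis. (x \<bullet> e)\<^sup>2)"
      unfolding power2_eq_square by (rule euclidean_inner)
    moreover have "(\<Sum>e\<in>(Basis :: 'a set). e \<bullet> e) = real ?N"
      by (simp add: inner_Basis)
    ultimately show ?thesis
      unfolding frechet_derivative_bump_potential_partial sum.distrib
      by (simp only: sum_distrib_left[symmetric] sum_distrib_right[symmetric])
  qed
  ultimately show ?thesis by simp
qed

end

section \<open>Convolution in \<open>L\<^sup>2\<close>\<close>

lemma lborel_nn_integral_affine: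
  fixes t :: "'a::euclidean_space"
  assumes [measurable]: "f \<in> borel_measurable borel" and c: "c \<noteq> 0"
  shows "(\<integral>\<^sup>+x. f x \<partial>lborel) = ennreal (\<bar>c\<bar> ^ DIM('a)) * (\<integral>\<^sup>+x. f (t + c *\<^sub>R x) \<partial>lborel)"
  by (subst lborel_affine[OF c, of t]) (simp add: nn_integral_density nn_integral_distr nn_integral_cmult)

lemma lborel_integrable_affine:
  fixes f :: "'a::euclidean_space \<Rightarrow> 'b::{banach, second_countable_topology}"
  assumes f: "integrable lborel f" and c: "c \<noteq> 0"
  shows "integrable lborel (\<lambda>x. f (t + c *\<^sub>R x))"
  using f f[THEN borel_measurable_integrable] c unfolding integrable_iff_bounded
  by (subst (asm) lborel_nn_integral_affine[where c=c and t=t]) (auto simp: ennreal_mult_less_top)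

lemma lborel_integrable_affine_iff:
  fixes f :: "'a::euclidean_space \<Rightarrow> 'b::{banach, second_countable_topology}"
  assumes c: "c \<noteq> 0"
  shows "integrable lborel (\<lambda>x. f (t + c *\<^sub>R x)) \<longleftrightarrow> integrable lborel f"
proof
  assume "integrable lborel (\<lambda>x. f (t + c *\<^sub>R x))"
  from lborel_integrable_affine[OF this, of "1 / c" "- (1 / c) *\<^sub>R t"] c
  show "integrable lborel f" by (simp add: algebra_simps)
qed (rule lborel_integrable_affine[OF _ c])

lemma lborel_integral_affine:
  fixes f :: "'a::euclidean_space \<Rightarrow> 'b::{banach, second_countable_topology}"
  assumes c: "c \<noteq> 0"
  shows "(\<integral>x. f x \<partial>lborel) = \<bar>c\<bar> ^ DIM('a) *\<^sub>R (\<integral>x. f (t + c *\<^sub>R x) \<partial>lborel)"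
proof cases
  assume f[measurable]: "integrable lborel f"
  then have "integrable lborel (\<lambda>x. f (t + c *\<^sub>R x))" by (rule lborel_integrable_affine[OF _ c])
  then show ?thesis
    using c f by (subst lborel_affine[OF c, of t]) (simp add: integral_density integral_distr)
next
  assume "\<not> integrable lborel f"
  then show ?thesis using c by (simp add: lborel_integrable_affine_iff not_integrable_integral_eq)
qed

text \<open>The integral of (f s - g t)^2 is a nonnegative quadratic form in (s, t), and suitable
  values of s and t give the inequality.\<close>

lemma Cauchy_Schwarz_integral:
  fixes f g :: "'a \<Rightarrow> real"
  assumes f: "integrable M (\<lambda>x. (f x)\<^sup>2)" and g: "integrable M (\<lambda>x. (g x)\<^sup>2)"
    and fg: "integrable M (\<lambda>x. f x * g x)"
  shows "(\<integral>x. f x * g x \<partial>M)\<^sup>2 \<le> (\<integral>x. (f x)\<^sup>2 \<partial>M) * (\<integral>x. (g x)\<^sup>2 \<partial>M)"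
proof -
  define F G X where "F = (\<integral>x. (f x)\<^sup>2 \<partial>M)" and "G = (\<integral>x. (g x)\<^sup>2 \<partial>M)" and "X = (\<integral>x. f x * g x \<partial>M)"
  have "F * s\<^sup>2 - 2 * X * s * t + G * t\<^sup>2 \<ge> 0" for s t
  proof -
    have "(\<integral>x. (f x * s - g x * t)\<^sup>2 \<partial>M) = (\<integral>x. (f x)\<^sup>2 * s\<^sup>2 - f x * g x * (2 * s * t) + (g x)\<^sup>2 * t\<^sup>2 \<partial>M)"
      by (intro arg_cong[where f = "integral\<^sup>L M"] ext) (simp add: power2_eq_square algebra_simps)
    also have "\<dots> = F * s\<^sup>2 - X * (2 * s * t) + G * t\<^sup>2"
      using assms by (simp add: F_def G_def X_def)
    finally have "F * s\<^sup>2 - X * (2 * s * t) + G * t\<^sup>2 = (\<integral>x. (f x * s - g x * t)\<^sup>2 \<partial>M)" ..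
    also have "\<dots> \<ge> 0" by simp
    finally show ?thesis by (simp add: algebra_simps)
  qed
  \<comment> \<open>The point (G, X) settles the case G > 0. The point (X, F + 1) settles G = 0,
    where it says (F + 2) X^2 <= 0 and so forces X = 0.\<close>
  from this[of G X] this[of X "F + 1"]
  have 1: "G * (F * G - X\<^sup>2) \<ge> 0" and 2: "F * X\<^sup>2 - 2 * X\<^sup>2 * (F + 1) + G * (F + 1)\<^sup>2 \<ge> 0"
    by (simp_all add: power2_eq_square algebra_simps)
  have "F \<ge> 0" "G \<ge> 0" by (simp_all add: F_def G_def)
  show ?thesis
  proof (cases "G = 0")
    case True
    then have "(F + 2) * X\<^sup>2 \<le> 0" using 2 by (simp add: algebra_simps)
    then have "X\<^sup>2 \<le> 0" using \<open>F \<ge> 0\<close> by (smt (verit) mult_pos_pos)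
    then show ?thesis using True by (simp add: F_def[symmetric] G_def[symmetric] X_def[symmetric])
  next
    case False
    then have "X\<^sup>2 \<le> F * G" using 1 \<open>G \<ge> 0\<close> by (simp add: zero_le_mult_iff)
    then show ?thesis by (simp add: F_def G_def X_def)
  qed
qed

lemma L2_measurable: "u \<in> L2 \<Longrightarrow> u \<in> borel_measurable borel"
  by (simp add: L2_def)

lemma L2_integrable: "u \<in> L2 \<Longrightarrow> integrable lborel (\<lambda>x. (norm (u x))\<^sup>2)"
  by (simp add: L2_def)

lemma norm_add_squared_le: "(norm (x + y))\<^sup>2 \<le> 2 * (norm x)\<^sup>2 + 2 * (norm y)\<^sup>2"
  for x y :: "'a::real_normed_vector"
proof -
  have "(norm (x + y))\<^sup>2 \<le> (norm x + norm y)\<^sup>2" by (intro power_mono norm_triangle_ineq) auto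
  also have "\<dots> \<le> 2 * (norm x)\<^sup>2 + 2 * (norm y)\<^sup>2"
    using sum_squares_bound[of "norm x" "norm y"] by (simp add: power2_sum)
  finally show ?thesis .
qed

lemma L2_add:
  assumes "u \<in> L2" "v \<in> L2"
  shows "(\<lambda>x. u x + v x) \<in> L2"
proof -
  note [measurable] = assms[THEN L2_measurable]
  have "integrable lborel (\<lambda>x. (norm (u x + v x))\<^sup>2)"
    by (rule Bochner_Integration.integrable_bound
          [where f = "\<lambda>x. 2 * (norm (u x))\<^sup>2 + 2 * (norm (v x))\<^sup>2"])
       (auto intro!: L2_integrable assms norm_add_squared_le)
  then show ?thesis by (simp add: L2_def)
qed

lemma L2_scaleR: "u \<in> L2 \<Longrightarrow> (\<lambda>x. c *\<^sub>R u x) \<in> L2"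
  by (auto simp: L2_def power_mult_distrib)

lemma L2_zero: "(\<lambda>x. 0) \<in> L2"
  by (simp add: L2_def)

lemma L2_sum: "finite I \<Longrightarrow> (\<And>i. i \<in> I \<Longrightarrow> f i \<in> L2) \<Longrightarrow> (\<lambda>x. \<Sum>i\<in>I. f i x) \<in> L2"
  by (induction rule: finite_induct) (auto intro: L2_zero L2_add)

lemma L2_affine_arg:
  assumes "u \<in> L2" "c \<noteq> 0"
  shows "(\<lambda>x. u (t + c *\<^sub>R x)) \<in> L2"
  using assms lborel_integrable_affine[OF L2_integrable[OF assms(1)] assms(2)]
  by (auto simp: L2_def)

text \<open>This class contains test functions, bumps and box indicators, and is stable under
  absolute value, squares and reflection. It makes the convolution with an \<open>L2\<close>
  function an absolutely convergent integral at every point, not just almost everywhere.\<close>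

definition kernel :: "('a::euclidean_space \<Rightarrow> real) \<Rightarrow> bool" where
  "kernel k \<longleftrightarrow> k \<in> borel_measurable borel \<and> (\<exists>B. \<forall>x. \<bar>k x\<bar> \<le> B) \<and> (\<exists>R. \<forall>x. R < norm x \<longrightarrow> k x = 0)"

lemma kernel_measurable: "kernel k \<Longrightarrow> k \<in> borel_measurable borel"
  by (simp add: kernel_def)

lemma kernel_integrable:
  fixes k :: "'a::euclidean_space \<Rightarrow> real"
  assumes "kernel k" shows "integrable lborel k"
proof -
  obtain B R where B: "\<And>x. \<bar>k x\<bar> \<le> B" and R: "\<And>x. R < norm x \<Longrightarrow> k x = 0"
    using assms by (auto simp: kernel_def)
  have "norm (k x) \<le> norm (indicator (cball 0 R) x * B)" for x
    using B[of x] R[of x] by (auto simp: indicator_def)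
  moreover have "integrable lborel (\<lambda>x :: 'a. indicator (cball 0 R) x * B)"
    using emeasure_bounded_finite[of "cball (0 :: 'a) R"]
    by (intro integrable_mult_left integrable_real_indicator) auto
  ultimately show ?thesis
    using kernel_measurable[OF assms]
    by (intro Bochner_Integration.integrable_bound[of _ "\<lambda>x. indicator (cball 0 R) x * B" k]) auto
qed

lemma kernel_abs: "kernel k \<Longrightarrow> kernel (\<lambda>x. \<bar>k x\<bar>)"
  by (auto simp: kernel_def)

lemma kernel_power2: "kernel k \<Longrightarrow> kernel (\<lambda>x. (k x)\<^sup>2)"
  unfolding kernel_def
  by (auto, metis abs_ge_zero power2_abs power_mono)

lemma kernel_continuous:
  assumes "continuous_on UNIV k" and "\<And>x. R < norm x \<Longrightarrow> k x = 0"
  shows "kernel k"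
proof -
  have "bounded (k ` cball 0 R)"
    using assms(1) by (intro compact_imp_bounded compact_continuous_image) (auto intro: continuous_on_subset)
  then obtain B where "B > 0" "\<forall>x\<in>cball 0 R. \<bar>k x\<bar> \<le> B" by (auto simp: bounded_pos)
  then have "\<bar>k x\<bar> \<le> B" for x using assms(2)[of x] by (cases "R < norm x") auto
  then show ?thesis
    using assms(2) borel_measurable_continuous_onI[OF assms(1)] by (auto simp: kernel_def)
qed

lemma kernel_test_function: "test_function \<phi> \<Longrightarrow> kernel \<phi>"
  by (rule test_function_bounded_support[of \<phi>], assumption, rule kernel_continuous)
     (auto simp: test_function_def dest: spec[of _ 0])

lemma integrable_reflect:
  fixes f :: "'a::euclidean_space \<Rightarrow> 'b::{banach, second_countable_topology}"
  shows "integrable lborel f \<Longrightarrow> integrable lborel (\<lambda>y. f (x - y))"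
  using lborel_integrable_affine[of f "-1" x] by simp

lemma integral_reflect:
  fixes f :: "'a::euclidean_space \<Rightarrow> 'b::{banach, second_countable_topology}"
  shows "(\<integral>y. f (x - y) \<partial>lborel) = (\<integral>y. f y \<partial>lborel)"
  using lborel_integral_affine[of "-1" f x] by simp

lemma integrable_kernel_scaleR:
  fixes u :: "'a::euclidean_space \<Rightarrow> 'k::euclidean_space"
  assumes k: "kernel k" and u: "u \<in> L2"
  shows "integrable lborel (\<lambda>y. k y *\<^sub>R u y)"
proof (rule Bochner_Integration.integrable_bound)
  show "integrable lborel (\<lambda>y. (k y)\<^sup>2 + (norm (u y))\<^sup>2)"
    using kernel_integrable[OF kernel_power2[OF k]] L2_integrable[OF u] by simp
  show "(\<lambda>y. k y *\<^sub>R u y) \<in> borel_measurable lborel"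
    using kernel_measurable[OF k] L2_measurable[OF u] by simp
  have "norm (k y *\<^sub>R u y) \<le> (k y)\<^sup>2 + (norm (u y))\<^sup>2" for y
  proof -
    have "2 * (\<bar>k y\<bar> * norm (u y)) \<le> (k y)\<^sup>2 + (norm (u y))\<^sup>2"
      using sum_squares_bound[of "\<bar>k y\<bar>" "norm (u y)"] by (simp add: mult.assoc)
    moreover have "0 \<le> \<bar>k y\<bar> * norm (u y)" by simp
    ultimately have "\<bar>k y\<bar> * norm (u y) \<le> (k y)\<^sup>2 + (norm (u y))\<^sup>2" by linarith
    then show ?thesis by simp
  qed
  then show "AE y in lborel. norm (k y *\<^sub>R u y) \<le> norm ((k y)\<^sup>2 + (norm (u y))\<^sup>2)"
    by (intro AE_I2) (smt (verit) real_norm_def)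
qed

lemma kernel_reflect: "kernel k \<Longrightarrow> kernel (\<lambda>y. k (x - y))"
proof -
  assume k: "kernel k"
  then obtain B R where B: "\<And>x. \<bar>k x\<bar> \<le> B" and R: "\<And>x. R < norm x \<Longrightarrow> k x = 0"
    by (auto simp: kernel_def)
  have "k (x - y) = 0" if "R + norm x < norm y" for y
    using R[of "x - y"] norm_triangle_ineq2[of y x] that by (simp add: norm_minus_commute)
  then show ?thesis
    using B kernel_measurable[OF k] unfolding kernel_def by (intro conjI exI allI impI) auto
qed

definition conv :: "('a::euclidean_space \<Rightarrow> real) \<Rightarrow> ('a \<Rightarrow> 'k::euclidean_space) \<Rightarrow> 'a \<Rightarrow> 'k" where
  "conv k u x = (\<integral>y. k (x - y) *\<^sub>R u y \<partial>lborel)"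

lemma conv_commute: "conv k u x = (\<integral>z. k z *\<^sub>R u (x - z) \<partial>lborel)"
  unfolding conv_def using integral_reflect[of "\<lambda>z. k z *\<^sub>R u (x - z)" x] by simp

lemma conv_integrable: "kernel k \<Longrightarrow> u \<in> L2 \<Longrightarrow> integrable lborel (\<lambda>y. k (x - y) *\<^sub>R u y)"
  by (rule integrable_kernel_scaleR[OF kernel_reflect])

lemma conv_measurable [measurable]:
  assumes [measurable]: "k \<in> borel_measurable borel" "u \<in> borel_measurable borel"
  shows "conv k u \<in> borel_measurable borel"
proof -
  have "(\<lambda>x. \<integral>y. k (x - y) *\<^sub>R u y \<partial>lborel) \<in> borel_measurable lborel"
    by (rule lborel.borel_measurable_lebesgue_integral) (simp add: split_beta')
  then show ?thesis by (simp add: conv_def[abs_def])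
qed

lemma conv_add:
  "kernel k \<Longrightarrow> u \<in> L2 \<Longrightarrow> v \<in> L2 \<Longrightarrow> conv k (\<lambda>x. u x + v x) x = conv k u x + conv k v x"
  unfolding conv_def scaleR_right_distrib by (intro Bochner_Integration.integral_add conv_integrable)

lemma conv_sum:
  assumes "finite I" "kernel k" "\<And>i. i \<in> I \<Longrightarrow> f i \<in> L2"
  shows "conv k (\<lambda>x. \<Sum>i\<in>I. f i x) x = (\<Sum>i\<in>I. conv k (f i) x)"
  unfolding conv_def scaleR_sum_right
  using assms by (intro Bochner_Integration.integral_sum conv_integrable)

lemma conv_scaleR: "conv k (\<lambda>x. c *\<^sub>R u x) x = c *\<^sub>R conv k u x"
proof -
  have "k (x - y) *\<^sub>R c *\<^sub>R u y = c *\<^sub>R (k (x - y) *\<^sub>R u y)" for y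
    by (simp add: mult.commute)
  then show ?thesis
    unfolding conv_def by (simp only: integral_scaleR_right)
qed

lemma norm_conv_squared_le:
  assumes k: "kernel k" and u: "u \<in> L2"
  shows "(norm (conv k u x))\<^sup>2 \<le> (\<integral>y. (k y)\<^sup>2 \<partial>lborel) * (\<integral>y. (norm (u y))\<^sup>2 \<partial>lborel)"
proof -
  have i: "integrable lborel (\<lambda>y. \<bar>k (x - y)\<bar> * norm (u y))"
    using integrable_norm[OF conv_integrable[OF k u]] by simp
  have "norm (conv k u x) \<le> (\<integral>y. norm (k (x - y) *\<^sub>R u y) \<partial>lborel)"
    unfolding conv_def by (rule integral_norm_bound)
  then have "(norm (conv k u x))\<^sup>2 \<le> (\<integral>y. \<bar>k (x - y)\<bar> * norm (u y) \<partial>lborel)\<^sup>2"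
    by (intro power_mono) auto
  also have "\<dots> \<le> (\<integral>y. (\<bar>k (x - y)\<bar>)\<^sup>2 \<partial>lborel) * (\<integral>y. (norm (u y))\<^sup>2 \<partial>lborel)"
    using i kernel_integrable[OF kernel_power2[OF kernel_reflect[OF k]]] L2_integrable[OF u]
    by (intro Cauchy_Schwarz_integral) auto
  also have "(\<integral>y. (\<bar>k (x - y)\<bar>)\<^sup>2 \<partial>lborel) = (\<integral>y. (k y)\<^sup>2 \<partial>lborel)"
    using integral_reflect[of "\<lambda>y. (k y)\<^sup>2" x] by simp
  finally show ?thesis .
qed

text \<open>Cauchy-Schwarz with the kernel split evenly, as sqrt |k| times sqrt |k| |u|. The second
  factor can then be integrated in x by Tonelli and contributes the L1 norm of k once more.\<close>

lemma conv_Young_pointwise: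
  assumes k: "kernel k" and u: "u \<in> L2"
  shows "integrable lborel (\<lambda>y. \<bar>k (x - y)\<bar> * (norm (u y))\<^sup>2)"
    and "(norm (conv k u x))\<^sup>2 \<le> (\<integral>y. \<bar>k y\<bar> \<partial>lborel) * (\<integral>y. \<bar>k (x - y)\<bar> * (norm (u y))\<^sup>2 \<partial>lborel)"
proof -
  obtain B where B: "\<And>x. \<bar>k x\<bar> \<le> B" using k by (auto simp: kernel_def)
  note [measurable] = kernel_measurable[OF k] L2_measurable[OF u]
  show j: "integrable lborel (\<lambda>y. \<bar>k (x - y)\<bar> * (norm (u y))\<^sup>2)"
  proof (rule Bochner_Integration.integrable_bound)
    show "integrable lborel (\<lambda>y. B * (norm (u y))\<^sup>2)" using L2_integrable[OF u] by simp
    have "B \<ge> 0" using B[of 0] by simp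
    then show "AE y in lborel. norm (\<bar>k (x - y)\<bar> * (norm (u y))\<^sup>2) \<le> norm (B * (norm (u y))\<^sup>2)"
      using B by (auto simp: abs_mult intro!: mult_right_mono)
  qed simp
  have i: "integrable lborel (\<lambda>y. \<bar>k (x - y)\<bar> * norm (u y))"
    using integrable_norm[OF conv_integrable[OF k u]] by simp
  have sq: "sqrt \<bar>k (x - y)\<bar> * (sqrt \<bar>k (x - y)\<bar> * norm (u y)) = \<bar>k (x - y)\<bar> * norm (u y)" for y
    by (simp flip: mult.assoc)
  have "norm (conv k u x) \<le> (\<integral>y. norm (k (x - y) *\<^sub>R u y) \<partial>lborel)"
    unfolding conv_def by (rule integral_norm_bound)
  then have "(norm (conv k u x))\<^sup>2 \<le> (\<integral>y. sqrt \<bar>k (x - y)\<bar> * (sqrt \<bar>k (x - y)\<bar> * norm (u y)) \<partial>lborel)\<^sup>2"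
    unfolding sq by (intro power_mono) auto
  also have "\<dots> \<le> (\<integral>y. (sqrt \<bar>k (x - y)\<bar>)\<^sup>2 \<partial>lborel) * (\<integral>y. (sqrt \<bar>k (x - y)\<bar> * norm (u y))\<^sup>2 \<partial>lborel)"
    using i j kernel_integrable[OF kernel_abs[OF kernel_reflect[OF k]], of x] unfolding sq[symmetric]
    by (intro Cauchy_Schwarz_integral) (simp_all add: power_mult_distrib sq)
  also have "\<dots> = (\<integral>y. \<bar>k y\<bar> \<partial>lborel) * (\<integral>y. \<bar>k (x - y)\<bar> * (norm (u y))\<^sup>2 \<partial>lborel)"
    using integral_reflect[of "\<lambda>y. \<bar>k y\<bar>" x] by (simp add: power_mult_distrib)
  finally show "(norm (conv k u x))\<^sup>2 \<le> (\<integral>y. \<bar>k y\<bar> \<partial>lborel) * (\<integral>y. \<bar>k (x - y)\<bar> * (norm (u y))\<^sup>2 \<partial>lborel)" .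
qed

text \<open>Stated for the nonnegative integral, so that membership of the convolution in
  \<open>L2\<close> is a consequence and not a premise.\<close>

lemma conv_Young:
  fixes u :: "'a::euclidean_space \<Rightarrow> 'k::euclidean_space"
  assumes k: "kernel k" and u: "u \<in> L2"
  shows "(\<integral>\<^sup>+x. ennreal ((norm (conv k u x))\<^sup>2) \<partial>lborel)
     \<le> ennreal ((\<integral>y. \<bar>k y\<bar> \<partial>lborel)\<^sup>2 * (\<integral>y. (norm (u y))\<^sup>2 \<partial>lborel))"
proof -
  note [measurable] = kernel_measurable[OF k] L2_measurable[OF u]
  define K where "K = (\<integral>y. \<bar>k y\<bar> \<partial>lborel)"
  have K: "K \<ge> 0" by (simp add: K_def)
  have Kn: "(\<integral>\<^sup>+x. ennreal \<bar>k (x - y)\<bar> \<partial>lborel) = ennreal K" for y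
  proof -
    have "(\<integral>\<^sup>+x. ennreal \<bar>k (x - y)\<bar> \<partial>lborel) = (\<integral>\<^sup>+x. ennreal \<bar>k x\<bar> \<partial>lborel)"
      using lborel_nn_integral_affine[of "\<lambda>x. ennreal \<bar>k x\<bar>" 1 "- y"] by simp
    also have "\<dots> = ennreal K"
      unfolding K_def by (intro nn_integral_eq_integral kernel_integrable kernel_abs k) auto
    finally show ?thesis .
  qed
  have "(\<integral>\<^sup>+x. ennreal ((norm (conv k u x))\<^sup>2) \<partial>lborel)
      \<le> (\<integral>\<^sup>+x. ennreal K * (\<integral>\<^sup>+y. ennreal \<bar>k (x - y)\<bar> * ennreal ((norm (u y))\<^sup>2) \<partial>lborel) \<partial>lborel)"
  proof (rule nn_integral_mono)
    fix x
    have "ennreal ((norm (conv k u x))\<^sup>2) \<le> ennreal (K * (\<integral>y. \<bar>k (x - y)\<bar> * (norm (u y))\<^sup>2 \<partial>lborel))"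
      unfolding K_def by (intro ennreal_leI conv_Young_pointwise k u)
    also have "\<dots> = ennreal K * ennreal (\<integral>y. \<bar>k (x - y)\<bar> * (norm (u y))\<^sup>2 \<partial>lborel)"
      using K by (intro ennreal_mult) auto
    also have "ennreal (\<integral>y. \<bar>k (x - y)\<bar> * (norm (u y))\<^sup>2 \<partial>lborel)
       = (\<integral>\<^sup>+y. ennreal \<bar>k (x - y)\<bar> * ennreal ((norm (u y))\<^sup>2) \<partial>lborel)"
      by (subst nn_integral_eq_integral[symmetric])
         (auto intro: conv_Young_pointwise k u simp: ennreal_mult)
    finally show "ennreal ((norm (conv k u x))\<^sup>2)
      \<le> ennreal K * (\<integral>\<^sup>+y. ennreal \<bar>k (x - y)\<bar> * ennreal ((norm (u y))\<^sup>2) \<partial>lborel)" .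
  qed
  also have "\<dots> = ennreal K * (\<integral>\<^sup>+x. (\<integral>\<^sup>+y. ennreal \<bar>k (x - y)\<bar> * ennreal ((norm (u y))\<^sup>2) \<partial>lborel) \<partial>lborel)"
    by (rule nn_integral_cmult) measurable
  also have "(\<integral>\<^sup>+x. (\<integral>\<^sup>+y. ennreal \<bar>k (x - y)\<bar> * ennreal ((norm (u y))\<^sup>2) \<partial>lborel) \<partial>lborel)
      = (\<integral>\<^sup>+y. (\<integral>\<^sup>+x. ennreal \<bar>k (x - y)\<bar> * ennreal ((norm (u y))\<^sup>2) \<partial>lborel) \<partial>lborel)"
    by (rule lborel_pair.Fubini') measurable
  also have "\<dots> = (\<integral>\<^sup>+y. ennreal K * ennreal ((norm (u y))\<^sup>2) \<partial>lborel)"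
    by (simp add: nn_integral_multc Kn)
  also have "\<dots> = ennreal K * (\<integral>\<^sup>+y. ennreal ((norm (u y))\<^sup>2) \<partial>lborel)"
    by (rule nn_integral_cmult) measurable
  also have "(\<integral>\<^sup>+y. ennreal ((norm (u y))\<^sup>2) \<partial>lborel) = ennreal (\<integral>y. (norm (u y))\<^sup>2 \<partial>lborel)"
    by (rule nn_integral_eq_integral[OF L2_integrable[OF u]]) simp
  also have "ennreal K * (ennreal K * \<dots>) = ennreal (K\<^sup>2 * (\<integral>y. (norm (u y))\<^sup>2 \<partial>lborel))"
    using K by (simp add: ennreal_mult power2_eq_square mult.assoc)
  finally show ?thesis by (simp add: K_def)
qed

lemma conv_L2:
  assumes k: "kernel k" and u: "u \<in> L2"
  shows "conv k u \<in> L2"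
proof -
  note [measurable] = kernel_measurable[OF k] L2_measurable[OF u]
  have "integrable lborel (\<lambda>x. (norm (conv k u x))\<^sup>2)"
    unfolding integrable_iff_bounded
    using conv_Young[OF assms] by (auto simp: less_top[symmetric] top_unique)
  then show ?thesis by (simp add: L2_def)
qed

text \<open>For fixed x the function y -> \<phi>(x - y) is an admissible test function; the sign
  from the reflection cancels the sign in the definition of the weak derivative.\<close>

lemma conv_partial:
  assumes \<phi>: "test_function \<phi>" and uv: "weak_partial b u v"
  shows "conv (\<lambda>x. frechet_derivative \<phi> (at x) b) u x = conv \<phi> v x"
proof -
  define \<psi> where "\<psi> = (\<lambda>y. \<phi> ((-1) *\<^sub>R y + x))"
  have "test_function \<psi>" unfolding \<psi>_def by (intro test_function_affine_arg \<phi>) simp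
  with uv have "(\<integral>y. frechet_derivative \<psi> (at y) b *\<^sub>R u y \<partial>lborel) = - (\<integral>y. \<psi> y *\<^sub>R v y \<partial>lborel)"
    unfolding weak_partial_def by blast
  moreover have "frechet_derivative \<psi> (at y) b = - frechet_derivative \<phi> (at (x - y)) b" for y
    unfolding \<psi>_def frechet_derivative_affine_arg[OF \<phi>] by simp
  ultimately show ?thesis
    by (simp add: conv_def \<psi>_def)
qed

section \<open>Approximation by radial bumps\<close>

lemma nn_integral_integral_Icc:
  fixes f :: "real \<Rightarrow> real"
  assumes "f integrable_on {a..b}" and "\<And>t. t \<in> {a..b} \<Longrightarrow> 0 \<le> f t"
  shows "(\<integral>\<^sup>+t. ennreal (indicator {a..b} t * f t) \<partial>lborel) = ennreal (integral {a..b} f)"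
  using nn_integral_has_integral_lebesgue[OF _ integrable_integral[OF assms(1)]] assms(2)
  by (metis (no_types, lifting) nn_integral_completion nn_integral_cong)

text \<open>All dilates t^N \<Phi>(t x) have the L1 norm of \<Phi>, so after exchanging the
  integrals only the integral of the weight \<open>s\<close> remains.\<close>

lemma dilation_mean_L1:
  fixes f \<Phi> :: "'a::euclidean_space \<Rightarrow> real"
  assumes a: "0 < a" and \<Phi>: "integrable lborel \<Phi>" "continuous_on UNIV \<Phi>" "\<And>x. 0 \<le> \<Phi> x"
    and s: "s \<in> borel_measurable borel" "continuous_on {a..b} s" "\<And>t. t \<in> {a..b} \<Longrightarrow> 0 \<le> s t"
    and f: "f \<in> borel_measurable borel"
      "\<And>x. \<bar>f x\<bar> \<le> integral {a..b} (\<lambda>t. t ^ DIM('a) * s t * \<Phi> (t *\<^sub>R x))"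
  shows "(\<integral>\<^sup>+x. ennreal \<bar>f x\<bar> \<partial>lborel) \<le> ennreal ((\<integral>x. \<Phi> x \<partial>lborel) * integral {a..b} s)"
proof -
  note [measurable] = s(1) f(1) borel_measurable_continuous_onI[OF \<Phi>(2)]
  let ?g = "\<lambda>t x. t ^ DIM('a) * s t * \<Phi> (t *\<^sub>R x)"
  have cont: "continuous_on {a..b} (\<lambda>t. \<Phi> (t *\<^sub>R x))" for x
    by (rule continuous_on_compose2[OF \<Phi>(2)]) (auto intro!: continuous_intros)
  have "(\<integral>\<^sup>+x. ennreal \<bar>f x\<bar> \<partial>lborel)
      \<le> (\<integral>\<^sup>+x. (\<integral>\<^sup>+t. ennreal (indicator {a..b} t * ?g t x) \<partial>lborel) \<partial>lborel)"
  proof (rule nn_integral_mono)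
    fix x
    have "(\<integral>\<^sup>+t. ennreal (indicator {a..b} t * ?g t x) \<partial>lborel) = ennreal (integral {a..b} (\<lambda>t. ?g t x))"
      using a s(3) \<Phi>(3)
      by (intro nn_integral_integral_Icc integrable_continuous_interval continuous_intros s(2) cont) auto
    then show "ennreal \<bar>f x\<bar> \<le> (\<integral>\<^sup>+t. ennreal (indicator {a..b} t * ?g t x) \<partial>lborel)"
      using f(2)[of x] by (simp add: ennreal_leI)
  qed
  also have "\<dots> = (\<integral>\<^sup>+t. (\<integral>\<^sup>+x. ennreal (indicator {a..b} t * ?g t x) \<partial>lborel) \<partial>lborel)"
    by (rule lborel_pair.Fubini') measurable
  also have "\<dots> = (\<integral>\<^sup>+t. ennreal (\<integral>x. \<Phi> x \<partial>lborel) * ennreal (indicator {a..b} t * s t) \<partial>lborel)"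
  proof (rule nn_integral_cong)
    fix t :: real
    show "(\<integral>\<^sup>+x. ennreal (indicator {a..b} t * ?g t x) \<partial>lborel)
        = ennreal (\<integral>x. \<Phi> x \<partial>lborel) * ennreal (indicator {a..b} t * s t)"
    proof (cases "t \<in> {a..b}")
      case True
      then have t: "t > 0" and st: "s t \<ge> 0" using a s(3) by auto
      have "(\<integral>\<^sup>+x. ennreal (?g t x) \<partial>lborel)
          = (\<integral>\<^sup>+x. ennreal (s t) * (ennreal (t ^ DIM('a)) * ennreal (\<Phi> (t *\<^sub>R x))) \<partial>lborel)"
        using t st \<Phi>(3) by (intro nn_integral_cong) (simp flip: ennreal_mult add: mult_ac)
      also have "\<dots> = ennreal (s t) * (ennreal (t ^ DIM('a)) * (\<integral>\<^sup>+x. ennreal (\<Phi> (t *\<^sub>R x)) \<partial>lborel))"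
        by (simp add: nn_integral_cmult)
      also have "ennreal (t ^ DIM('a)) * (\<integral>\<^sup>+x. ennreal (\<Phi> (t *\<^sub>R x)) \<partial>lborel) = (\<integral>\<^sup>+x. ennreal (\<Phi> x) \<partial>lborel)"
        using lborel_nn_integral_affine[of "\<lambda>x. ennreal (\<Phi> x)" t 0] t by simp
      also have "\<dots> = ennreal (\<integral>x. \<Phi> x \<partial>lborel)"
        by (rule nn_integral_eq_integral[OF \<Phi>(1)]) (simp add: \<Phi>(3))
      finally show ?thesis using True by (simp add: mult.commute)
    qed simp
  qed
  also have "\<dots> = ennreal (\<integral>x. \<Phi> x \<partial>lborel) * ennreal (integral {a..b} s)"
    using nn_integral_integral_Icc[OF integrable_continuous_interval[OF s(2)] s(3)]
    by (simp add: nn_integral_cmult)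
  also have "\<dots> = ennreal ((\<integral>x. \<Phi> x \<partial>lborel) * integral {a..b} s)"
    using s by (intro ennreal_mult[symmetric] Bochner_Integration.integral_nonneg \<Phi> integral_nonneg
        integrable_continuous_interval) auto
  finally show ?thesis .
qed

lemma kernel_L1_le:
  assumes "kernel k" "(\<integral>\<^sup>+x. ennreal \<bar>k x\<bar> \<partial>lborel) \<le> ennreal C" "0 \<le> C"
  shows "(\<integral>x. \<bar>k x\<bar> \<partial>lborel) \<le> C"
  using assms(2,3) nn_integral_eq_integral[OF kernel_integrable[OF kernel_abs[OF assms(1)]]]
  by (simp add: ennreal_le_iff)

lemma one_minus_scaled_inner: "1 - (t *\<^sub>R x) \<bullet> (t *\<^sub>R x) = 1 - t\<^sup>2 * (x \<bullet> x)"
  by (simp add: power2_eq_square)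

lemma kernel_flat_profile: "kernel (\<lambda>x::'a::euclidean_space. (norm x) ^ m * flat n (1 - x \<bullet> x))"
proof (rule kernel_continuous[where R = 1])
  fix x :: 'a assume "1 < norm x"
  then have "1 \<le> (norm x)\<^sup>2" by (simp add: one_le_power)
  then show "(norm x) ^ m * flat n (1 - x \<bullet> x) = 0"
    by (simp add: flat_nonpos power2_norm_eq_inner)
qed (intro continuous_intros)

text \<open>The bound is uniform in b, which later allows the finer scale to tend to infinity. The
  rate 1 / a^2 is the gain from two derivatives.\<close>

lemma integral_inverse_cube:
  assumes "0 < a" "a \<le> b"
  shows "integral {a..b} (\<lambda>t::real. 1 / (2 * t ^ 3)) \<le> 1 / a\<^sup>2"
proof -
  have "((\<lambda>t::real. 1 / (2 * t ^ 3)) has_integral (- (1 / (4 * b\<^sup>2)) - (- (1 / (4 * a\<^sup>2))))) {a..b}"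
  proof (rule fundamental_theorem_of_calculus)
    fix t assume "t \<in> {a..b}"
    then have "t > 0" using assms by auto
    then have "((\<lambda>t::real. - (1 / (4 * t\<^sup>2))) has_real_derivative 1 / (2 * t ^ 3)) (at t)"
      by (auto intro!: derivative_eq_intros simp: field_simps power2_eq_square power3_eq_cube)
    then show "((\<lambda>t::real. - (1 / (4 * t\<^sup>2))) has_vector_derivative 1 / (2 * t ^ 3)) (at t within {a..b})"
      by (simp add: has_real_derivative_iff_has_vector_derivative has_vector_derivative_at_within)
  qed (use assms in auto)
  then have "integral {a..b} (\<lambda>t::real. 1 / (2 * t ^ 3)) = 1 / (4 * a\<^sup>2) - 1 / (4 * b\<^sup>2)"
    by (simp add: integral_unique)
  also have "\<dots> \<le> 1 / (4 * a\<^sup>2)" by simp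
  also have "\<dots> \<le> 1 / a\<^sup>2" using assms by (simp add: field_simps)
  finally show ?thesis .
qed

lemma integral_inverse_square:
  assumes "0 < a" "a \<le> b"
  shows "integral {a..b} (\<lambda>t::real. 1 / t\<^sup>2) \<le> 1 / a"
proof -
  have "((\<lambda>t::real. 1 / t\<^sup>2) has_integral (- (1 / b) - (- (1 / a)))) {a..b}"
  proof (rule fundamental_theorem_of_calculus)
    fix t assume "t \<in> {a..b}"
    then have "t > 0" using assms by auto
    then have "((\<lambda>t::real. - (1 / t)) has_real_derivative 1 / t\<^sup>2) (at t)"
      by (auto intro!: derivative_eq_intros simp: field_simps power2_eq_square)
    then show "((\<lambda>t::real. - (1 / t)) has_vector_derivative 1 / t\<^sup>2) (at t within {a..b})"
      by (simp add: has_real_derivative_iff_has_vector_derivative has_vector_derivative_at_within)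
  qed (use assms in auto)
  then have "integral {a..b} (\<lambda>t::real. 1 / t\<^sup>2) = 1 / a - 1 / b"
    by (simp add: integral_unique)
  also have "\<dots> \<le> 1 / a" using assms by simp
  finally show ?thesis .
qed

lemma bump_potential_L1:
  assumes ab: "0 < a" "a \<le> b"
  shows "(\<integral>(x::'a). \<bar>bump_potential a b x\<bar> \<partial>lborel) \<le> (\<integral>(x::'a::euclidean_space). flat 0 (1 - x \<bullet> x) \<partial>lborel) / a\<^sup>2"
proof (rule kernel_L1_le)
  let ?\<Phi> = "\<lambda>x::'a. flat 0 (1 - x \<bullet> x)"
  let ?s = "\<lambda>t::real. 1 / (2 * t ^ 3)"
  have P: "0 \<le> (\<integral>x. ?\<Phi> x \<partial>lborel)" by (simp add: flat_0_bounds)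
  show k: "kernel (bump_potential a b :: 'a \<Rightarrow> real)"
    by (rule kernel_test_function[OF test_function_bump_potential[OF ab]])
  have "(\<integral>\<^sup>+x. ennreal \<bar>bump_potential a b (x::'a)\<bar> \<partial>lborel) \<le> ennreal ((\<integral>x. ?\<Phi> x \<partial>lborel) * integral {a..b} ?s)"
  proof (rule dilation_mean_L1[OF ab(1)])
    show "integrable lborel ?\<Phi>" using kernel_integrable[OF kernel_flat_profile[of 0 0]] by simp
    show "continuous_on UNIV ?\<Phi>" by (intro continuous_intros)
    show "continuous_on {a..b} ?s" using ab by (intro continuous_intros) auto
    show "(bump_potential a b :: 'a \<Rightarrow> real) \<in> borel_measurable borel" by (rule kernel_measurable[OF k])
    fix x :: 'a
    let ?h = "\<lambda>t. t ^ DIM('a) * ?s t * ?\<Phi> (t *\<^sub>R x)"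
    have "bump_potential a b x = integral {a..b} ?h"
      unfolding bump_potential_def flat_mean_def one_minus_scaled_inner by (intro integral_cong) simp
    moreover have "0 \<le> integral {a..b} ?h"
      using ab by (intro integral_nonneg integrable_continuous_interval continuous_intros)
        (auto intro!: divide_nonneg_nonneg mult_nonneg_nonneg flat_0_bounds)
    ultimately show "\<bar>bump_potential a b x\<bar> \<le> integral {a..b} ?h" by simp
  qed (use ab in \<open>auto simp: flat_0_bounds\<close>)
  also have "\<dots> \<le> ennreal ((\<integral>x. ?\<Phi> x \<partial>lborel) / a\<^sup>2)"
    using mult_left_mono[OF integral_inverse_cube[OF ab] P] by (intro ennreal_leI) simp
  finally show "(\<integral>\<^sup>+x. ennreal \<bar>bump_potential a b (x::'a)\<bar> \<partial>lborel) \<le> ennreal ((\<integral>x. ?\<Phi> x \<partial>lborel) / a\<^sup>2)" .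
  show "0 \<le> (\<integral>x. ?\<Phi> x \<partial>lborel) / a\<^sup>2" using P by simp
qed

text \<open>One differentiation leaves the weight t^N / t and a factor x . e. Bounding this factor
  by |x| = |t x| / t absorbs it into the dilated profile and turns the weight into t^N / t^2, whence
  the rate 1 / a.\<close>

lemma bump_potential_partial_L1:
  assumes ab: "0 < a" "a \<le> b" and e: "e \<in> Basis"
  shows "(\<integral>(x::'a). \<bar>bump_potential_partial a b e x\<bar> \<partial>lborel)
     \<le> (\<integral>(x::'a::euclidean_space). norm x * flat 1 (1 - x \<bullet> x) \<partial>lborel) / a"
proof (rule kernel_L1_le)
  let ?\<Phi> = "\<lambda>x::'a. norm x * flat 1 (1 - x \<bullet> x)"
  let ?s = "\<lambda>t::real. 1 / t\<^sup>2"
  have P: "0 \<le> (\<integral>x. ?\<Phi> x \<partial>lborel)"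
    by (intro Bochner_Integration.integral_nonneg mult_nonneg_nonneg flat_1_nonneg) auto
  show k: "kernel (bump_potential_partial a b e :: 'a \<Rightarrow> real)"
    by (rule kernel_test_function[OF test_function_bump_potential_partial[OF ab]])
  have "(\<integral>\<^sup>+x. ennreal \<bar>bump_potential_partial a b e (x::'a)\<bar> \<partial>lborel)
      \<le> ennreal ((\<integral>x. ?\<Phi> x \<partial>lborel) * integral {a..b} ?s)"
  proof (rule dilation_mean_L1[OF ab(1)])
    show "integrable lborel ?\<Phi>" using kernel_integrable[OF kernel_flat_profile[of 1 1]] by simp
    show "continuous_on UNIV ?\<Phi>" by (intro continuous_intros)
    show "continuous_on {a..b} ?s" using ab by (intro continuous_intros) auto
    show "bump_potential_partial a b e \<in> borel_measurable borel" by (rule kernel_measurable[OF k])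
    show "0 \<le> ?\<Phi> x" for x by (intro mult_nonneg_nonneg flat_1_nonneg) auto
    fix x :: 'a
    let ?h = "\<lambda>t. t ^ DIM('a) * ?s t * ?\<Phi> (t *\<^sub>R x)"
    let ?m = "\<lambda>t. t ^ DIM('a) / t * flat 1 (1 - t\<^sup>2 * (x \<bullet> x))"
    have "bump_potential_partial a b e x = - (x \<bullet> e) * integral {a..b} ?m"
    proof -
      have "flat_mean (\<lambda>t. t ^ DIM('a) / (2 * t ^ 3)) a b 1 (x \<bullet> x) = integral {a..b} (\<lambda>t. (- (1 / 2)) * ?m t)"
        unfolding flat_mean_def
        using ab by (intro integral_cong) (auto simp: field_simps power2_eq_square power3_eq_cube)
      also have "\<dots> = (- (1 / 2)) * integral {a..b} ?m" by (rule integral_mult_right)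
      finally show ?thesis by (simp only: bump_potential_partial_def) simp
    qed
    moreover have "0 \<le> integral {a..b} ?m"
      using ab by (intro integral_nonneg integrable_continuous_interval continuous_intros)
        (auto intro!: divide_nonneg_nonneg mult_nonneg_nonneg flat_1_nonneg[unfolded One_nat_def])
    ultimately have "\<bar>bump_potential_partial a b e x\<bar> = \<bar>x \<bullet> e\<bar> * integral {a..b} ?m"
      by (simp add: abs_mult)
    also have "\<dots> \<le> norm x * integral {a..b} ?m"
      using \<open>0 \<le> integral {a..b} ?m\<close> e by (intro mult_right_mono Basis_le_norm)
    also have "\<dots> = integral {a..b} (\<lambda>t. norm x * ?m t)" by (rule integral_mult_right[symmetric])
    also have "\<dots> = integral {a..b} ?h"
      unfolding one_minus_scaled_inner
      using ab by (intro integral_cong) (auto simp: field_simps power2_eq_square)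
    finally show "\<bar>bump_potential_partial a b e x\<bar> \<le> integral {a..b} ?h" .
  qed (use ab in auto)
  also have "\<dots> \<le> ennreal ((\<integral>x. ?\<Phi> x \<partial>lborel) / a)"
    using mult_left_mono[OF integral_inverse_square[OF ab] P] by (intro ennreal_leI) simp
  finally show "(\<integral>\<^sup>+x. ennreal \<bar>bump_potential_partial a b e (x::'a)\<bar> \<partial>lborel)
      \<le> ennreal ((\<integral>x. ?\<Phi> x \<partial>lborel) / a)" .
  show "0 \<le> (\<integral>x. ?\<Phi> x \<partial>lborel) / a" using P ab by simp
qed

section \<open>Bumps as an approximate identity\<close>

lemma bump_eq_scaled: "bump a (x::'a::euclidean_space) = a ^ DIM('a) * bump 1 (a *\<^sub>R x)"
  by (simp add: bump_def power2_eq_square mult.assoc)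

lemma bump_nonneg: "0 \<le> a \<Longrightarrow> 0 \<le> bump a x"
  unfolding bump_def by (intro mult_nonneg_nonneg flat_1_nonneg) auto

lemma kernel_bump:
  assumes "0 < a" shows "kernel (bump a)"
proof (rule kernel_continuous[where R = "1 / a"])
  show "continuous_on UNIV (bump a)" unfolding bump_def[abs_def] by (intro continuous_intros)
  show "bump a x = 0" if "1 / a < norm x" for x
    using one_le_scaled_inner[OF assms order_refl that] by (simp add: bump_def flat_nonpos)
qed

lemma integral_bump_squared:
  assumes "0 < a"
  shows "(\<integral>(x::'a::euclidean_space). (bump a x)\<^sup>2 \<partial>lborel) = a ^ DIM('a) * (\<integral>(x::'a). (bump 1 x)\<^sup>2 \<partial>lborel)"
proof -
  have "(\<integral>(x::'a). (bump 1 x)\<^sup>2 \<partial>lborel) = a ^ DIM('a) * (\<integral>(x::'a). (bump 1 (a *\<^sub>R x))\<^sup>2 \<partial>lborel)"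
    using lborel_integral_affine[of a "\<lambda>x::'a. (bump 1 x)\<^sup>2" 0] assms by simp
  moreover have "(\<integral>(x::'a). (bump a x)\<^sup>2 \<partial>lborel) = (a ^ DIM('a))\<^sup>2 * (\<integral>(x::'a). (bump 1 (a *\<^sub>R x))\<^sup>2 \<partial>lborel)"
    by (subst bump_eq_scaled) (simp add: power_mult_distrib)
  ultimately show ?thesis by (simp add: power2_eq_square)
qed

lemma open_AE_False:
  assumes "open S" "AE x in lborel. x \<notin> S"
  shows "S = {}"
proof (rule ccontr)
  assume "S \<noteq> {}"
  have "{x. \<not> x \<notin> S} \<in> null_sets lborel" using assms by (subst (asm) AE_iff_null) auto
  then have "S \<in> null_sets lebesgue" by (simp add: null_sets_completionI)
  then have "negligible S" by (simp add: negligible_iff_null_sets)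
  then show False using open_not_negligible[OF assms(1) \<open>S \<noteq> {}\<close>] by simp
qed

text \<open>Smoothing tends to multiplication by this constant instead of to the identity;
  positivity keeps the comparison of levels of u and of its smoothing meaningful.\<close>

lemma integral_bump_pos: "0 < (\<integral>(x::'a::euclidean_space). bump 1 x \<partial>lborel)"
proof -
  have b1: "integrable lborel (bump 1 :: 'a \<Rightarrow> real)" by (rule kernel_integrable[OF kernel_bump]) simp
  have "(\<integral>(x::'a). bump 1 x \<partial>lborel) \<noteq> 0"
  proof
    assume "(\<integral>(x::'a). bump 1 x \<partial>lborel) = 0"
    then have "AE x::'a in lborel. bump 1 x = 0"
      using integral_nonneg_eq_0_iff_AE[of lborel "bump 1 :: 'a \<Rightarrow> real"]
        b1
      by (simp add: bump_nonneg)
    then have "AE x::'a in lborel. x \<notin> ball 0 1"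
    proof (eventually_elim, safe)
      fix x :: 'a assume "bump 1 x = 0" "x \<in> ball 0 1"
      then have "(norm x)\<^sup>2 < 1" by (simp add: power_less_one_iff)
      then have "0 < flat 1 (1 - x \<bullet> x)" unfolding flat_1 by (simp add: power2_norm_eq_inner)
      then show False using \<open>bump 1 x = 0\<close> by (simp add: bump_def)
    qed
    from open_AE_False[OF open_ball this] show False by simp
  qed
  moreover have "0 \<le> (\<integral>(x::'a). bump 1 x \<partial>lborel)" by (simp add: bump_nonneg)
  ultimately show ?thesis by linarith
qed

lemma conv_bump_bound:
  fixes u :: "'a::euclidean_space \<Rightarrow> 'k::euclidean_space"
  assumes "0 < a" "u \<in> L2"
  shows "(norm (conv (bump a) u x))\<^sup>2
    \<le> a ^ DIM('a) * (\<integral>(x::'a). (bump 1 x)\<^sup>2 \<partial>lborel) * (\<integral>y. (norm (u y))\<^sup>2 \<partial>lborel)"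
  using norm_conv_squared_le[OF kernel_bump[OF assms(1)] assms(2), of x]
  by (simp add: integral_bump_squared[OF assms(1)])

text \<open>Rescaling the variable moves the parameter into the argument of \<open>w\<close>, where
  continuity at x yields the pointwise limit and boundedness a dominating function.\<close>

lemma conv_bump_tendsto:
  fixes w :: "'a::euclidean_space \<Rightarrow> 'k::euclidean_space"
  assumes w: "w \<in> borel_measurable borel" "isCont w x" "\<And>y. norm (w y) \<le> C"
    and r: "filterlim r at_top sequentially" "\<And>n. 0 < r n"
  shows "(\<lambda>n. conv (bump (r n)) w x) \<longlonglongrightarrow> (\<integral>(z::'a). bump 1 z \<partial>lborel) *\<^sub>R w x"
proof -
  note [measurable] = w(1) kernel_measurable[OF kernel_bump[of 1]]
  have b1: "integrable lborel (bump 1 :: 'a \<Rightarrow> real)" by (rule kernel_integrable[OF kernel_bump]) simp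
  have eq: "conv (bump (r n)) w x = (\<integral>z. bump 1 z *\<^sub>R w (x - (1 / r n) *\<^sub>R z) \<partial>lborel)" for n
  proof -
    have "(\<integral>z. bump 1 z *\<^sub>R w (x - (1 / r n) *\<^sub>R z) \<partial>lborel)
        = r n ^ DIM('a) *\<^sub>R (\<integral>z. bump 1 (r n *\<^sub>R z) *\<^sub>R w (x - z) \<partial>lborel)"
      using r(2)[of n] lborel_integral_affine[of "r n" "\<lambda>z. bump 1 z *\<^sub>R w (x - (1 / r n) *\<^sub>R z)" 0] by simp
    also have "\<dots> = (\<integral>z. bump (r n) z *\<^sub>R w (x - z) \<partial>lborel)"
      unfolding integral_scaleR_right[symmetric] by (simp add: bump_eq_scaled[of "r n"])
    finally show ?thesis by (simp add: conv_commute)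
  qed
  have "(\<lambda>n. \<integral>z. bump 1 z *\<^sub>R w (x - (1 / r n) *\<^sub>R z) \<partial>lborel) \<longlonglongrightarrow> (\<integral>(z::'a). bump 1 z *\<^sub>R w x \<partial>lborel)"
  proof (rule integral_dominated_convergence[where w = "\<lambda>z. bump 1 z * C"])
    show "integrable lborel (\<lambda>z::'a. bump 1 z * C)" using b1 by simp
    show "AE z in lborel. (\<lambda>n. bump 1 z *\<^sub>R w (x - (1 / r n) *\<^sub>R z)) \<longlonglongrightarrow> bump 1 z *\<^sub>R w x"
    proof (intro AE_I2 tendsto_scaleR tendsto_const)
      fix z
      have "(\<lambda>n. 1 / r n) \<longlonglongrightarrow> 0"
        by (rule tendsto_divide_0[OF tendsto_const filterlim_at_top_imp_at_infinity[OF r(1)]])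
      then have "(\<lambda>n. x - (1 / r n) *\<^sub>R z) \<longlonglongrightarrow> x - 0 *\<^sub>R z" by (intro tendsto_intros)
      then show "(\<lambda>n. w (x - (1 / r n) *\<^sub>R z)) \<longlonglongrightarrow> w x"
        using isCont_tendsto_compose[OF w(2)] by simp
    qed
    show "AE z in lborel. norm (bump 1 z *\<^sub>R w (x - (1 / r n) *\<^sub>R z)) \<le> bump 1 z * C" for n
      using w(3) by (intro AE_I2) (simp add: bump_nonneg mult_left_mono)
  qed auto
  then show ?thesis using b1 by (simp add: eq)
qed

section \<open>Box averages and Lebesgue differentiation\<close>

definition box_average :: "real \<Rightarrow> 'a::euclidean_space \<Rightarrow> real" where
  "box_average \<delta> y = indicator (cbox (- (\<delta> *\<^sub>R One)) 0) y / \<delta> ^ DIM('a)"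

lemma kernel_box_average:
  assumes "0 < \<delta>" shows "kernel (box_average \<delta> :: 'a::euclidean_space \<Rightarrow> real)"
proof -
  obtain R where R: "\<forall>x\<in>cbox (- (\<delta> *\<^sub>R One)) (0 :: 'a). norm x \<le> R"
    using bounded_cbox[of "- (\<delta> *\<^sub>R One)" "0 :: 'a"] by (auto simp: bounded_iff)
  have "\<bar>box_average \<delta> x\<bar> \<le> 1 / \<delta> ^ DIM('a)" for x :: 'a
    using assms by (auto simp: box_average_def indicator_def)
  moreover have "box_average \<delta> x = 0" if "R < norm x" for x :: 'a
    using R that by (force simp: box_average_def indicator_def)
  moreover have "(box_average \<delta> :: 'a \<Rightarrow> real) \<in> borel_measurable borel"
    by (simp add: box_average_def[abs_def])
  ultimately show ?thesis unfolding kernel_def by blast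
qed

lemma box_average_L1:
  assumes "0 < \<delta>" shows "(\<integral>(y::'a::euclidean_space). \<bar>box_average \<delta> y\<bar> \<partial>lborel) = 1"
proof -
  have "(\<integral>(y::'a). \<bar>box_average \<delta> y\<bar> \<partial>lborel)
      = (\<integral>(y::'a). indicator (cbox (- (\<delta> *\<^sub>R One)) 0) y / \<delta> ^ DIM('a) \<partial>lborel)"
    using assms by (simp add: box_average_def)
  also have "\<dots> = measure lborel (cbox (- (\<delta> *\<^sub>R One)) (0 :: 'a)) / \<delta> ^ DIM('a)" by simp
  also have "measure lborel (cbox (- (\<delta> *\<^sub>R One)) (0 :: 'a)) = \<delta> ^ DIM('a)"
    using assms by (subst measure_lborel_cbox) (auto simp: inner_diff_left)
  finally show ?thesis using assms by simp
qed

lemma mem_reflected_cbox: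
  fixes x y :: "'a::euclidean_space"
  shows "x - y \<in> cbox (- (\<delta> *\<^sub>R One)) 0 \<longleftrightarrow> y \<in> cbox x (x + \<delta> *\<^sub>R One)"
  by (auto simp: mem_box inner_diff_left inner_add_left algebra_simps)

lemma conv_box_average:
  fixes u :: "'a::euclidean_space \<Rightarrow> 'k::euclidean_space"
  shows "conv (box_average \<delta>) u x
    = (\<integral>y. (indicator (cbox x (x + \<delta> *\<^sub>R One)) y / \<delta> ^ DIM('a)) *\<^sub>R u y \<partial>lborel)"
  unfolding conv_def box_average_def
  by (intro Bochner_Integration.integral_cong) (simp_all add: indicator_def mem_reflected_cbox)

lemma kernel_indicator:
  assumes "S \<in> sets borel" "bounded S" shows "kernel (indicator S)"
proof -
  obtain R where "\<forall>x\<in>S. norm x \<le> R" using assms(2) by (auto simp: bounded_iff)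
  then have "indicator S x = (0::real)" if "R < norm x" for x using that by (force simp: indicator_def)
  moreover have "\<bar>indicator S x\<bar> \<le> (1::real)" for x by (simp add: indicator_def)
  ultimately show ?thesis using assms(1) unfolding kernel_def by (auto intro: borel_measurable_indicator)
qed

text \<open>Lebesgue's differentiation theorem for cubes that have x as their lowest corner. The
  kernel lives on the cube from - \<delta> to 0 so that its convolution at x averages over just such
  a cube.\<close>

lemma conv_box_average_AE:
  fixes u :: "'a::euclidean_space \<Rightarrow> 'k::euclidean_space"
  assumes u: "u \<in> L2"
  shows "AE x in lborel. (\<lambda>n. conv (box_average (1 / real (Suc n))) u x) \<longlonglongrightarrow> u x"
proof -
  have set_int: "set_integrable lborel (cbox a b) u" for a b
    unfolding set_integrable_def by (intro integrable_kernel_scaleR kernel_indicator u) auto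
  then have "u integrable_on cbox a b" for a b
    by (rule set_borel_integral_eq_integral)
  then obtain N where N: "negligible N"
    "\<And>x e. x \<notin> N \<Longrightarrow> 0 < e \<Longrightarrow> \<exists>d>0. \<forall>h. 0 < h \<and> h < d \<longrightarrow>
       norm (integral (cbox x (x + h *\<^sub>R One)) u /\<^sub>R h ^ DIM('a) - u x) < e"
    using integrable_ccontinuous_explicit by metis
  have conv_eq: "conv (box_average h) u x = integral (cbox x (x + h *\<^sub>R One)) u /\<^sub>R h ^ DIM('a)" for h x
  proof -
    have "conv (box_average h) u x
        = (\<integral>y. (1 / h ^ DIM('a)) *\<^sub>R (indicator (cbox x (x + h *\<^sub>R One)) y *\<^sub>R u y) \<partial>lborel)"
      unfolding conv_box_average by (intro Bochner_Integration.integral_cong) auto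
    also have "\<dots> = (1 / h ^ DIM('a)) *\<^sub>R (LINT y : cbox x (x + h *\<^sub>R One) | lborel. u y)"
      unfolding set_lebesgue_integral_def by (rule integral_scaleR_right)
    also have "(LINT y : cbox x (x + h *\<^sub>R One) | lborel. u y) = integral (cbox x (x + h *\<^sub>R One)) u"
      by (rule set_borel_integral_eq_integral[OF set_int])
    finally show ?thesis by (simp add: inverse_eq_divide)
  qed
  have "(\<lambda>n. conv (box_average (1 / real (Suc n))) u x) \<longlonglongrightarrow> u x" if x: "x \<notin> N" for x
  proof (rule LIMSEQ_I)
    fix e :: real assume e: "0 < e"
    obtain d where d: "d > 0" "\<And>h. 0 < h \<Longrightarrow> h < d \<Longrightarrow> norm (conv (box_average h) u x - u x) < e"
      using N(2)[OF x e] by (auto simp: conv_eq)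
    obtain n0 where "1 / real (Suc n0) < d" using nat_approx_posE[OF d(1)] by blast
    then have "1 / real (Suc n) < d" if "n \<ge> n0" for n
      using that by (smt (verit) frac_le of_nat_0_less_iff of_nat_le_iff not_less_eq_eq zero_less_Suc)
    then show "\<exists>n0. \<forall>n\<ge>n0. norm (conv (box_average (1 / real (Suc n))) u x - u x) < e"
      using d(2) by (intro exI[of _ n0]) simp
  qed
  moreover have "AE x in lebesgue. x \<notin> N"
    using N(1) by (simp add: negligible_iff_null_sets AE_not_in)
  ultimately have "AE x in lebesgue. (\<lambda>n. conv (box_average (1 / real (Suc n))) u x) \<longlonglongrightarrow> u x"
    by (auto elim!: eventually_mono)
  then show ?thesis by (simp add: AE_completion_iff)
qed

text \<open>The kernel jumps only on the faces of a cube, a null set. Off these faces its translates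
  converge, and dominated convergence applies.\<close>

lemma isCont_conv_box_average:
  fixes u :: "'a::euclidean_space \<Rightarrow> 'k::euclidean_space"
  assumes \<delta>: "0 < \<delta>" and u: "u \<in> L2"
  shows "isCont (conv (box_average \<delta>) u) x"
  unfolding continuous_at_sequentially
proof safe
  fix X :: "nat \<Rightarrow> 'a" assume X: "X \<longlonglongrightarrow> x"
  let ?k = "box_average \<delta> :: 'a \<Rightarrow> real"
  note [measurable] = kernel_measurable[OF kernel_box_average[OF \<delta>, where 'a='a]] L2_measurable[OF u]
  obtain R where R: "\<And>y. R < norm y \<Longrightarrow> ?k y = 0" using kernel_box_average[OF \<delta>] by (auto simp: kernel_def)
  obtain B where B: "\<And>y. \<bar>?k y\<bar> \<le> B" using kernel_box_average[OF \<delta>] by (auto simp: kernel_def)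
  obtain S where S: "\<And>n. norm (X n) \<le> S"
    using convergent_imp_Bseq[of X] X by (auto simp: convergent_def Bseq_def)
  \<comment> \<open>The kernels centred at the points X n all live in this one ball, since a
    convergent sequence is bounded; this gives a dominating function independent of n.\<close>
  let ?K = "indicator (cball 0 (R + S)) :: 'a \<Rightarrow> real"
  have ae: "AE y in lborel. x - y \<notin> cbox (- (\<delta> *\<^sub>R One)) 0 - box (- (\<delta> *\<^sub>R One)) 0"
  proof -
    have "negligible (cbox x (x + \<delta> *\<^sub>R One) - box x (x + \<delta> *\<^sub>R One))"
      by (rule negligible_frontier_interval)
    then have "cbox x (x + \<delta> *\<^sub>R One) - box x (x + \<delta> *\<^sub>R One) \<in> null_sets lborel"
      by (simp add: negligible_iff_null_sets null_sets_completion_iff)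
    then have "AE y in lborel. y \<notin> cbox x (x + \<delta> *\<^sub>R One) - box x (x + \<delta> *\<^sub>R One)"
      by (rule AE_not_in)
    moreover have "x - y \<in> box (- (\<delta> *\<^sub>R One)) 0 \<longleftrightarrow> y \<in> box x (x + \<delta> *\<^sub>R One)" for y
      by (auto simp: mem_box inner_diff_left inner_add_left algebra_simps)
    ultimately show ?thesis by (simp add: mem_reflected_cbox)
  qed
  have "(\<lambda>n. \<integral>y. ?k (X n - y) *\<^sub>R u y \<partial>lborel) \<longlonglongrightarrow> (\<integral>y. ?k (x - y) *\<^sub>R u y \<partial>lborel)"
  proof (rule integral_dominated_convergence[where w = "\<lambda>y. B * norm (?K y *\<^sub>R u y)"])
    show "integrable lborel (\<lambda>y. B * norm (?K y *\<^sub>R u y))"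
      by (intro integrable_mult_right integrable_norm integrable_kernel_scaleR kernel_indicator u) auto
    show "AE y in lborel. (\<lambda>n. ?k (X n - y) *\<^sub>R u y) \<longlonglongrightarrow> ?k (x - y) *\<^sub>R u y"
      using ae
    proof eventually_elim
      fix y assume y: "x - y \<notin> cbox (- (\<delta> *\<^sub>R One)) 0 - box (- (\<delta> *\<^sub>R One)) 0"
      have lim: "(\<lambda>n. X n - y) \<longlonglongrightarrow> x - y" by (intro tendsto_intros X)
      \<comment> \<open>The open box and the complement of the closed box are both open, and the
        kernel is constant on each; hence its values along the sequence are eventually
        constant.\<close>
      have "eventually (\<lambda>n. ?k (X n - y) = ?k (x - y)) sequentially"
      proof (cases "x - y \<in> box (- (\<delta> *\<^sub>R One)) 0")
        case True
        then have "eventually (\<lambda>n. X n - y \<in> box (- (\<delta> *\<^sub>R One)) 0) sequentially"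
          using lim open_box topological_tendstoD by blast
        then show ?thesis
          by eventually_elim (use True box_subset_cbox in \<open>auto simp: box_average_def indicator_def\<close>)
      next
        case False
        then have "x - y \<in> - cbox (- (\<delta> *\<^sub>R One)) 0" using y by auto
        then have "eventually (\<lambda>n. X n - y \<in> - cbox (- (\<delta> *\<^sub>R One)) 0) sequentially"
          using lim open_Compl[OF closed_cbox] topological_tendstoD by blast
        then show ?thesis
          by eventually_elim (use \<open>x - y \<in> - _\<close> in \<open>auto simp: box_average_def indicator_def\<close>)
      qed
      then have "(\<lambda>n. ?k (X n - y)) \<longlonglongrightarrow> ?k (x - y)" by (rule tendsto_eventually)
      then show "(\<lambda>n. ?k (X n - y) *\<^sub>R u y) \<longlonglongrightarrow> ?k (x - y) *\<^sub>R u y" by (intro tendsto_intros)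
    qed
    show "AE y in lborel. norm (?k (X n - y) *\<^sub>R u y) \<le> B * norm (?K y *\<^sub>R u y)" for n
    proof (rule AE_I2)
      fix y
      show "norm (?k (X n - y) *\<^sub>R u y) \<le> B * norm (?K y *\<^sub>R u y)"
      proof (cases "norm y \<le> R + S")
        case True
        then show ?thesis using B by (simp add: mult_right_mono)
      next
        case False
        then have "R < norm (X n - y)"
          using S[of n] norm_triangle_ineq2[of y "X n"] by (simp add: norm_minus_commute)
        then show ?thesis using R B[of 0] by simp
      qed
    qed
  qed auto
  then show "(conv ?k u \<circ> X) \<longlonglongrightarrow> conv ?k u x" by (simp add: conv_def comp_def)
qed

text \<open>Fubini's theorem. Absolute integrability holds because the inner integral is the
  convolution of |j| with |u|, which is bounded by Cauchy-Schwarz, while |k| is integrable.\<close>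

lemma conv_conv_commute:
  fixes u :: "'a::euclidean_space \<Rightarrow> 'k::euclidean_space"
  assumes j: "kernel j" and k: "kernel k" and u: "u \<in> L2"
  shows "conv j (conv k u) x = conv k (conv j u) x"
proof -
  note [measurable] = kernel_measurable[OF j] kernel_measurable[OF k] L2_measurable[OF u]
  define F where "F = (\<lambda>(z, y). (k z * j (x - y)) *\<^sub>R u (y - z))"
  have norm_F: "norm (F (z, y)) = \<bar>k z\<bar> * (\<bar>j (x - y)\<bar> * norm (u (y - z)))" for z y
    by (simp add: F_def abs_mult)
  have shift: "(\<lambda>y. norm (u (y - z))) \<in> L2" for z
    using L2_affine_arg[OF u, of 1 "- z"] by (simp add: L2_def)
  have nu: "(\<lambda>y. norm (u y)) \<in> L2" using u by (simp add: L2_def)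
  have int_y: "integrable lborel (\<lambda>y. \<bar>j (x - y)\<bar> * norm (u (y - z)))" for z
    using conv_integrable[OF kernel_abs[OF j] shift] by simp
  have conv_y: "(\<integral>y. \<bar>j (x - y)\<bar> * norm (u (y - z)) \<partial>lborel) = conv (\<lambda>y. \<bar>j y\<bar>) (\<lambda>y. norm (u y)) (x - z)" for z
    unfolding conv_def
    using lborel_integral_affine[of 1 "\<lambda>y. \<bar>j (x - y)\<bar> * norm (u (y - z))" z]
    by (simp add: algebra_simps)
  define C where "C = sqrt ((\<integral>y. (j y)\<^sup>2 \<partial>lborel) * (\<integral>y. (norm (u y))\<^sup>2 \<partial>lborel))"
  have C: "\<bar>conv (\<lambda>y. \<bar>j y\<bar>) (\<lambda>y. norm (u y)) t\<bar> \<le> C" for t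
    using norm_conv_squared_le[OF kernel_abs[OF j] nu, of t] unfolding C_def
    by (intro real_le_rsqrt) simp
  have F_int: "integrable (lborel \<Otimes>\<^sub>M lborel) F"
  proof (rule lborel_pair.Fubini_integrable)
    show "F \<in> borel_measurable (lborel \<Otimes>\<^sub>M lborel)" unfolding F_def by measurable
    show "AE z in lborel. integrable lborel (\<lambda>y. F (z, y))"
    proof (rule AE_I2)
      fix z
      have "integrable lborel (\<lambda>y. norm (F (z, y)))"
        unfolding norm_F by (intro integrable_mult_right int_y)
      moreover have "(\<lambda>y. F (z, y)) \<in> borel_measurable lborel" unfolding F_def by simp
      ultimately show "integrable lborel (\<lambda>y. F (z, y))" using integrable_norm_iff by blast
    qed
    have "integrable lborel (\<lambda>z. \<bar>k z\<bar> * conv (\<lambda>y. \<bar>j y\<bar>) (\<lambda>y. norm (u y)) (x - z))"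
    proof (rule Bochner_Integration.integrable_bound)
      show "integrable lborel (\<lambda>z. \<bar>k z\<bar> * C)"
        by (intro integrable_mult_left kernel_integrable kernel_abs k)
      show "AE z in lborel. norm (\<bar>k z\<bar> * conv (\<lambda>y. \<bar>j y\<bar>) (\<lambda>y. norm (u y)) (x - z)) \<le> norm (\<bar>k z\<bar> * C)"
        using order_trans[OF C abs_ge_self]
        by (intro AE_I2) (simp add: abs_mult mult_left_mono)
    qed simp
    then show "integrable lborel (\<lambda>z. \<integral>y. norm (F (z, y)) \<partial>lborel)"
      unfolding norm_F by (simp add: conv_y)
  qed
  have "conv j (conv k u) x = (\<integral>y. (\<integral>z. F (z, y) \<partial>lborel) \<partial>lborel)"
    unfolding conv_def[of j] conv_commute[of k] F_def
    by (simp add: mult.commute[of "k _"] flip: integral_scaleR_right scaleR_scaleR)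
  also have "\<dots> = (\<integral>z. (\<integral>y. F (z, y) \<partial>lborel) \<partial>lborel)"
    using lborel_pair.Fubini_integral[of "\<lambda>z y. F (z, y)"] F_int by (simp add: split_beta')
  also have "\<dots> = (\<integral>z. k z *\<^sub>R conv j u (x - z) \<partial>lborel)"
  proof (rule Bochner_Integration.integral_cong)
    fix z
    have "(\<integral>y. F (z, y) \<partial>lborel) = k z *\<^sub>R (\<integral>y. j (x - y) *\<^sub>R u (y - z) \<partial>lborel)"
      unfolding F_def by (simp flip: integral_scaleR_right scaleR_scaleR)
    also have "(\<integral>y. j (x - y) *\<^sub>R u (y - z) \<partial>lborel) = conv j u (x - z)"
      unfolding conv_def
      using lborel_integral_affine[of 1 "\<lambda>y. j (x - y) *\<^sub>R u (y - z)" z]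
      by (simp add: algebra_simps)
    finally show "(\<integral>y. F (z, y) \<partial>lborel) = k z *\<^sub>R conv j u (x - z)" .
  qed simp
  finally show ?thesis by (simp add: conv_commute[of k])
qed

lemma nn_integral_norm_squared_Fatou:
  fixes f :: "nat \<Rightarrow> 'a::euclidean_space \<Rightarrow> 'k::euclidean_space"
  assumes [measurable]: "\<And>n. f n \<in> borel_measurable borel"
    and lim: "AE x in lborel. (\<lambda>n. f n x) \<longlonglongrightarrow> g x"
    and le: "\<And>n. (\<integral>\<^sup>+x. ennreal ((norm (f n x))\<^sup>2) \<partial>lborel) \<le> X"
  shows "(\<integral>\<^sup>+x. ennreal ((norm (g x))\<^sup>2) \<partial>lborel) \<le> X"
proof -
  have "(\<integral>\<^sup>+x. ennreal ((norm (g x))\<^sup>2) \<partial>lborel)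
      = (\<integral>\<^sup>+x. liminf (\<lambda>n. ennreal ((norm (f n x))\<^sup>2)) \<partial>lborel)"
  proof (rule nn_integral_cong_AE)
    show "AE x in lborel. ennreal ((norm (g x))\<^sup>2) = liminf (\<lambda>n. ennreal ((norm (f n x))\<^sup>2))"
      using lim
    proof eventually_elim
      fix x assume "(\<lambda>n. f n x) \<longlonglongrightarrow> g x"
      then have "(\<lambda>n. ennreal ((norm (f n x))\<^sup>2)) \<longlonglongrightarrow> ennreal ((norm (g x))\<^sup>2)"
        by (intro tendsto_intros)
      from lim_imp_Liminf[OF _ this] show "ennreal ((norm (g x))\<^sup>2) = liminf (\<lambda>n. ennreal ((norm (f n x))\<^sup>2))"
        by simp
    qed
  qed
  also have "\<dots> \<le> liminf (\<lambda>n. \<integral>\<^sup>+x. ennreal ((norm (f n x))\<^sup>2) \<partial>lborel)"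
    by (rule nn_integral_liminf) simp
  also have "\<dots> \<le> X"
    using Liminf_mono[of "\<lambda>n. \<integral>\<^sup>+x. ennreal ((norm (f n x))\<^sup>2) \<partial>lborel" "\<lambda>_. X" sequentially] le
    by (simp add: Liminf_const)
  finally show ?thesis .
qed

lemma L2_diff: "u \<in> L2 \<Longrightarrow> v \<in> L2 \<Longrightarrow> (\<lambda>x. u x - v x) \<in> L2"
  using L2_add[OF _ L2_scaleR[of v "-1"]] by simp

lemma conv_diff:
  assumes "kernel k" "u \<in> L2" "v \<in> L2"
  shows "conv k (\<lambda>x. u x - v x) x = conv k u x - conv k v x"
  using conv_add[OF assms(1,2) L2_scaleR[OF assms(3), of "-1"], of x] conv_scaleR[of k "-1" v x] by simp

lemma conv_Young_box_average:
  assumes "0 < \<delta>" "u \<in> L2"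
  shows "(\<integral>\<^sup>+x. ennreal ((norm (conv (box_average \<delta>) u x))\<^sup>2) \<partial>lborel)
    \<le> (\<integral>\<^sup>+x. ennreal ((norm (u x))\<^sup>2) \<partial>lborel)"
  using conv_Young[OF kernel_box_average[OF assms(1)] assms(2)]
  by (simp add: box_average_L1[OF assms(1)] nn_integral_eq_integral[OF L2_integrable[OF assms(2)]])

text \<open>The almost everywhere convergence of box averages replaces that of the smooth averages:
  after averaging over a small box the approximated function is continuous.\<close>

lemma approximate_identity_L2_bound:
  fixes g u :: "'a::euclidean_space \<Rightarrow> 'k::euclidean_space"
  assumes g: "g \<in> L2" and u: "u \<in> L2" and a: "0 < a"
    and le: "\<And>b. a \<le> b \<Longrightarrow> (\<integral>\<^sup>+x. ennreal ((norm (g x - conv (bump b) u x))\<^sup>2) \<partial>lborel) \<le> X"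
  shows "(\<integral>\<^sup>+x. ennreal ((norm (g x - (\<integral>(z::'a). bump 1 z \<partial>lborel) *\<^sub>R u x))\<^sup>2) \<partial>lborel) \<le> X"
proof -
  define Z where "Z = (\<integral>(z::'a). bump 1 z \<partial>lborel)"
  define h where "h = (\<lambda>x. g x - Z *\<^sub>R u x)"
  have h: "h \<in> L2" unfolding h_def by (intro L2_diff L2_scaleR g u)
  define r where "r = (\<lambda>n. a + real n)"
  have r: "0 < r n" "a \<le> r n" for n using a by (auto simp: r_def)
  have r_lim: "filterlim r at_top sequentially"
    unfolding r_def by (rule filterlim_tendsto_add_at_top[OF tendsto_const filterlim_real_sequentially])
  \<comment> \<open>First passage to the limit, with the box fixed and the bump scale going to
    infinity. Averaging over the box does not increase the L2 norm, so the bound X persists, and it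
    commutes with the bump, which then acts on a bounded continuous function.\<close>
  have avg: "(\<integral>\<^sup>+x. ennreal ((norm (conv (box_average \<delta>) h x))\<^sup>2) \<partial>lborel) \<le> X" if \<delta>: "0 < \<delta>" for \<delta>
  proof (rule nn_integral_norm_squared_Fatou)
    let ?k = "box_average \<delta> :: 'a \<Rightarrow> real"
    let ?f = "\<lambda>n. conv ?k (\<lambda>x. g x - conv (bump (r n)) u x)"
    note k = kernel_box_average[OF \<delta>, where 'a='a]
    have d: "(\<lambda>x. g x - conv (bump (r n)) u x) \<in> L2" for n
      by (intro L2_diff g conv_L2 kernel_bump r u)
    show "?f n \<in> borel_measurable borel" for n
      by (rule L2_measurable[OF conv_L2[OF k d]])
    show "(\<integral>\<^sup>+x. ennreal ((norm (?f n x))\<^sup>2) \<partial>lborel) \<le> X" for n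
      by (rule order_trans[OF conv_Young_box_average[OF \<delta> d] le[OF r(2)]])
    show "AE x in lborel. (\<lambda>n. ?f n x) \<longlonglongrightarrow> conv ?k h x"
    proof (rule AE_I2)
      fix x
      let ?C = "sqrt ((\<integral>y. (?k y)\<^sup>2 \<partial>lborel) * (\<integral>y. (norm (u y))\<^sup>2 \<partial>lborel))"
      have "norm (conv ?k u y) \<le> ?C" for y
        by (intro real_le_rsqrt norm_conv_squared_le k u)
      then have "(\<lambda>n. conv (bump (r n)) (conv ?k u) x) \<longlonglongrightarrow> Z *\<^sub>R conv ?k u x"
        unfolding Z_def
        by (intro conv_bump_tendsto[OF L2_measurable[OF conv_L2[OF k u]] isCont_conv_box_average[OF \<delta> u] _ r_lim r(1)])
      then have "(\<lambda>n. conv ?k g x - conv (bump (r n)) (conv ?k u) x) \<longlonglongrightarrow> conv ?k g x - Z *\<^sub>R conv ?k u x"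
        by (intro tendsto_intros)
      moreover have "?f n x = conv ?k g x - conv (bump (r n)) (conv ?k u) x" for n
        using conv_diff[OF k g conv_L2[OF kernel_bump[OF r(1)] u]] conv_conv_commute[OF k kernel_bump[OF r(1)] u]
        by simp
      moreover have "conv ?k h x = conv ?k g x - Z *\<^sub>R conv ?k u x"
        unfolding h_def using conv_diff[OF k g L2_scaleR[OF u]] by (simp add: conv_scaleR)
      ultimately show "(\<lambda>n. ?f n x) \<longlonglongrightarrow> conv ?k h x" by simp
    qed
  qed
  \<comment> \<open>Second passage to the limit: the box shrinks, and Fatou's lemma removes the
    averaging.\<close>
  have "(\<integral>\<^sup>+x. ennreal ((norm (h x))\<^sup>2) \<partial>lborel) \<le> X"
  proof (rule nn_integral_norm_squared_Fatou)
    show "conv (box_average (1 / real (Suc n))) h \<in> borel_measurable borel" for n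
      by (intro L2_measurable conv_L2 kernel_box_average h) simp
    show "AE x in lborel. (\<lambda>n. conv (box_average (1 / real (Suc n))) h x) \<longlonglongrightarrow> h x"
      by (rule conv_box_average_AE[OF h])
  qed (rule avg, simp)
  then show ?thesis by (simp add: h_def Z_def)
qed

section \<open>Weak derivatives\<close>

lemma indicator_box_cbox_AE:
  fixes l r :: "'a::euclidean_space"
  shows "AE x in lborel. indicator (box l r) x = (indicator (cbox l r) x :: real)"
proof -
  have "cbox l r - box l r \<in> null_sets lborel"
    using negligible_frontier_interval[of l r] by (simp add: negligible_iff_null_sets null_sets_completion_iff)
  then have "AE x in lborel. x \<notin> cbox l r - box l r" by (rule AE_not_in)
  then show ?thesis
    by eventually_elim (use box_subset_cbox in \<open>auto simp: indicator_def\<close>)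
qed

text \<open>The fundamental lemma of the calculus of variations. Smooth approximations of box
  indicators make all box integrals of v vanish, hence all its box averages, and these converge to v
  almost everywhere.\<close>

lemma AE_zero_if_test_integrals_zero:
  fixes v :: "'a::euclidean_space \<Rightarrow> 'k::euclidean_space"
  assumes v: "v \<in> L2" and zero: "\<And>\<phi>. test_function \<phi> \<Longrightarrow> (\<integral>x. \<phi> x *\<^sub>R v x \<partial>lborel) = 0"
  shows "AE x in lborel. v x = 0"
proof -
  note [measurable] = L2_measurable[OF v]
  have box: "(\<integral>x. indicator (cbox l r) x *\<^sub>R v x \<partial>lborel) = 0" for l r
  proof -
    have m[measurable]: "box_bump l r n \<in> borel_measurable borel" for n
      by (rule kernel_measurable[OF kernel_test_function[OF test_function_box_bump]])
    have "(\<lambda>n. \<integral>x. box_bump l r n x *\<^sub>R v x \<partial>lborel) \<longlonglongrightarrow> (\<integral>x. indicator (box l r) x *\<^sub>R v x \<partial>lborel)"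
    proof (rule integral_dominated_convergence[where w = "\<lambda>x. norm (indicator (box l r) x *\<^sub>R v x)"])
      show "integrable lborel (\<lambda>x. norm (indicator (box l r) x *\<^sub>R v x))"
        by (intro integrable_norm integrable_kernel_scaleR kernel_indicator v) auto
      show "AE x in lborel. (\<lambda>n. box_bump l r n x *\<^sub>R v x) \<longlonglongrightarrow> indicator (box l r) x *\<^sub>R v x"
        by (intro AE_I2 tendsto_intros box_bump_tendsto)
      show "AE x in lborel. norm (box_bump l r n x *\<^sub>R v x) \<le> norm (indicator (box l r) x *\<^sub>R v x)" for n
      proof (rule AE_I2)
        fix x
        have "\<bar>box_bump l r n x\<bar> \<le> indicator (box l r) x"
          using box_bump_bounds[of l r n x] box_bump_eq_0[of x l r n] by (auto simp: indicator_def)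
        then show "norm (box_bump l r n x *\<^sub>R v x) \<le> norm (indicator (box l r) x *\<^sub>R v x)"
          by (auto intro!: mult_right_mono)
      qed
    qed auto
    then have "(\<lambda>n. 0) \<longlonglongrightarrow> (\<integral>x. indicator (box l r) x *\<^sub>R v x \<partial>lborel)"
      by (simp add: zero test_function_box_bump)
    then have "(\<integral>x. indicator (box l r) x *\<^sub>R v x \<partial>lborel) = 0"
      by (simp add: LIMSEQ_const_iff)
    moreover have "(\<integral>x. indicator (box l r) x *\<^sub>R v x \<partial>lborel) = (\<integral>x. indicator (cbox l r) x *\<^sub>R v x \<partial>lborel)"
    proof (rule integral_cong_AE)
      show "AE x in lborel. indicator (box l r) x *\<^sub>R v x = indicator (cbox l r) x *\<^sub>R v x"
        using indicator_box_cbox_AE[of l r] by eventually_elim simp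
    qed auto
    ultimately show ?thesis by simp
  qed
  have "conv (box_average \<delta>) v x = 0" for \<delta> x
  proof -
    have "conv (box_average \<delta>) v x
        = (\<integral>y. (1 / \<delta> ^ DIM('a)) *\<^sub>R (indicator (cbox x (x + \<delta> *\<^sub>R One)) y *\<^sub>R v y) \<partial>lborel)"
      unfolding conv_box_average by (intro Bochner_Integration.integral_cong) auto
    then show ?thesis unfolding integral_scaleR_right box by simp
  qed
  then have "AE x in lborel. (\<lambda>n::nat. 0) \<longlonglongrightarrow> v x"
    using conv_box_average_AE[OF v] by simp
  then show ?thesis by eventually_elim (simp add: LIMSEQ_const_iff)
qed

lemma weak_partial_unique:
  fixes v w :: "'a::euclidean_space \<Rightarrow> 'k::euclidean_space"
  assumes v: "v \<in> L2" and w: "w \<in> L2" and "weak_partial b u v" "weak_partial b u w"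
  shows "AE x in lborel. v x = w x"
proof -
  have "AE x in lborel. v x - w x = 0"
  proof (rule AE_zero_if_test_integrals_zero[OF L2_diff[OF v w]])
    fix \<phi> :: "'a \<Rightarrow> real" assume \<phi>: "test_function \<phi>"
    note k = kernel_test_function[OF \<phi>]
    have "(\<integral>x. \<phi> x *\<^sub>R v x \<partial>lborel) = (\<integral>x. \<phi> x *\<^sub>R w x \<partial>lborel)"
      using assms(3)[unfolded weak_partial_def, rule_format, OF \<phi>]
        assms(4)[unfolded weak_partial_def, rule_format, OF \<phi>] by simp
    then show "(\<integral>x. \<phi> x *\<^sub>R (v x - w x) \<partial>lborel) = 0"
      using integrable_kernel_scaleR[OF k v] integrable_kernel_scaleR[OF k w]
      by (simp add: scaleR_right_diff_distrib)
  qed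
  then show ?thesis by simp
qed

text \<open>\<open>H2\<close> asks for second derivatives of some witness of the first derivative,
  whereas \<open>wpd\<close> is a choice among such witnesses. This transfer across null sets makes
  them interchangeable.\<close>

lemma weak_partial_cong_AE:
  fixes u u' :: "'a::euclidean_space \<Rightarrow> 'k::euclidean_space"
  assumes b: "b \<in> Basis" and u: "u \<in> L2" "u' \<in> L2" "AE x in lborel. u x = u' x" and w: "weak_partial b u v"
  shows "weak_partial b u' v"
  unfolding weak_partial_def
proof (intro allI impI)
  fix \<phi> :: "'a \<Rightarrow> real" assume \<phi>: "test_function \<phi>"
  note [measurable] = kernel_measurable[OF kernel_test_function[OF test_function_partial[OF \<phi> b]]]
    u(1,2)[THEN L2_measurable]
  have "(\<integral>x. frechet_derivative \<phi> (at x) b *\<^sub>R u' x \<partial>lborel) = (\<integral>x. frechet_derivative \<phi> (at x) b *\<^sub>R u x \<partial>lborel)"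
  proof (rule integral_cong_AE)
    show "AE x in lborel. frechet_derivative \<phi> (at x) b *\<^sub>R u' x = frechet_derivative \<phi> (at x) b *\<^sub>R u x"
      using u(3) by eventually_elim simp
  qed simp_all
  then show "(\<integral>x. frechet_derivative \<phi> (at x) b *\<^sub>R u' x \<partial>lborel) = - (\<integral>x. \<phi> x *\<^sub>R v x \<partial>lborel)"
    using w \<phi> by (simp add: weak_partial_def)
qed

lemma wpd_props:
  assumes "v \<in> L2" "weak_partial b u v"
  shows "wpd b u \<in> L2" "weak_partial b u (wpd b u)" "AE x in lborel. wpd b u x = v x"
proof -
  have *: "wpd b u \<in> L2 \<and> weak_partial b u (wpd b u)"
    unfolding wpd_def by (rule someI[of _ v]) (use assms in blast)
  then show "wpd b u \<in> L2" "weak_partial b u (wpd b u)" by auto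
  then show "AE x in lborel. wpd b u x = v x" using assms by (intro weak_partial_unique)
qed

lemma H2_wpd:
  assumes "u \<in> H2" "b \<in> Basis"
  shows "wpd b u \<in> L2" "weak_partial b u (wpd b u)"
  using assms wpd_props unfolding H2_def by blast+

lemma H2_wpd_wpd:
  assumes u: "u \<in> H2" and b: "b \<in> Basis" "b' \<in> Basis"
  shows "wpd b' (wpd b u) \<in> L2" "weak_partial b' (wpd b u) (wpd b' (wpd b u))"
proof -
  obtain v w where v: "v \<in> L2" "weak_partial b u v" and w: "w \<in> L2" "weak_partial b' v w"
    using u b unfolding H2_def by blast
  have "AE x in lborel. v x = wpd b u x" using wpd_props(3)[OF v] by eventually_elim simp
  from weak_partial_cong_AE[OF b(2) v(1) wpd_props(1)[OF v] this w(2)]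
  have "weak_partial b' (wpd b u) w" .
  from wpd_props(1,2)[OF w(1) this]
  show "wpd b' (wpd b u) \<in> L2" "weak_partial b' (wpd b u) (wpd b' (wpd b u))" .
qed

lemma H2_L2: "u \<in> H2 \<Longrightarrow> u \<in> L2"
  by (simp add: H2_def)

lemma laplacian_L2: "u \<in> H2 \<Longrightarrow> laplacian u \<in> L2"
  unfolding laplacian_def[abs_def] by (intro L2_sum H2_wpd_wpd finite_Basis)

lemma grad_abs_power2: "(grad_abs u x)\<^sup>2 = (\<Sum>b\<in>Basis. (norm (wpd b u x))\<^sup>2)"
  unfolding grad_abs_def by (intro real_sqrt_pow2 sum_nonneg) auto

lemma integral_grad_abs_power2:
  "u \<in> H2 \<Longrightarrow> (\<integral>x. (grad_abs u x)\<^sup>2 \<partial>lborel) = (\<Sum>b\<in>Basis. \<integral>x. (norm (wpd b u x))\<^sup>2 \<partial>lborel)"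
  unfolding grad_abs_power2 by (intro Bochner_Integration.integral_sum L2_integrable H2_wpd)

section \<open>Error of the bump approximation on \<open>H2\<close>\<close>

lemma conv_bump_diff:
  assumes ab: "0 < a" "a \<le> b" and u: "u \<in> L2"
  shows "conv (bump a) u x - conv (bump b) u x
    = (\<Sum>e\<in>Basis. conv (\<lambda>x. frechet_derivative (bump_potential_partial a b e) (at x) e) u x)"
proof -
  have b: "0 < b" using ab by simp
  have "conv (bump a) u x - conv (bump b) u x = (\<integral>y. (bump a (x - y) - bump b (x - y)) *\<^sub>R u y \<partial>lborel)"
    using conv_integrable[OF kernel_bump[OF ab(1)] u] conv_integrable[OF kernel_bump[OF b] u]
    by (simp add: conv_def scaleR_left_diff_distrib)
  also have "\<dots> = (\<integral>y. (\<Sum>e\<in>Basis. frechet_derivative (bump_potential_partial a b e) (at (x - y)) e *\<^sub>R u y) \<partial>lborel)"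
    unfolding laplacian_bump_potential[OF ab, symmetric] scaleR_sum_left ..
  also have "\<dots> = (\<Sum>e\<in>Basis. conv (\<lambda>x. frechet_derivative (bump_potential_partial a b e) (at x) e) u x)"
    unfolding conv_def
    by (intro Bochner_Integration.integral_sum conv_integrable[OF _ u] kernel_test_function
        test_function_partial test_function_bump_potential_partial ab)
  finally show ?thesis .
qed

lemma conv_bump_diff_gradient:
  assumes ab: "0 < a" "a \<le> b" and u: "u \<in> H2"
  shows "conv (bump a) u x - conv (bump b) u x = (\<Sum>e\<in>Basis. conv (bump_potential_partial a b e) (wpd e u) x)"
  unfolding conv_bump_diff[OF ab H2_L2[OF u]]
  by (intro sum.cong conv_partial test_function_bump_potential_partial ab H2_wpd u refl)

text \<open>Both derivatives of the potential are moved onto u. Only the pure second derivatives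
  occur, with the same kernel, so they add up to the Laplacian; no mixed derivative has to be
  estimated.\<close>

lemma conv_bump_diff_laplacian:
  assumes ab: "0 < a" "a \<le> b" and u: "u \<in> H2"
  shows "conv (bump a) u x - conv (bump b) u x = conv (bump_potential a b) (laplacian u) x"
proof -
  have "conv (bump_potential_partial a b e) (wpd e u) x = conv (bump_potential a b) (wpd e (wpd e u)) x"
    if "e \<in> Basis" for e
    using conv_partial[OF test_function_bump_potential[OF ab] H2_wpd_wpd(2)[OF u that that], of x]
    by (simp add: frechet_derivative_bump_potential[OF ab])
  then show ?thesis
    unfolding conv_bump_diff_gradient[OF ab u] laplacian_def[abs_def]
    using conv_sum[OF finite_Basis kernel_test_function[OF test_function_bump_potential[OF ab]],
        of "\<lambda>e. wpd e (wpd e u)" x] H2_wpd_wpd(1)[OF u] by simp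
qed

text \<open>Young's inequality with the small potential bounds the distance to every finer smoothing
  uniformly in b, and \<open>approximate_identity_L2_bound\<close> lets b tend to infinity.\<close>

lemma bump_error_laplacian:
  fixes u :: "'a::euclidean_space \<Rightarrow> 'k::euclidean_space"
  assumes a: "0 < a" and u: "u \<in> H2"
  shows "(\<integral>\<^sup>+x. ennreal ((norm (conv (bump a) u x - (\<integral>(z::'a). bump 1 z \<partial>lborel) *\<^sub>R u x))\<^sup>2) \<partial>lborel)
    \<le> ennreal (((\<integral>(x::'a). flat 0 (1 - x \<bullet> x) \<partial>lborel) / a\<^sup>2)\<^sup>2 * (\<integral>x. (norm (laplacian u x))\<^sup>2 \<partial>lborel))"
proof (rule approximate_identity_L2_bound[OF conv_L2[OF kernel_bump[OF a] H2_L2[OF u]] H2_L2[OF u] a])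
  fix b assume ab: "a \<le> b"
  have "(\<integral>x. \<bar>bump_potential a b (x::'a)\<bar> \<partial>lborel)\<^sup>2 \<le> ((\<integral>(x::'a). flat 0 (1 - x \<bullet> x) \<partial>lborel) / a\<^sup>2)\<^sup>2"
    by (intro power_mono bump_potential_L1 a ab) simp
  then show "(\<integral>\<^sup>+x. ennreal ((norm (conv (bump a) u x - conv (bump b) u x))\<^sup>2) \<partial>lborel)
    \<le> ennreal (((\<integral>(x::'a). flat 0 (1 - x \<bullet> x) \<partial>lborel) / a\<^sup>2)\<^sup>2 * (\<integral>x. (norm (laplacian u x))\<^sup>2 \<partial>lborel))"
    unfolding conv_bump_diff_laplacian[OF a ab u]
    by (intro order_trans[OF conv_Young[OF kernel_test_function[OF test_function_bump_potential[OF a ab]]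
        laplacian_L2[OF u]]] ennreal_leI mult_right_mono) simp_all
qed

lemma norm_sum_squared_le:
  fixes f :: "'a \<Rightarrow> 'b::real_normed_vector"
  assumes "finite I"
  shows "(norm (\<Sum>i\<in>I. f i))\<^sup>2 \<le> card I * (\<Sum>i\<in>I. (norm (f i))\<^sup>2)"
proof -
  have "(norm (\<Sum>i\<in>I. f i))\<^sup>2 \<le> (\<Sum>i\<in>I. norm (f i) * 1)\<^sup>2"
    by (intro power_mono) (simp_all add: norm_sum)
  also have "\<dots> \<le> (\<Sum>i\<in>I. (norm (f i))\<^sup>2) * (\<Sum>i\<in>I. 1\<^sup>2)"
    by (rule Cauchy_Schwarz_ineq_sum)
  finally show ?thesis by (simp add: mult.commute)
qed

lemma nn_integral_norm_sum_squared_le: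
  fixes f :: "'i \<Rightarrow> 'a \<Rightarrow> 'b::euclidean_space" and c :: "'i \<Rightarrow> real"
  assumes I: "finite I" and f: "\<And>i. i \<in> I \<Longrightarrow> f i \<in> borel_measurable M"
    and le: "\<And>i. i \<in> I \<Longrightarrow> (\<integral>\<^sup>+x. ennreal ((norm (f i x))\<^sup>2) \<partial>M) \<le> ennreal (c i)"
    and c: "\<And>i. i \<in> I \<Longrightarrow> 0 \<le> c i"
  shows "(\<integral>\<^sup>+x. ennreal ((norm (\<Sum>i\<in>I. f i x))\<^sup>2) \<partial>M) \<le> ennreal (card I * (\<Sum>i\<in>I. c i))"
proof -
  let ?q = "\<lambda>i x. ennreal ((norm (f i x))\<^sup>2)"
  have m: "?q i \<in> borel_measurable M" if "i \<in> I" for i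
  proof -
    note [measurable] = f[OF that]
    show ?thesis by simp
  qed
  have "(\<integral>\<^sup>+x. ennreal ((norm (\<Sum>i\<in>I. f i x))\<^sup>2) \<partial>M) \<le> (\<integral>\<^sup>+x. ennreal (card I) * (\<Sum>i\<in>I. ?q i x) \<partial>M)"
  proof (rule nn_integral_mono)
    fix x
    have "ennreal ((norm (\<Sum>i\<in>I. f i x))\<^sup>2) \<le> ennreal (card I * (\<Sum>i\<in>I. (norm (f i x))\<^sup>2))"
      by (intro ennreal_leI norm_sum_squared_le I)
    also have "\<dots> = ennreal (card I) * (\<Sum>i\<in>I. ?q i x)"
      by (subst sum_ennreal) (auto intro!: ennreal_mult sum_nonneg)
    finally show "ennreal ((norm (\<Sum>i\<in>I. f i x))\<^sup>2) \<le> ennreal (card I) * (\<Sum>i\<in>I. ?q i x)" .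
  qed
  moreover have "(\<integral>\<^sup>+x. ennreal (card I) * (\<Sum>i\<in>I. ?q i x) \<partial>M) = ennreal (card I) * (\<Sum>i\<in>I. integral\<^sup>N M (?q i))"
    using m by (simp add: nn_integral_cmult nn_integral_sum del: sum_ennreal)
  moreover have "ennreal (card I) * (\<Sum>i\<in>I. integral\<^sup>N M (?q i)) \<le> ennreal (card I) * (\<Sum>i\<in>I. ennreal (c i))"
    by (intro mult_left_mono sum_mono le) auto
  moreover have "ennreal (card I) * (\<Sum>i\<in>I. ennreal (c i)) = ennreal (card I * (\<Sum>i\<in>I. c i))"
    using c by (subst sum_ennreal) (auto intro!: ennreal_mult[symmetric] sum_nonneg)
  ultimately show ?thesis by (simp only: order_trans)
qed

text \<open>Only one derivative is moved onto u here. The factor N comes from applying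
  Cauchy-Schwarz to the sum over the coordinate directions.\<close>

lemma bump_error_gradient:
  fixes u :: "'a::euclidean_space \<Rightarrow> 'k::euclidean_space"
  assumes a: "0 < a" and u: "u \<in> H2"
  shows "(\<integral>\<^sup>+x. ennreal ((norm (conv (bump a) u x - (\<integral>(z::'a). bump 1 z \<partial>lborel) *\<^sub>R u x))\<^sup>2) \<partial>lborel)
    \<le> ennreal (DIM('a) * ((\<integral>(x::'a). norm x * flat 1 (1 - x \<bullet> x) \<partial>lborel) / a)\<^sup>2
        * (\<integral>x. (grad_abs u x)\<^sup>2 \<partial>lborel))"
proof (rule approximate_identity_L2_bound[OF conv_L2[OF kernel_bump[OF a] H2_L2[OF u]] H2_L2[OF u] a])
  fix b assume ab: "a \<le> b"
  let ?G = "\<lambda>e. bump_potential_partial a b e :: 'a \<Rightarrow> real"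
  let ?K = "(\<integral>(x::'a). norm x * flat 1 (1 - x \<bullet> x) \<partial>lborel) / a"
  note k = kernel_test_function[OF test_function_bump_potential_partial[OF a ab]]
  have "(\<integral>\<^sup>+x. ennreal ((norm (\<Sum>e\<in>Basis. conv (?G e) (wpd e u) x))\<^sup>2) \<partial>lborel)
      \<le> ennreal (DIM('a) * (\<Sum>e\<in>Basis. ?K\<^sup>2 * (\<integral>x. (norm (wpd e u x))\<^sup>2 \<partial>lborel)))"
  proof (rule nn_integral_norm_sum_squared_le)
    fix e :: 'a assume e: "e \<in> Basis"
    show "conv (?G e) (wpd e u) \<in> borel_measurable lborel"
      using L2_measurable[OF conv_L2[OF k H2_wpd(1)[OF u e]]] by simp
    have "(\<integral>x. \<bar>?G e x\<bar> \<partial>lborel)\<^sup>2 \<le> ?K\<^sup>2" by (intro power_mono bump_potential_partial_L1 a ab e) simp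
    then show "(\<integral>\<^sup>+x. ennreal ((norm (conv (?G e) (wpd e u) x))\<^sup>2) \<partial>lborel)
        \<le> ennreal (?K\<^sup>2 * (\<integral>x. (norm (wpd e u x))\<^sup>2 \<partial>lborel))"
      by (intro order_trans[OF conv_Young[OF k H2_wpd(1)[OF u e]]] ennreal_leI mult_right_mono) simp_all
  qed simp_all
  then show "(\<integral>\<^sup>+x. ennreal ((norm (conv (bump a) u x - conv (bump b) u x))\<^sup>2) \<partial>lborel)
    \<le> ennreal (DIM('a) * ?K\<^sup>2 * (\<integral>x. (grad_abs u x)\<^sup>2 \<partial>lborel))"
    unfolding conv_bump_diff_gradient[OF a ab u] integral_grad_abs_power2[OF u]
    by (simp only: sum_distrib_left[symmetric] mult.assoc)
qed

section \<open>The mixed Gagliardo-Nirenberg inequality\<close>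

lemma layer_cake_powr:
  fixes f :: "'a::euclidean_space \<Rightarrow> real"
  assumes [measurable]: "f \<in> borel_measurable borel" and f: "\<And>x. 0 \<le> f x" and p: "0 < p"
  shows "(\<integral>\<^sup>+x. ennreal (f x powr p) \<partial>lborel)
    = (\<integral>\<^sup>+t. ennreal (indicator {0<..} t * (p * t powr (p - 1))) * emeasure lborel {x. t \<le> f x} \<partial>lborel)"
proof -
  have "(\<integral>\<^sup>+x. ennreal (f x powr p) \<partial>lborel)
      = (\<integral>\<^sup>+x. (\<integral>\<^sup>+t. ennreal (indicator {0<..} t * (p * t powr (p - 1))) * (if t \<le> f x then 1 else 0) \<partial>lborel) \<partial>lborel)"
  proof (rule nn_integral_cong)
    fix x
    have "((\<lambda>t. t powr (p - 1)) has_integral (f x powr (p - 1 + 1) / (p - 1 + 1))) {0..f x}"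
      using p f by (intro has_integral_powr_from_0) auto
    from has_integral_mult_right[OF this, of p]
    have "((\<lambda>t. p * t powr (p - 1)) has_integral f x powr p) {0..f x}" using p by simp
    then have "(\<integral>\<^sup>+t. ennreal (indicator {0..f x} t * (p * t powr (p - 1))) \<partial>lborel) = ennreal (f x powr p)"
      using p by (intro nn_integral_has_integral_lebesgue) auto
    then have "ennreal (f x powr p) = (\<integral>\<^sup>+t. ennreal (indicator {0..f x} t * (p * t powr (p - 1))) \<partial>lborel)"
      by simp
    also have "\<dots> = (\<integral>\<^sup>+t. ennreal (indicator {0<..} t * (p * t powr (p - 1))) * (if t \<le> f x then 1 else 0) \<partial>lborel)"
    proof (rule nn_integral_cong)
      fix t :: real
      show "ennreal (indicator {0..f x} t * (p * t powr (p - 1)))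
          = ennreal (indicator {0<..} t * (p * t powr (p - 1))) * (if t \<le> f x then 1 else 0)"
        \<comment> \<open>At t = 0 the two indicators disagree, but \<open>0 powr (p - 1)\<close> is
          0 for every exponent.\<close>
        by (cases "t = 0") (auto simp: indicator_def)
    qed
    finally show "ennreal (f x powr p)
      = (\<integral>\<^sup>+t. ennreal (indicator {0<..} t * (p * t powr (p - 1))) * (if t \<le> f x then 1 else 0) \<partial>lborel)" .
  qed
  also have "\<dots> = (\<integral>\<^sup>+t. (\<integral>\<^sup>+x. ennreal (indicator {0<..} t * (p * t powr (p - 1))) * (if t \<le> f x then 1 else 0) \<partial>lborel) \<partial>lborel)"
    by (rule lborel_pair.Fubini') measurable
  also have "\<dots> = (\<integral>\<^sup>+t. ennreal (indicator {0<..} t * (p * t powr (p - 1))) * emeasure lborel {x. t \<le> f x} \<partial>lborel)"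
  proof (rule nn_integral_cong)
    fix t
    have "(\<integral>\<^sup>+x. ennreal (indicator {0<..} t * (p * t powr (p - 1))) * indicator {x. t \<le> f x} x \<partial>lborel)
        = ennreal (indicator {0<..} t * (p * t powr (p - 1))) * emeasure lborel {x. t \<le> f x}"
      by (rule nn_integral_cmult_indicator) simp
    then show "(\<integral>\<^sup>+x. ennreal (indicator {0<..} t * (p * t powr (p - 1))) * (if t \<le> f x then 1 else 0) \<partial>lborel)
        = ennreal (indicator {0<..} t * (p * t powr (p - 1))) * emeasure lborel {x. t \<le> f x}"
      by (simp only: indicator_def of_bool_def mem_Collect_eq)
  qed
  finally show ?thesis .
qed

text \<open>The bound with exponent s makes the layer-cake integral converge at 0, the one with
  exponent r at infinity. Each is used on its side of a suitable level.\<close>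

lemma weak_type_interpolation:
  fixes f :: "'a::euclidean_space \<Rightarrow> real"
  assumes [measurable]: "f \<in> borel_measurable borel" and f: "\<And>x. 0 \<le> f x"
    and p: "0 < s" "s < p" "p < r" and nonneg: "0 \<le> \<alpha>" "0 \<le> \<beta>"
    and \<alpha>: "\<And>t. 0 < t \<Longrightarrow> emeasure lborel {x. t \<le> f x} \<le> ennreal (\<alpha> * t powr (- s))"
    and \<beta>: "\<And>t. 0 < t \<Longrightarrow> emeasure lborel {x. t \<le> f x} \<le> ennreal (\<beta> * t powr (- r))"
  shows "(\<integral>\<^sup>+x. ennreal (f x powr p) \<partial>lborel)
    \<le> ennreal (p * (1 / (p - s) + 1 / (r - p)) * (\<alpha> powr ((r - p) / (r - s)) * \<beta> powr ((p - s) / (r - s))))"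
proof (cases "\<alpha> = 0 \<or> \<beta> = 0")
  case True
  then have "emeasure lborel {x. t \<le> f x} = 0" if "0 < t" for t
    using \<alpha>[OF that] \<beta>[OF that] by auto
  then have "(\<integral>\<^sup>+x. ennreal (f x powr p) \<partial>lborel) = (\<integral>\<^sup>+t. 0 \<partial>(lborel :: real measure))"
    unfolding layer_cake_powr[OF assms(1) f order.strict_trans[OF p(1,2)]]
    by (intro nn_integral_cong) (auto simp: indicator_def)
  then show ?thesis by simp
next
  case False
  then have pos: "0 < \<alpha>" "0 < \<beta>" using nonneg by auto
  \<comment> \<open>The level at which \<alpha> L^(- s) = \<beta> L^(- r). With it both pieces
    become multiples of the same product \<open>W\<close>.\<close>
  define L where "L = (\<beta> / \<alpha>) powr (1 / (r - s))"
  have L: "0 < L" using pos by (simp add: L_def)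
  define W where "W = \<alpha> powr ((r - p) / (r - s)) * \<beta> powr ((p - s) / (r - s))"
  have WL: "\<alpha> * L powr (p - s) = W" "\<beta> * L powr (p - r) = W"
  proof -
    define \<theta> \<eta> where "\<theta> = (r - p) / (r - s)" and "\<eta> = (p - s) / (r - s)"
    have sum1: "\<theta> = 1 - \<eta>" "\<eta> = 1 - \<theta>" using p by (simp_all add: \<theta>_def \<eta>_def field_simps)
    have "L powr (p - s) = \<beta> powr \<eta> / \<alpha> powr \<eta>"
      unfolding L_def powr_powr \<eta>_def using pos by (simp add: powr_divide)
    moreover have "\<alpha> powr \<theta> = \<alpha> / \<alpha> powr \<eta>"
      unfolding sum1(1) powr_diff using pos by simp
    ultimately show "\<alpha> * L powr (p - s) = W"
      by (simp add: W_def flip: \<theta>_def \<eta>_def)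
    have "1 / (r - s) * (p - r) = - \<theta>" by (simp add: \<theta>_def diff_divide_distrib)
    then have "L powr (p - r) = \<alpha> powr \<theta> / \<beta> powr \<theta>"
      unfolding L_def powr_powr using pos by (simp add: powr_divide powr_minus_divide)
    moreover have "\<beta> powr \<eta> = \<beta> / \<beta> powr \<theta>"
      unfolding sum1(2) powr_diff using pos by simp
    ultimately show "\<beta> * L powr (p - r) = W"
      by (simp add: W_def flip: \<theta>_def \<eta>_def)
  qed
  have I: "(\<integral>\<^sup>+t. ennreal (indicator {0..L} t * (p * \<alpha> * t powr (p - 1 - s))) \<partial>lborel) = ennreal (p * W / (p - s))"
  proof -
    have "((\<lambda>t. t powr (p - 1 - s)) has_integral (L powr (p - 1 - s + 1) / (p - 1 - s + 1))) {0..L}"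
      using p L by (intro has_integral_powr_from_0) auto
    from has_integral_mult_right[OF this, of "p * \<alpha>"]
    have "((\<lambda>t. p * \<alpha> * t powr (p - 1 - s)) has_integral p * W / (p - s)) {0..L}"
      by (simp add: WL(1)[symmetric] mult.assoc)
    then show ?thesis
      using p pos by (intro nn_integral_has_integral_lebesgue) auto
  qed
  have J: "(\<integral>\<^sup>+t. ennreal (indicator {L..} t * (p * \<beta> * t powr (p - 1 - r))) \<partial>lborel) = ennreal (p * W / (r - p))"
  proof -
    have "((\<lambda>t. t powr (p - 1 - r)) has_integral - (L powr (p - 1 - r + 1)) / (p - 1 - r + 1)) {L..}"
      using p L by (intro has_integral_powr_to_inf) auto
    note has_integral_mult_right[OF this, of "p * \<beta>"]
    moreover have "p * \<beta> * (- (L powr (p - 1 - r + 1)) / (p - 1 - r + 1)) = p * W / (r - p)"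
      using p by (simp add: WL(2)[symmetric] field_simps)
    ultimately have "((\<lambda>t. p * \<beta> * t powr (p - 1 - r)) has_integral p * W / (r - p)) {L..}"
      by (simp only:)
    then show ?thesis
      using p pos by (intro nn_integral_has_integral_lebesgue) auto
  qed
  have "(\<integral>\<^sup>+x. ennreal (f x powr p) \<partial>lborel)
      \<le> (\<integral>\<^sup>+t. ennreal (indicator {0..L} t * (p * \<alpha> * t powr (p - 1 - s)))
            + ennreal (indicator {L..} t * (p * \<beta> * t powr (p - 1 - r))) \<partial>lborel)"
    unfolding layer_cake_powr[OF assms(1) f order.strict_trans[OF p(1,2)]]
  proof (rule nn_integral_mono)
    fix t :: real
    let ?m = "emeasure lborel {x. t \<le> f x}"
    have le: "ennreal (p * t powr (p - 1)) * ?m \<le> ennreal (p * \<gamma> * t powr (p - 1 - q))"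
      if "0 < t" "?m \<le> ennreal (\<gamma> * t powr (- q))" "0 \<le> \<gamma>" for \<gamma> q
    proof -
      have "ennreal (p * t powr (p - 1)) * ?m \<le> ennreal (p * t powr (p - 1)) * ennreal (\<gamma> * t powr (- q))"
        by (intro mult_left_mono that) simp
      also have "\<dots> = ennreal (p * t powr (p - 1) * (\<gamma> * t powr (- q)))"
        using p that by (intro ennreal_mult[symmetric]) auto
      also have "p * t powr (p - 1) * (\<gamma> * t powr (- q)) = p * \<gamma> * t powr (p - 1 - q)"
        by (simp add: powr_diff[of t "p - 1" q] powr_minus divide_inverse)
      finally show ?thesis .
    qed
    consider "t \<le> 0" | "0 < t" "t \<le> L" | "L < t" by linarith
    then show "ennreal (indicator {0<..} t * (p * t powr (p - 1))) * ?m
        \<le> ennreal (indicator {0..L} t * (p * \<alpha> * t powr (p - 1 - s)))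
          + ennreal (indicator {L..} t * (p * \<beta> * t powr (p - 1 - r)))"
    proof cases
      case 2
      then show ?thesis using le[OF _ \<alpha>[OF 2(1)] nonneg(1)] by (simp add: add_increasing2)
    next
      case 3
      then have "0 < t" using L by simp
      then show ?thesis using le[OF _ \<beta> nonneg(2)] 3 by simp
    qed simp
  qed
  also have "\<dots> = ennreal (p * W / (p - s)) + ennreal (p * W / (r - p))"
    unfolding I[symmetric] J[symmetric] by (rule nn_integral_add) simp_all
  also have "\<dots> = ennreal (p * (1 / (p - s) + 1 / (r - p)) * W)"
  proof -
    have "0 \<le> p * W / (p - s)" "0 \<le> p * W / (r - p)" using p by (simp_all add: W_def)
    moreover have "p * W / (p - s) + p * W / (r - p) = p * (1 / (p - s) + 1 / (r - p)) * W"
      by (simp add: distrib_left distrib_right)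
    ultimately show ?thesis by (simp only: ennreal_plus[symmetric])
  qed
  finally show ?thesis by (simp add: W_def)
qed

text \<open>Where |h| >= t, the vector Z h has length at least 2 T while |g| <= T, so the error is
  at least T; Chebyshev's inequality bounds the measure of that set.\<close>

lemma emeasure_superlevel_le:
  fixes g h :: "'a::euclidean_space \<Rightarrow> 'k::euclidean_space"
  assumes [measurable]: "g \<in> borel_measurable borel" "h \<in> borel_measurable borel"
    and T: "0 < T" and small: "\<And>x. norm (g x) \<le> T" and Z: "0 < Z" "Z * t = 2 * T"
    and le: "(\<integral>\<^sup>+x. ennreal ((norm (g x - Z *\<^sub>R h x))\<^sup>2) \<partial>lborel) \<le> ennreal E" "0 \<le> E"
  shows "emeasure lborel {x. t \<le> norm (h x)} \<le> ennreal (E / T\<^sup>2)"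
proof -
  have "emeasure lborel {x. t \<le> norm (h x)} = (\<integral>\<^sup>+x. indicator {x. t \<le> norm (h x)} x \<partial>lborel)"
    by (rule nn_integral_indicator[symmetric]) simp
  also have "\<dots> \<le> (\<integral>\<^sup>+x. ennreal (1 / T\<^sup>2) * ennreal ((norm (g x - Z *\<^sub>R h x))\<^sup>2) \<partial>lborel)"
  proof (rule nn_integral_mono)
    fix x
    show "indicator {x. t \<le> norm (h x)} x \<le> ennreal (1 / T\<^sup>2) * ennreal ((norm (g x - Z *\<^sub>R h x))\<^sup>2)"
    proof (cases "t \<le> norm (h x)")
      case True
      have "2 * T \<le> norm (Z *\<^sub>R h x)"
        using True Z mult_left_mono[OF True, of Z] by simp
      also have "\<dots> \<le> norm (g x) + norm (g x - Z *\<^sub>R h x)"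
        using norm_triangle_sub[of "Z *\<^sub>R h x" "g x"] by (simp add: norm_minus_commute)
      finally have "T \<le> norm (g x - Z *\<^sub>R h x)" using small[of x] by linarith
      then have "T\<^sup>2 \<le> (norm (g x - Z *\<^sub>R h x))\<^sup>2" using T by (intro power_mono) auto
      then have "1 \<le> 1 / T\<^sup>2 * (norm (g x - Z *\<^sub>R h x))\<^sup>2" using T by (simp add: field_simps)
      then have "ennreal 1 \<le> ennreal (1 / T\<^sup>2 * (norm (g x - Z *\<^sub>R h x))\<^sup>2)" by (rule ennreal_leI)
      also have "ennreal (1 / T\<^sup>2 * (norm (g x - Z *\<^sub>R h x))\<^sup>2)
          = ennreal (1 / T\<^sup>2) * ennreal ((norm (g x - Z *\<^sub>R h x))\<^sup>2)"
        by (rule ennreal_mult) auto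
      finally show ?thesis using True by simp
    qed simp
  qed
  also have "\<dots> = ennreal (1 / T\<^sup>2) * (\<integral>\<^sup>+x. ennreal ((norm (g x - Z *\<^sub>R h x))\<^sup>2) \<partial>lborel)"
    by (rule nn_integral_cmult) simp
  also have "\<dots> \<le> ennreal (1 / T\<^sup>2) * ennreal E"
    by (intro mult_left_mono le) simp
  also have "\<dots> = ennreal (E / T\<^sup>2)"
    using le(2) by (simp flip: ennreal_mult)
  finally show ?thesis .
qed

text \<open>A single argument for both error rates: q = 2 for the gradient and q = 4 for the
  Laplacian. The constant K is any positive upper bound, so that it may be divided by.\<close>

lemma bump_weak_type:
  fixes u :: "'a::euclidean_space \<Rightarrow> 'k::euclidean_space"
  assumes u: "u \<in> L2" and M: "0 < (\<integral>x. (norm (u x))\<^sup>2 \<partial>lborel)"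
    and K: "(\<integral>(z::'a). (bump 1 z)\<^sup>2 \<partial>lborel) \<le> K" "0 < K"
    and le: "\<And>a. 0 < a \<Longrightarrow>
      (\<integral>\<^sup>+x. ennreal ((norm (conv (bump a) u x - (\<integral>(z::'a). bump 1 z \<partial>lborel) *\<^sub>R u x))\<^sup>2) \<partial>lborel)
        \<le> ennreal (E / a powr q)" and E: "0 \<le> E" and t: "0 < t"
  shows "emeasure lborel {x. t \<le> norm (u x)}
    \<le> ennreal (E * (K * (\<integral>x. (norm (u x))\<^sup>2 \<partial>lborel)) powr (q / DIM('a))
        * ((\<integral>(z::'a). bump 1 z \<partial>lborel) / 2) powr (- (2 + 2 * q / DIM('a))) * t powr (- (2 + 2 * q / DIM('a))))"
proof -
  let ?N = "real DIM('a)"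
  define Z M' where "Z = (\<integral>(z::'a). bump 1 z \<partial>lborel)" and "M' = (\<integral>x. (norm (u x))\<^sup>2 \<partial>lborel)"
  have Z: "0 < Z" unfolding Z_def by (rule integral_bump_pos)
  have M': "0 < M'" using M by (simp add: M'_def)
  define T where "T = Z * t / 2"
  have T: "0 < T" using Z t by (simp add: T_def)
  \<comment> \<open>This width makes the pointwise bound a^N K M' of the squared smoothing equal to
    T^2. Then E / (a^q T^2) is proportional to T^(- 2 - 2 q / N).\<close>
  define a where "a = (T\<^sup>2 / (K * M')) powr (1 / ?N)"
  have a: "0 < a" unfolding a_def using T K M' by simp
  have aN: "a ^ DIM('a) = T\<^sup>2 / (K * M')"
  proof -
    have "a ^ DIM('a) = a powr ?N" using a by (simp add: powr_realpow)
    also have "\<dots> = (T\<^sup>2 / (K * M')) powr 1" by (simp add: a_def powr_powr)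
    finally show ?thesis using T K M' by simp
  qed
  have small: "norm (conv (bump a) u x) \<le> T" for x
  proof -
    have "(norm (conv (bump a) u x))\<^sup>2 \<le> a ^ DIM('a) * (\<integral>(z::'a). (bump 1 z)\<^sup>2 \<partial>lborel) * M'"
      unfolding M'_def by (rule conv_bump_bound[OF a u])
    also have "\<dots> \<le> a ^ DIM('a) * K * M'"
      using a K M' by (intro mult_right_mono mult_left_mono) auto
    also have "\<dots> = T\<^sup>2" unfolding aN using K M' by simp
    finally show ?thesis using T by (simp add: power2_le_iff_abs_le)
  qed
  have "emeasure lborel {x. t \<le> norm (u x)} \<le> ennreal (E / a powr q / T\<^sup>2)"
  proof (rule emeasure_superlevel_le[OF _ L2_measurable[OF u] T small Z])
    show "conv (bump a) u \<in> borel_measurable borel"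
      by (rule L2_measurable[OF conv_L2[OF kernel_bump[OF a] u]])
    show "Z * t = 2 * T" by (simp add: T_def)
    show "(\<integral>\<^sup>+x. ennreal ((norm (conv (bump a) u x - Z *\<^sub>R u x))\<^sup>2) \<partial>lborel) \<le> ennreal (E / a powr q)"
      unfolding Z_def by (rule le[OF a])
  qed (use E in simp)
  also have "E / a powr q / T\<^sup>2 = E * (K * M') powr (q / ?N) * T powr (- (2 + 2 * q / ?N))"
  proof -
    have P: "(T\<^sup>2) powr (q / ?N) = T powr (2 * q / ?N)"
      using T powr_powr[of T 2 "q / ?N"] by simp
    have "a powr q = (T\<^sup>2 / (K * M')) powr (q / ?N)" by (simp add: a_def powr_powr)
    also have "\<dots> = T powr (2 * q / ?N) / (K * M') powr (q / ?N)"
      unfolding P[symmetric] by (rule powr_divide)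
    finally have aq: "a powr q = T powr (2 * q / ?N) / (K * M') powr (q / ?N)" .
    have "T powr (- (2 + 2 * q / ?N)) = 1 / (T\<^sup>2 * T powr (2 * q / ?N))"
      unfolding powr_minus_divide powr_add using T by simp
    then show ?thesis unfolding aq by simp
  qed
  also have "T powr (- (2 + 2 * q / ?N)) = (Z / 2) powr (- (2 + 2 * q / ?N)) * t powr (- (2 + 2 * q / ?N))"
    unfolding T_def using Z t powr_mult[of "Z / 2" t] by simp
  finally show ?thesis by (simp add: Z_def M'_def mult.assoc)
qed

lemma integral_le_of_nn_integral_le:
  fixes f :: "'a \<Rightarrow> real"
  assumes "f \<in> borel_measurable M" "\<And>x. 0 \<le> f x" "(\<integral>\<^sup>+x. ennreal (f x) \<partial>M) \<le> ennreal C" "0 \<le> C"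
  shows "(\<integral>x. f x \<partial>M) \<le> C"
  using assms enn2real_mono[OF assms(3)] by (simp add: integral_eq_nn_integral)

lemma integral_norm_powr_eq_0:
  assumes "u \<in> L2" "(\<integral>x. (norm (u x))\<^sup>2 \<partial>lborel) = 0"
  shows "(\<integral>x. norm (u x) powr p \<partial>lborel) = 0"
proof -
  have "AE x in lborel. (norm (u x))\<^sup>2 = 0"
    using integral_nonneg_eq_0_iff_AE[OF L2_integrable[OF assms(1)]] assms(2) by simp
  then have "AE x in lborel. norm (u x) powr p = 0" by eventually_elim simp
  then show ?thesis by (rule integral_eq_zero_AE)
qed

text \<open>In terms of squared norms the exponents are half of those for norms. Some finite
  constant is produced here; the best one is taken afterwards as an infimum.\<close>

lemma mixed_Gagliardo_Nirenberg:
  fixes p :: real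
  defines "N \<equiv> real DIM('a::euclidean_space)"
  assumes p: "2 + 4 / N < p" "p < 2 + 8 / N"
  shows "\<exists>C\<ge>0. \<forall>u \<in> (H2 :: ('a \<Rightarrow> 'k::euclidean_space) set).
    (\<integral>x. norm (u x) powr p \<partial>lborel)
      \<le> C * (\<integral>x. (norm (laplacian u x))\<^sup>2 \<partial>lborel) powr ((N * (p - 2) - 4) / 4)
          * (\<integral>x. (grad_abs u x)\<^sup>2 \<partial>lborel) powr ((8 - N * (p - 2)) / 4)
          * (\<integral>x. (norm (u x))\<^sup>2 \<partial>lborel) powr ((p - 2) / 2)"
proof -
  have N: "0 < N" by (simp add: N_def)
  \<comment> \<open>Adding 1 makes K positive at once.\<close>
  define Z K where "Z = (\<integral>(z::'a). bump 1 z \<partial>lborel)" and "K = (\<integral>(z::'a). (bump 1 z)\<^sup>2 \<partial>lborel) + 1"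
  have K: "(\<integral>(z::'a). (bump 1 z)\<^sup>2 \<partial>lborel) \<le> K" "0 < K"
    by (simp_all add: K_def add_nonneg_pos)
  define K0 K1 where "K0 = (\<integral>(x::'a). flat 0 (1 - x \<bullet> x) \<partial>lborel)"
    and "K1 = (\<integral>(x::'a). norm x * flat 1 (1 - x \<bullet> x) \<partial>lborel)"
  \<comment> \<open>The constants c1 and c2 collect the factors that \<open>bump_weak_type\<close>
    yields for q = 2 and q = 4, apart from the powers of the norms of u.\<close>
  define c1 where "c1 = N * K1\<^sup>2 * K powr (2 / N) * (Z / 2) powr (- (2 + 4 / N))"
  define c2 where "c2 = K0\<^sup>2 * K powr (4 / N) * (Z / 2) powr (- (2 + 8 / N))"
  have c: "0 \<le> c1" "0 \<le> c2" using N by (simp_all add: c1_def c2_def)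
  define \<theta> where "\<theta> = (8 - N * (p - 2)) / 4"
  define \<eta> where "\<eta> = (N * (p - 2) - 4) / 4"
  define C where "C = p * (1 / (p - (2 + 4 / N)) + 1 / (2 + 8 / N - p)) * (c1 powr \<theta> * c2 powr \<eta>)"
  have p0: "0 < p" using p N by (smt (verit) divide_pos_pos)
  have C: "0 \<le> C" unfolding C_def using p p0 by (intro mult_nonneg_nonneg add_nonneg_nonneg) auto
  show ?thesis
  proof (intro exI[of _ C] conjI ballI C)
    fix u :: "'a \<Rightarrow> 'k" assume u: "u \<in> H2"
    define A B M where "A = (\<integral>x. (norm (laplacian u x))\<^sup>2 \<partial>lborel)" and "B = (\<integral>x. (grad_abs u x)\<^sup>2 \<partial>lborel)"
      and "M = (\<integral>x. (norm (u x))\<^sup>2 \<partial>lborel)"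
    have nn: "0 \<le> A" "0 \<le> B" "0 \<le> M" by (simp_all add: A_def B_def M_def)
    have "(\<integral>x. norm (u x) powr p \<partial>lborel) \<le> C * (A powr \<eta> * B powr \<theta> * M powr ((p - 2) / 2))"
    proof (cases "M = 0")
      case True
      then show ?thesis using integral_norm_powr_eq_0[OF H2_L2[OF u]] C by (simp add: M_def)
    next
      case False
      then have M: "0 < M" using nn by simp
      have grad: "emeasure lborel {x. t \<le> norm (u x)} \<le> ennreal (c1 * M powr (2 / N) * B * t powr (- (2 + 4 / N)))"
        if t: "0 < t" for t
      proof -
        have "emeasure lborel {x. t \<le> norm (u x)}
          \<le> ennreal (N * K1\<^sup>2 * B * (K * M) powr (2 / N) * (Z / 2) powr (- (2 + 2 * 2 / N)) * t powr (- (2 + 2 * 2 / N)))"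
          unfolding M_def Z_def N_def
        proof (rule bump_weak_type[OF H2_L2[OF u] M[unfolded M_def] K _ _ t])
          fix a :: real assume a: "0 < a"
          show "(\<integral>\<^sup>+x. ennreal ((norm (conv (bump a) u x - (\<integral>(z::'a). bump 1 z \<partial>lborel) *\<^sub>R u x))\<^sup>2) \<partial>lborel)
              \<le> ennreal (real DIM('a) * K1\<^sup>2 * B / a powr 2)"
            using bump_error_gradient[OF a u] a by (simp add: K1_def B_def power_divide)
        qed (use nn in simp)
        also have "(K * M) powr (2 / N) = K powr (2 / N) * M powr (2 / N)"
          using K M by (simp add: powr_mult)
        finally show ?thesis by (simp add: c1_def mult_ac)
      qed
      have lap: "emeasure lborel {x. t \<le> norm (u x)} \<le> ennreal (c2 * M powr (4 / N) * A * t powr (- (2 + 8 / N)))"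
        if t: "0 < t" for t
      proof -
        have "emeasure lborel {x. t \<le> norm (u x)}
          \<le> ennreal (K0\<^sup>2 * A * (K * M) powr (4 / N) * (Z / 2) powr (- (2 + 2 * 4 / N)) * t powr (- (2 + 2 * 4 / N)))"
          unfolding M_def Z_def N_def
        proof (rule bump_weak_type[OF H2_L2[OF u] M[unfolded M_def] K _ _ t])
          fix a :: real assume a: "0 < a"
          show "(\<integral>\<^sup>+x. ennreal ((norm (conv (bump a) u x - (\<integral>(z::'a). bump 1 z \<partial>lborel) *\<^sub>R u x))\<^sup>2) \<partial>lborel)
              \<le> ennreal (K0\<^sup>2 * A / a powr 4)"
            using bump_error_laplacian[OF a u] a by (simp add: K0_def A_def power_divide)
        qed (use nn in simp)
        also have "(K * M) powr (4 / N) = K powr (4 / N) * M powr (4 / N)"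
          using K M by (simp add: powr_mult)
        finally show ?thesis by (simp add: c2_def mult_ac)
      qed
      \<comment> \<open>The two weak-type exponents differ by 4 / N, so the interpolation weights
        are the exponents of the claim.\<close>
      have \<theta>: "(2 + 8 / N - p) / (2 + 8 / N - (2 + 4 / N)) = \<theta>"
        and \<eta>: "(p - (2 + 4 / N)) / (2 + 8 / N - (2 + 4 / N)) = \<eta>"
        using N by (simp_all add: \<theta>_def \<eta>_def field_simps)
      have [measurable]: "u \<in> borel_measurable borel" by (rule L2_measurable[OF H2_L2[OF u]])
      have "(\<integral>\<^sup>+x. ennreal (norm (u x) powr p) \<partial>lborel)
          \<le> ennreal (p * (1 / (p - (2 + 4 / N)) + 1 / (2 + 8 / N - p))
              * ((c1 * M powr (2 / N) * B) powr \<theta> * (c2 * M powr (4 / N) * A) powr \<eta>))"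
        unfolding \<theta>[symmetric] \<eta>[symmetric]
        using c nn N p by (intro weak_type_interpolation grad lap) (auto simp: add_pos_nonneg)
      also have "(c1 * M powr (2 / N) * B) powr \<theta> * (c2 * M powr (4 / N) * A) powr \<eta>
          = c1 powr \<theta> * c2 powr \<eta> * (A powr \<eta> * B powr \<theta> * M powr (2 / N * \<theta> + 4 / N * \<eta>))"
        using c nn by (simp add: powr_mult powr_powr powr_add mult_ac)
      also have "2 / N * \<theta> + 4 / N * \<eta> = (p - 2) / 2"
        using N by (simp add: \<theta>_def \<eta>_def field_simps)
      finally have "(\<integral>\<^sup>+x. ennreal (norm (u x) powr p) \<partial>lborel)
          \<le> ennreal (C * (A powr \<eta> * B powr \<theta> * M powr ((p - 2) / 2)))"
        by (simp add: C_def mult.assoc)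
      then show ?thesis
        using C by (intro integral_le_of_nn_integral_le) auto
    qed
    then show "(\<integral>x. norm (u x) powr p \<partial>lborel)
      \<le> C * A powr ((N * (p - 2) - 4) / 4) * B powr ((8 - N * (p - 2)) / 4) * M powr ((p - 2) / 2)"
      by (simp add: \<theta>_def \<eta>_def mult.assoc)
  qed
qed

section \<open>Dilations\<close>

definition dilate :: "real \<Rightarrow> real \<Rightarrow> ('a::euclidean_space \<Rightarrow> 'k::euclidean_space) \<Rightarrow> 'a \<Rightarrow> 'k" where
  "dilate a c u x = a *\<^sub>R u (c *\<^sub>R x)"

lemma integral_dilate_arg:
  fixes f :: "'a::euclidean_space \<Rightarrow> 'b::{banach, second_countable_topology}"
  assumes "0 < c"
  shows "(\<integral>x. f (c *\<^sub>R x) \<partial>lborel) = (1 / c ^ DIM('a)) *\<^sub>R (\<integral>x. f x \<partial>lborel)"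
  using lborel_integral_affine[of c f 0] assms by simp

text \<open>The derivative of u is tested against \<phi>(y / c) and y = c x is substituted. The same
  Jacobian appears on both sides; the inner derivative 1 / c accounts for the new amplitude a
  c.\<close>

lemma weak_partial_dilate:
  fixes u w :: "'a::euclidean_space \<Rightarrow> 'k::euclidean_space"
  assumes c: "0 < c" and uw: "weak_partial b u w"
  shows "weak_partial b (dilate a c u) (dilate (a * c) c w)"
  unfolding weak_partial_def
proof (intro allI impI)
  fix \<phi> :: "'a \<Rightarrow> real" assume \<phi>: "test_function \<phi>"
  define \<psi> where "\<psi> = (\<lambda>y. \<phi> ((1 / c) *\<^sub>R y + 0))"
  have "test_function \<psi>" unfolding \<psi>_def by (intro test_function_affine_arg \<phi>) (use c in simp)
  with uw have I: "(\<integral>y. frechet_derivative \<psi> (at y) b *\<^sub>R u y \<partial>lborel) = - (\<integral>y. \<psi> y *\<^sub>R w y \<partial>lborel)"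
    unfolding weak_partial_def by blast
  have D: "frechet_derivative \<psi> (at (c *\<^sub>R x)) b = 1 / c * frechet_derivative \<phi> (at x) b" for x
    unfolding \<psi>_def frechet_derivative_affine_arg[OF \<phi>] using c by simp
  have "(\<integral>x. frechet_derivative \<phi> (at x) b *\<^sub>R dilate a c u x \<partial>lborel)
      = (\<integral>x. (a * c) *\<^sub>R (frechet_derivative \<psi> (at (c *\<^sub>R x)) b *\<^sub>R u (c *\<^sub>R x)) \<partial>lborel)"
    unfolding D dilate_def using c by (intro Bochner_Integration.integral_cong) (simp_all add: mult.commute)
  also have "\<dots> = (a * c) *\<^sub>R (1 / c ^ DIM('a)) *\<^sub>R (\<integral>y. frechet_derivative \<psi> (at y) b *\<^sub>R u y \<partial>lborel)"
    unfolding integral_scaleR_right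
    by (subst integral_dilate_arg[OF c, of "\<lambda>y. frechet_derivative \<psi> (at y) b *\<^sub>R u y"]) simp
  also have "\<dots> = - ((a * c) *\<^sub>R (1 / c ^ DIM('a)) *\<^sub>R (\<integral>y. \<psi> y *\<^sub>R w y \<partial>lborel))"
    unfolding I by simp
  also have "\<dots> = - (\<integral>x. (a * c) *\<^sub>R (\<psi> (c *\<^sub>R x) *\<^sub>R w (c *\<^sub>R x)) \<partial>lborel)"
    unfolding integral_scaleR_right
    by (subst integral_dilate_arg[OF c, of "\<lambda>y. \<psi> y *\<^sub>R w y"]) simp
  also have "\<dots> = - (\<integral>x. \<phi> x *\<^sub>R dilate (a * c) c w x \<partial>lborel)"
    unfolding \<psi>_def dilate_def using c
    by (intro arg_cong[where f = uminus] Bochner_Integration.integral_cong) (simp_all add: mult.commute)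
  finally show "(\<integral>x. frechet_derivative \<phi> (at x) b *\<^sub>R dilate a c u x \<partial>lborel)
      = - (\<integral>x. \<phi> x *\<^sub>R dilate (a * c) c w x \<partial>lborel)" .
qed

lemma L2_dilate: "u \<in> L2 \<Longrightarrow> 0 < c \<Longrightarrow> dilate a c u \<in> L2"
  using L2_scaleR[OF L2_affine_arg[of u c 0], of a] by (simp add: dilate_def[abs_def])

lemma dilate_AE_wpd:
  assumes u: "u \<in> H2" and c: "0 < c" and b: "b \<in> Basis"
  shows "AE x in lborel. wpd b (dilate a c u) x = dilate (a * c) c (wpd b u) x"
  by (rule wpd_props(3)[OF L2_dilate[OF H2_wpd(1)[OF u b] c] weak_partial_dilate[OF c H2_wpd(2)[OF u b]]])

lemma H2_dilate:
  assumes u: "u \<in> H2" and c: "0 < c"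
  shows "dilate a c u \<in> H2"
  unfolding H2_def
proof (intro CollectI conjI ballI)
  show "dilate a c u \<in> L2" by (rule L2_dilate[OF H2_L2[OF u] c])
  fix b assume b: "b \<in> (Basis :: 'a set)"
  show "\<exists>v\<in>L2. weak_partial b (dilate a c u) v \<and> (\<forall>b'\<in>Basis. \<exists>w\<in>L2. weak_partial b' v w)"
  proof (rule bexI[of _ "dilate (a * c) c (wpd b u)"], intro conjI ballI)
    show "weak_partial b (dilate a c u) (dilate (a * c) c (wpd b u))"
      by (rule weak_partial_dilate[OF c H2_wpd(2)[OF u b]])
    fix b' assume b': "b' \<in> (Basis :: 'a set)"
    show "\<exists>w\<in>L2. weak_partial b' (dilate (a * c) c (wpd b u)) w"
      using weak_partial_dilate[OF c H2_wpd_wpd(2)[OF u b b']] L2_dilate[OF H2_wpd_wpd(1)[OF u b b'] c]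
      by blast
  next
    show "dilate (a * c) c (wpd b u) \<in> L2" by (rule L2_dilate[OF H2_wpd(1)[OF u b] c])
  qed
qed

text \<open>The chosen first derivative of the dilation is the dilated first derivative only up to a
  null set, so the second differentiation goes through \<open>weak_partial_cong_AE\<close>.\<close>

lemma dilate_AE_wpd_wpd:
  assumes u: "u \<in> H2" and c: "0 < c" and b: "b \<in> Basis"
  shows "AE x in lborel. wpd b (wpd b (dilate a c u)) x = dilate (a * c\<^sup>2) c (wpd b (wpd b u)) x"
proof -
  have "AE x in lborel. dilate (a * c) c (wpd b u) x = wpd b (dilate a c u) x"
    using dilate_AE_wpd[OF u c b, of a] by eventually_elim simp
  from weak_partial_cong_AE[OF b L2_dilate[OF H2_wpd(1)[OF u b] c] H2_wpd(1)[OF H2_dilate[OF u c] b] this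
      weak_partial_dilate[OF c H2_wpd_wpd(2)[OF u b b]]]
  have "weak_partial b (wpd b (dilate a c u)) (dilate (a * c * c) c (wpd b (wpd b u)))" .
  from wpd_props(3)[OF L2_dilate[OF H2_wpd_wpd(1)[OF u b b] c] this]
  show ?thesis by (simp add: power2_eq_square mult.assoc)
qed

lemma laplacian_dilate_AE:
  assumes u: "u \<in> H2" and c: "0 < c"
  shows "AE x in lborel. laplacian (dilate a c u) x = dilate (a * c\<^sup>2) c (laplacian u) x"
proof -
  have "AE x in lborel. \<forall>b\<in>Basis. wpd b (wpd b (dilate a c u)) x = dilate (a * c\<^sup>2) c (wpd b (wpd b u)) x"
    by (intro AE_finite_allI finite_Basis dilate_AE_wpd_wpd u c)
  then show ?thesis
    by eventually_elim (simp add: laplacian_def dilate_def scaleR_sum_right)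
qed

lemma integral_norm_power2_dilate:
  fixes f :: "'a::euclidean_space \<Rightarrow> 'k::euclidean_space"
  assumes "0 < c"
  shows "(\<integral>x. (norm (dilate a c f x))\<^sup>2 \<partial>lborel) = a\<^sup>2 / c ^ DIM('a) * (\<integral>x. (norm (f x))\<^sup>2 \<partial>lborel)"
  using integral_dilate_arg[OF assms, of "\<lambda>x. a\<^sup>2 * (norm (f x))\<^sup>2"]
  by (simp add: dilate_def power_mult_distrib)

lemma integral_norm_powr_dilate:
  fixes f :: "'a::euclidean_space \<Rightarrow> 'k::euclidean_space"
  assumes "0 < c"
  shows "(\<integral>x. norm (dilate a c f x) powr p \<partial>lborel)
    = \<bar>a\<bar> powr p / c ^ DIM('a) * (\<integral>x. norm (f x) powr p \<partial>lborel)"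
  using integral_dilate_arg[OF assms, of "\<lambda>x. \<bar>a\<bar> powr p * norm (f x) powr p"]
  by (simp add: dilate_def powr_mult)

lemma integral_laplacian_dilate:
  fixes u :: "'a::euclidean_space \<Rightarrow> 'k::euclidean_space"
  assumes u: "u \<in> H2" and c: "0 < c"
  shows "(\<integral>x. (norm (laplacian (dilate a c u) x))\<^sup>2 \<partial>lborel)
    = a\<^sup>2 * c ^ 4 / c ^ DIM('a) * (\<integral>x. (norm (laplacian u x))\<^sup>2 \<partial>lborel)"
proof -
  note [measurable] = L2_measurable[OF laplacian_L2[OF H2_dilate[OF u c]]]
    L2_measurable[OF L2_dilate[OF laplacian_L2[OF u] c]]
  have "(\<integral>x. (norm (laplacian (dilate a c u) x))\<^sup>2 \<partial>lborel)
      = (\<integral>x. (norm (dilate (a * c\<^sup>2) c (laplacian u) x))\<^sup>2 \<partial>lborel)"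
  proof (rule integral_cong_AE)
    show "AE x in lborel. (norm (laplacian (dilate a c u) x))\<^sup>2 = (norm (dilate (a * c\<^sup>2) c (laplacian u) x))\<^sup>2"
      using laplacian_dilate_AE[OF u c, of a] by eventually_elim simp
  qed simp_all
  then show ?thesis
    by (simp add: integral_norm_power2_dilate[OF c] power_mult_distrib flip: power_mult)
qed

lemma integral_grad_abs_dilate:
  fixes u :: "'a::euclidean_space \<Rightarrow> 'k::euclidean_space"
  assumes u: "u \<in> H2" and c: "0 < c"
  shows "(\<integral>x. (grad_abs (dilate a c u) x)\<^sup>2 \<partial>lborel) = a\<^sup>2 * c\<^sup>2 / c ^ DIM('a) * (\<integral>x. (grad_abs u x)\<^sup>2 \<partial>lborel)"
proof -
  have "(\<integral>x. (norm (wpd b (dilate a c u) x))\<^sup>2 \<partial>lborel)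
      = a\<^sup>2 * c\<^sup>2 / c ^ DIM('a) * (\<integral>x. (norm (wpd b u x))\<^sup>2 \<partial>lborel)" if b: "b \<in> Basis" for b
  proof -
    note [measurable] = L2_measurable[OF H2_wpd(1)[OF H2_dilate[OF u c] b]]
      L2_measurable[OF L2_dilate[OF H2_wpd(1)[OF u b] c]]
    have "(\<integral>x. (norm (wpd b (dilate a c u) x))\<^sup>2 \<partial>lborel)
        = (\<integral>x. (norm (dilate (a * c) c (wpd b u) x))\<^sup>2 \<partial>lborel)"
    proof (rule integral_cong_AE)
      show "AE x in lborel. (norm (wpd b (dilate a c u) x))\<^sup>2 = (norm (dilate (a * c) c (wpd b u) x))\<^sup>2"
        using dilate_AE_wpd[OF u c b, of a] by eventually_elim simp
    qed simp_all
    then show ?thesis by (simp add: integral_norm_power2_dilate[OF c] power_mult_distrib)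
  qed
  then show ?thesis
    unfolding integral_grad_abs_power2[OF u] integral_grad_abs_power2[OF H2_dilate[OF u c]] sum_distrib_left
    by (rule sum.cong[OF refl])
qed

section \<open>Test functions as elements of \<open>H2\<close>\<close>

lemma test_function_mult:
  assumes "test_function \<phi>" "test_function \<psi>"
  shows "test_function (\<lambda>x. \<phi> x * \<psi> x)"
proof -
  obtain R where "R > 0" "\<And>x. R < norm x \<Longrightarrow> \<phi> x = 0"
    using test_function_bounded_support[OF assms(1)] by blast
  then show ?thesis
    using assms by (intro test_function_cut[where R = R] Ck_mult) (auto simp: test_function_def)
qed

text \<open>By translation invariance every difference quotient has integral 0. The mean value
  theorem bounds these quotients, and dominated convergence passes to the derivative.\<close>

lemma integral_partial_test_function:
  fixes f :: "'a::euclidean_space \<Rightarrow> real"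
  assumes f: "test_function f" and b: "b \<in> Basis"
  shows "(\<integral>x. frechet_derivative f (at x) b \<partial>lborel) = 0"
proof -
  let ?D = "\<lambda>x. frechet_derivative f (at x) b"
  note kf = kernel_test_function[OF f] and kD = kernel_test_function[OF test_function_partial[OF f b]]
  note [measurable] = kernel_measurable[OF kf] kernel_measurable[OF kD]
  obtain R where R: "R > 0" "\<And>x. R < norm x \<Longrightarrow> f x = 0"
    using test_function_bounded_support[OF f] by blast
  obtain B where B: "\<And>x. \<bar>?D x\<bar> \<le> B" using kD by (auto simp: kernel_def)
  define h where "h = (\<lambda>n. 1 / real (Suc n))"
  have h: "0 < h n" "h n \<le> 1" for n by (simp_all add: h_def)
  have line: "((\<lambda>t. f (x + t *\<^sub>R b)) has_real_derivative ?D (x + t *\<^sub>R b)) (at t)" for x t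
  proof -
    have "((\<lambda>t. x + t *\<^sub>R b) has_derivative (\<lambda>s. s *\<^sub>R b)) (at t)"
      by (auto intro!: derivative_eq_intros)
    from diff_chain_at[OF this test_function_has_derivative[OF f]]
    have "((\<lambda>t. f (x + t *\<^sub>R b)) has_derivative (\<lambda>s. frechet_derivative f (at (x + t *\<^sub>R b)) (s *\<^sub>R b))) (at t)"
      by (simp add: comp_def)
    then show ?thesis
      using linear_cmul[OF has_derivative_linear[OF test_function_has_derivative[OF f]]]
      by (simp add: has_field_derivative_def mult.commute[of _ "frechet_derivative f _ _"])
  qed
  let ?q = "\<lambda>n x. (f (x + h n *\<^sub>R b) - f x) / h n"
  have lim: "(\<lambda>n. ?q n x) \<longlonglongrightarrow> ?D x" for x
  proof -
    have "((\<lambda>t. (f (x + t *\<^sub>R b) - f x) / t) \<longlongrightarrow> ?D x) (at 0)"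
      using line[of x 0] by (simp add: DERIV_def)
    moreover have "filterlim h (at 0) sequentially"
      unfolding filterlim_at using h(1) LIMSEQ_inverse_real_of_nat
      by (auto simp: h_def inverse_eq_divide intro!: always_eventually)
    ultimately show ?thesis by (rule filterlim_compose)
  qed
  have "(\<lambda>n. \<integral>x. ?q n x \<partial>lborel) \<longlonglongrightarrow> (\<integral>x. ?D x \<partial>lborel)"
  \<comment> \<open>The increments are at most 1 along a unit vector, so a ball of radius R + 1
    contains the supports of all difference quotients.\<close>
  proof (rule integral_dominated_convergence[where w = "\<lambda>x. B * indicator (cball 0 (R + 1)) x"])
    show "integrable lborel (\<lambda>x::'a. B * indicator (cball 0 (R + 1)) x)"
      by (intro integrable_mult_right kernel_integrable kernel_indicator) auto
    show "AE x in lborel. (\<lambda>n. ?q n x) \<longlonglongrightarrow> ?D x" by (intro AE_I2 lim)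
    show "AE x in lborel. norm (?q n x) \<le> B * indicator (cball 0 (R + 1)) x" for n
    proof (rule AE_I2)
      fix x :: 'a
      show "norm (?q n x) \<le> B * indicator (cball 0 (R + 1)) x"
      proof (cases "norm x \<le> R + 1")
        case True
        obtain z where "f (x + h n *\<^sub>R b) - f (x + 0 *\<^sub>R b) = (h n - 0) * ?D (x + z *\<^sub>R b)"
          using MVT2[OF h(1)[of n], of "\<lambda>t. f (x + t *\<^sub>R b)" "\<lambda>t. ?D (x + t *\<^sub>R b)"] line by blast
        then have "?q n x = ?D (x + z *\<^sub>R b)" using h(1)[of n] by simp
        then show ?thesis using B True by simp
      next
        case False
        have "norm (h n *\<^sub>R b) \<le> 1" using h[of n] b by simp
        then have "R < norm (x + h n *\<^sub>R b)"
          using False norm_triangle_ineq2[of x "- (h n *\<^sub>R b)"] by simp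
        then show ?thesis using False R(2) by simp
      qed
    qed
  qed auto
  moreover have q0: "(\<integral>x. ?q n x \<partial>lborel) = 0" for n
  proof -
    have "integrable lborel (\<lambda>x. f (x + h n *\<^sub>R b))"
      using lborel_integrable_affine[OF kernel_integrable[OF kf], of 1 "h n *\<^sub>R b"] by (simp add: add.commute)
    moreover have "(\<integral>x. f (x + h n *\<^sub>R b) \<partial>lborel) = (\<integral>x. f x \<partial>lborel)"
      using lborel_integral_affine[of 1 f "h n *\<^sub>R b"] by (simp add: add.commute)
    ultimately show ?thesis using kernel_integrable[OF kf] by simp
  qed
  ultimately show ?thesis unfolding q0 by (simp add: LIMSEQ_const_iff)
qed

lemma integral_by_parts_test_function:
  assumes \<phi>: "test_function \<phi>" and \<psi>: "test_function \<psi>" and b: "b \<in> Basis"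
  shows "(\<integral>x. frechet_derivative \<phi> (at x) b * \<psi> x \<partial>lborel) = - (\<integral>x. \<phi> x * frechet_derivative \<psi> (at x) b \<partial>lborel)"
proof -
  have d: "frechet_derivative (\<lambda>x. \<phi> x * \<psi> x) (at x) b
      = \<phi> x * frechet_derivative \<psi> (at x) b + frechet_derivative \<phi> (at x) b * \<psi> x" for x
  proof -
    note has_derivative_mult[OF test_function_has_derivative[OF \<phi>] test_function_has_derivative[OF \<psi>], of x]
    from frechet_derivative_at[OF this, symmetric] show ?thesis by simp
  qed
  have "(\<integral>x. \<phi> x * frechet_derivative \<psi> (at x) b + frechet_derivative \<phi> (at x) b * \<psi> x \<partial>lborel) = 0"
    using integral_partial_test_function[OF test_function_mult[OF \<phi> \<psi>] b] by (simp add: d)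
  moreover have "integrable lborel (\<lambda>x. \<phi> x * frechet_derivative \<psi> (at x) b)"
    "integrable lborel (\<lambda>x. frechet_derivative \<phi> (at x) b * \<psi> x)"
    by (intro kernel_integrable kernel_test_function test_function_mult test_function_partial \<phi> \<psi> b)+
  ultimately show ?thesis by simp
qed

lemma kernel_scaleR_L2:
  assumes "kernel \<phi>" shows "(\<lambda>x. \<phi> x *\<^sub>R k) \<in> L2"
  using kernel_integrable[OF kernel_power2[OF assms]] kernel_measurable[OF assms]
  by (auto simp: L2_def power_mult_distrib)

lemma weak_partial_test_function:
  assumes \<phi>: "test_function \<phi>" and b: "b \<in> Basis"
  shows "weak_partial b (\<lambda>x. \<phi> x *\<^sub>R k) (\<lambda>x. frechet_derivative \<phi> (at x) b *\<^sub>R k)"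
  unfolding weak_partial_def
proof (intro allI impI)
  fix \<psi> :: "'a \<Rightarrow> real" assume \<psi>: "test_function \<psi>"
  have "integrable lborel (\<lambda>x. \<psi> x * frechet_derivative \<phi> (at x) b)"
    "integrable lborel (\<lambda>x. frechet_derivative \<psi> (at x) b * \<phi> x)"
    by (intro kernel_integrable kernel_test_function test_function_mult test_function_partial \<phi> \<psi> b)+
  then show "(\<integral>x. frechet_derivative \<psi> (at x) b *\<^sub>R \<phi> x *\<^sub>R k \<partial>lborel)
      = - (\<integral>x. \<psi> x *\<^sub>R frechet_derivative \<phi> (at x) b *\<^sub>R k \<partial>lborel)"
    using integral_by_parts_test_function[OF \<psi> \<phi> b] by simp
qed

lemma test_function_H2:
  assumes \<phi>: "test_function \<phi>" shows "(\<lambda>x. \<phi> x *\<^sub>R k) \<in> H2"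
  unfolding H2_def
proof (intro CollectI conjI ballI)
  show "(\<lambda>x. \<phi> x *\<^sub>R k) \<in> L2" by (intro kernel_scaleR_L2 kernel_test_function \<phi>)
  fix b assume b: "b \<in> (Basis :: 'a set)"
  note \<phi>b = test_function_partial[OF \<phi> b]
  show "\<exists>v\<in>L2. weak_partial b (\<lambda>x. \<phi> x *\<^sub>R k) v \<and> (\<forall>b'\<in>Basis. \<exists>w\<in>L2. weak_partial b' v w)"
    using weak_partial_test_function[OF \<phi> b] kernel_scaleR_L2[OF kernel_test_function[OF \<phi>b]]
      weak_partial_test_function[OF \<phi>b] kernel_scaleR_L2[OF kernel_test_function[OF test_function_partial[OF \<phi>b]]]
    by blast
qed

lemma test_function_bump: "test_function (bump 1)"
proof (rule test_function_cut[where R = 1])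
  fix k
  have "Ck j (\<lambda>x :: 'a. 1 + (- 1) * (x \<bullet> x))" for j
    by (intro Ck_add Ck_mult Ck_const Ck_self_inner[of 1 1]) auto
  from Ck_compose_chain[OF flat_derivative_chain this]
  show "Ck k (bump 1 :: 'a \<Rightarrow> real)" by (simp add: bump_def[abs_def])
  show "bump 1 x = 0" if "1 < norm x" for x :: 'a
    using one_le_scaled_inner[of 1 1 x] that by (simp add: bump_def flat_nonpos)
qed

text \<open>This nontrivial function keeps the best constants away from 0 and the suprema and
  spheres nonempty.\<close>

lemma H2_exists_positive_powr:
  assumes p: "0 < p"
  shows "\<exists>u \<in> (H2 :: ('a::euclidean_space \<Rightarrow> 'k::euclidean_space) set). 0 < (\<integral>x. norm (u x) powr p \<partial>lborel)"
proof -
  obtain k :: 'k where k: "k \<in> Basis" using nonempty_Basis by blast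
  let ?u = "\<lambda>x::'a. bump 1 x *\<^sub>R k"
  have nu: "norm (?u x) powr p = bump 1 x powr p" for x
    using k by (simp add: bump_nonneg)
  obtain B where B: "\<And>x::'a. \<bar>bump 1 x\<bar> \<le> B" using kernel_bump[of 1, where 'a='a] by (auto simp: kernel_def)
  obtain R where R: "\<And>x::'a. R < norm x \<Longrightarrow> bump 1 x = 0" using kernel_bump[of 1, where 'a='a] by (auto simp: kernel_def)
  have m: "(bump 1 :: 'a \<Rightarrow> real) \<in> borel_measurable borel" by (rule kernel_measurable[OF kernel_bump]) simp
  have "kernel (\<lambda>x::'a. bump 1 x powr p)"
    unfolding kernel_def
  proof (intro conjI exI allI impI)
    show "(\<lambda>x::'a. bump 1 x powr p) \<in> borel_measurable borel" using m by measurable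
    show "\<bar>bump 1 (x::'a) powr p\<bar> \<le> B powr p" for x
      using B[of x] p by (simp add: powr_mono2 bump_nonneg)
    show "bump 1 x powr p = 0" if "R < norm x" for x :: 'a using R[OF that] by simp
  qed
  then have i: "integrable lborel (\<lambda>x::'a. bump 1 x powr p)" by (rule kernel_integrable)
  have "(\<integral>(x::'a). bump 1 x powr p \<partial>lborel) \<noteq> 0"
  proof
    assume "(\<integral>(x::'a). bump 1 x powr p \<partial>lborel) = 0"
    then have "AE x::'a in lborel. bump 1 x powr p = 0"
      using integral_nonneg_eq_0_iff_AE[OF i] by simp
    then have "AE x::'a in lborel. bump 1 x = 0" by eventually_elim simp
    then have "(\<integral>(x::'a). bump 1 x \<partial>lborel) = 0" by (rule integral_eq_zero_AE)
    then show False using integral_bump_pos[where 'a='a] by simp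
  qed
  moreover have "0 \<le> (\<integral>(x::'a). bump 1 x powr p \<partial>lborel)" by simp
  ultimately have "0 < (\<integral>x. norm (?u x) powr p \<partial>lborel)" unfolding nu by linarith
  then show ?thesis by (rule bexI[of _ ?u]) (rule test_function_H2[OF test_function_bump])
qed

section \<open>Ground states and optimizers\<close>

definition bilap :: "('a::euclidean_space \<Rightarrow> 'k::euclidean_space) \<Rightarrow> real" where
  "bilap u = (\<integral>x. (norm (laplacian u x))\<^sup>2 \<partial>lborel)"

definition dirichlet :: "('a::euclidean_space \<Rightarrow> 'k::euclidean_space) \<Rightarrow> real" where
  "dirichlet u = (\<integral>x. (grad_abs u x)\<^sup>2 \<partial>lborel)"

definition mass :: "('a::euclidean_space \<Rightarrow> 'k::euclidean_space) \<Rightarrow> real" where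
  "mass u = (\<integral>x. (norm (u x))\<^sup>2 \<partial>lborel)"

definition Lp_integral :: "real \<Rightarrow> ('a::euclidean_space \<Rightarrow> 'k::euclidean_space) \<Rightarrow> real" where
  "Lp_integral p u = (\<integral>x. norm (u x) powr p \<partial>lborel)"

lemma functional_nonneg: "0 \<le> bilap u" "0 \<le> dirichlet u" "0 \<le> mass u"
  by (simp_all add: bilap_def dirichlet_def mass_def)

lemma Lp_integral_nonneg: "0 \<le> Lp_integral p u"
  by (simp add: Lp_integral_def)

lemma Lnorm_powr: "0 < p \<Longrightarrow> Lnorm p u powr p = Lp_integral p u"
  by (simp add: Lnorm_def Lp_integral_def powr_powr)

lemma Lnorm_2_powr: "Lnorm 2 u powr q = (\<integral>x. (norm (u x))\<^sup>2 \<partial>lborel) powr (q / 2)"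
  by (simp add: Lnorm_def powr_powr)

lemma Lnorm_2_power2: "(Lnorm 2 u)\<^sup>2 = (\<integral>x. (norm (u x))\<^sup>2 \<partial>lborel)"
  by (simp add: Lnorm_def powr_half_sqrt)

lemma energy_eq: "energy \<epsilon> p u = (\<epsilon> * bilap u + dirichlet u) / 2 - Lp_integral p u / p"
  by (simp add: energy_def bilap_def dirichlet_def Lp_integral_def add_divide_distrib)

lemma mass_sphere_iff: "u \<in> mass_sphere c \<longleftrightarrow> u \<in> H2 \<and> mass u = c"
  by (simp add: mass_sphere_def mass_def)

lemma H2_nonzero_iff: "u \<in> H2_nonzero \<longleftrightarrow> u \<in> H2 \<and> 0 < mass u"
proof (cases "u \<in> H2")
  case True
  have "mass u = 0 \<longleftrightarrow> (AE x in lborel. u x = 0)"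
    unfolding mass_def
    using integral_nonneg_eq_0_iff_AE[OF L2_integrable[OF H2_L2[OF True]]] by simp
  then show ?thesis using True functional_nonneg(3)[of u] by (auto simp: H2_nonzero_def)
qed (simp add: H2_nonzero_def)

lemma dilate_functionals:
  fixes u :: "'a::euclidean_space \<Rightarrow> 'k::euclidean_space"
  assumes "u \<in> H2" "0 < c"
  shows "bilap (dilate a c u) = a\<^sup>2 * c ^ 4 / c ^ DIM('a) * bilap u"
    and "dirichlet (dilate a c u) = a\<^sup>2 * c\<^sup>2 / c ^ DIM('a) * dirichlet u"
    and "mass (dilate a c u) = a\<^sup>2 / c ^ DIM('a) * mass u"
    and "Lp_integral p (dilate a c u) = \<bar>a\<bar> powr p / c ^ DIM('a) * Lp_integral p u"
  unfolding bilap_def dirichlet_def mass_def Lp_integral_def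
  using assms by (simp_all only: integral_laplacian_dilate integral_grad_abs_dilate
      integral_norm_power2_dilate integral_norm_powr_dilate)

text \<open>The abbreviating parameters are tied down by equations, so the theorem discharges them
  with \<open>refl\<close>. They are the exponents belonging to squared norms, and \<kappa> is the
  constant of a weighted Young inequality.\<close>

context
  fixes T :: "('a::euclidean_space \<Rightarrow> 'k::euclidean_space) itself" and p \<epsilon> N \<eta> \<theta> \<sigma> \<kappa> :: real
  assumes p: "2 + 4 / real DIM('a) < p" "p < 2 + 8 / real DIM('a)" and \<epsilon>: "0 < \<epsilon>"
    and N_def: "N = real DIM('a)"
    and \<eta>_def: "\<eta> = (N * (p - 2) - 4) / 4"
    and \<theta>_def: "\<theta> = (8 - N * (p - 2)) / 4"
    and \<sigma>_def: "\<sigma> = (p - 2) / 2"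
    and \<kappa>_def: "\<kappa> = (\<eta> / \<epsilon>) powr \<eta> * \<theta> powr \<theta>"
begin

lemma N_pos: "0 < N"
  by (simp add: N_def)

text \<open>The range of p says precisely that \<eta> and \<theta> are positive. The last identity
  expresses the invariance of the Gagliardo-Nirenberg inequality under dilations.\<close>

lemma exponents: "0 < \<eta>" "0 < \<theta>" "\<eta> + \<theta> = 1" "0 < \<sigma>" "2 < p" "4 * \<eta> + 2 * \<theta> = N * \<sigma>"
proof -
  have "4 < N * (p - 2)" "N * (p - 2) < 8"
    using p N_pos unfolding N_def[symmetric] by (simp_all add: field_simps)
  then show "0 < \<eta>" "0 < \<theta>" by (simp_all add: \<eta>_def \<theta>_def)
  show "\<eta> + \<theta> = 1" "4 * \<eta> + 2 * \<theta> = N * \<sigma>" by (simp_all add: \<eta>_def \<theta>_def \<sigma>_def field_simps)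
  show "2 < p" using p(1) N_pos unfolding N_def[symmetric] by (smt (verit) divide_pos_pos)
  then show "0 < \<sigma>" by (simp add: \<sigma>_def)
qed

abbreviation product :: "('a \<Rightarrow> 'k) \<Rightarrow> real" where
  "product u \<equiv> bilap u powr \<eta> * dirichlet u powr \<theta> * mass u powr \<sigma>"

abbreviation kinetic :: "('a \<Rightarrow> 'k) \<Rightarrow> real" where
  "kinetic u \<equiv> \<epsilon> * bilap u + dirichlet u"

lemma mixed_GN_eq:
  "mixed_GN TYPE('a \<Rightarrow> 'k) p = Inf {C. 0 \<le> C \<and> (\<forall>u \<in> (H2 :: ('a \<Rightarrow> 'k) set). Lp_integral p u \<le> C * product u)}"
proof -
  have "Lnorm p u powr p \<le> C * Lnorm 2 (laplacian u) powr ((real DIM('a) * (p - 2) - 4) / 2)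
         * Lnorm 2 (grad_abs u) powr ((8 - real DIM('a) * (p - 2)) / 2) * Lnorm 2 u powr (p - 2)
      \<longleftrightarrow> Lp_integral p u \<le> C * product u" for C and u :: "'a \<Rightarrow> 'k"
    using exponents(5)
    by (simp add: Lnorm_powr Lnorm_2_powr bilap_def dirichlet_def mass_def \<eta>_def \<theta>_def \<sigma>_def N_def mult.assoc)
  then show ?thesis unfolding mixed_GN_def by simp
qed

lemma mixed_GN_set_nonempty:
  "\<exists>C\<ge>0. \<forall>u \<in> (H2 :: ('a \<Rightarrow> 'k) set). Lp_integral p u \<le> C * product u"
  using mixed_Gagliardo_Nirenberg[OF p, where 'k='k]
  by (simp add: bilap_def dirichlet_def mass_def Lp_integral_def \<eta>_def \<theta>_def \<sigma>_def N_def mult.assoc)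

lemma mixed_GN_nonneg: "0 \<le> mixed_GN TYPE('a \<Rightarrow> 'k) p"
  unfolding mixed_GN_eq using mixed_GN_set_nonempty by (intro cInf_greatest) auto

text \<open>The infimum is itself admissible: for fixed u with positive product, each admissible
  constant dominates one and the same quotient. If the product is 0, any admissible constant gives
  the claim.\<close>

lemma mixed_GN_inequality:
  fixes u :: "'a \<Rightarrow> 'k"
  assumes u: "u \<in> H2"
  shows "Lp_integral p u \<le> mixed_GN TYPE('a \<Rightarrow> 'k) p * product u"
proof (cases "product u = 0")
  case True
  then show ?thesis using mixed_GN_set_nonempty u by fastforce
next
  case False
  moreover have "0 \<le> product u" by simp
  ultimately have pos: "0 < product u" by linarith
  have "Lp_integral p u / product u \<le> mixed_GN TYPE('a \<Rightarrow> 'k) p"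
    unfolding mixed_GN_eq
    using mixed_GN_set_nonempty u by (intro cInf_greatest) (auto simp: pos_divide_le_eq[OF pos])
  then show ?thesis by (simp only: pos_divide_le_eq[OF pos])
qed

lemma mixed_GN_least:
  assumes "0 \<le> C" "\<And>u :: 'a \<Rightarrow> 'k. u \<in> H2 \<Longrightarrow> Lp_integral p u \<le> C * product u"
  shows "mixed_GN TYPE('a \<Rightarrow> 'k) p \<le> C"
  unfolding mixed_GN_eq using assms by (intro cInf_lower) (auto intro!: bdd_belowI[of _ 0])

text \<open>No derivative is computed: a positive Lp integral forces the other side of the
  inequality, and with it each of its factors, to be nonzero.\<close>

lemma exists_positive:
  obtains u :: "'a \<Rightarrow> 'k" where "u \<in> H2" "0 < Lp_integral p u" "0 < product u" "0 < mass u"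
proof -
  obtain u :: "'a \<Rightarrow> 'k" where u: "u \<in> H2" "0 < Lp_integral p u"
    using H2_exists_positive_powr[of p, where 'a='a and 'k='k] exponents(5) unfolding Lp_integral_def by auto
  then have "product u \<noteq> 0" using mixed_GN_inequality[OF u(1)] by auto
  then have "0 < product u" "mass u \<noteq> 0" by (auto simp: less_le)
  then show thesis using that u functional_nonneg(3)[of u] by (simp add: less_le)
qed

lemma mixed_GN_pos: "0 < mixed_GN TYPE('a \<Rightarrow> 'k) p"
proof -
  obtain u :: "'a \<Rightarrow> 'k" where "u \<in> H2" "0 < Lp_integral p u" using exists_positive by blast
  then have "mixed_GN TYPE('a \<Rightarrow> 'k) p \<noteq> 0" using mixed_GN_inequality[of u] by auto
  then show ?thesis using mixed_GN_nonneg by simp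
qed

lemma young_const_pos: "0 < \<kappa>"
  using exponents \<epsilon> by (simp add: \<kappa>_def)

text \<open>The equality case of \<open>young_bound\<close>: here \<epsilon> a = \<eta> m and b =
  \<theta> m, so that \<epsilon> a + b = m.\<close>

lemma young_const_equality:
  assumes "0 \<le> m"
  shows "(\<eta> / \<epsilon> * m) powr \<eta> * (\<theta> * m) powr \<theta> = \<kappa> * m"
proof -
  have "m powr \<eta> * m powr \<theta> = m" using assms exponents(3) by (simp flip: powr_add)
  then show ?thesis unfolding \<kappa>_def powr_mult by (metis mult.assoc mult.left_commute)
qed

text \<open>Weighted AM-GM with weights \<eta> and \<theta>, applied to \<epsilon> a / \<eta> and b
  / \<theta>: their weighted mean is \<epsilon> a + b, and \<kappa> undoes the rescaling on the
  other side.\<close>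

lemma young_bound:
  assumes "0 \<le> a" "0 \<le> b"
  shows "a powr \<eta> * b powr \<theta> \<le> \<kappa> * (\<epsilon> * a + b)"
proof (cases "a = 0 \<or> b = 0")
  case True
  then show ?thesis using assms \<epsilon> young_const_pos by auto
next
  case False
  then have ab: "0 < a" "0 < b" using assms by auto
  have "(\<epsilon> * a / \<eta>) powr \<eta> * (b / \<theta>) powr \<theta> \<le> \<eta> * (\<epsilon> * a / \<eta>) + \<theta> * (b / \<theta>)"
    using exponents ab \<epsilon> by (intro Youngs_inequality_0) auto
  also have "\<dots> = \<epsilon> * a + b" using exponents by simp
  finally have "\<kappa> * ((\<epsilon> * a / \<eta>) powr \<eta> * (b / \<theta>) powr \<theta>) \<le> \<kappa> * (\<epsilon> * a + b)"
    using young_const_pos by simp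
  moreover have "\<kappa> * ((\<epsilon> * a / \<eta>) powr \<eta> * (b / \<theta>) powr \<theta>)
      = ((\<eta> / \<epsilon>) * (\<epsilon> * a / \<eta>)) powr \<eta> * (\<theta> * (b / \<theta>)) powr \<theta>"
    unfolding \<kappa>_def powr_mult by (simp only: mult_ac)
  moreover have "(\<eta> / \<epsilon>) * (\<epsilon> * a / \<eta>) = a" "\<theta> * (b / \<theta>) = b"
    using exponents \<epsilon> by simp_all
  ultimately show ?thesis by simp
qed

lemma Lp_le_kinetic:
  fixes u :: "'a \<Rightarrow> 'k"
  assumes u: "u \<in> H2"
  shows "Lp_integral p u \<le> mixed_GN TYPE('a \<Rightarrow> 'k) p * \<kappa> * (mass u powr \<sigma> * kinetic u)"
proof -
  have "product u \<le> \<kappa> * kinetic u * mass u powr \<sigma>"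
    using mult_right_mono[OF young_bound[OF functional_nonneg(1)[of u] functional_nonneg(2)[of u]], of "mass u powr \<sigma>"]
    by simp
  from mult_left_mono[OF this mixed_GN_nonneg] mixed_GN_inequality[OF u]
  show ?thesis by (simp add: mult_ac)
qed

lemma best_K_eq:
  "best_K TYPE('a \<Rightarrow> 'k) p \<epsilon>
    = (SUP u \<in> (H2_nonzero :: ('a \<Rightarrow> 'k) set). Lp_integral p u / (mass u powr \<sigma> * kinetic u))"
  unfolding best_K_def Lnorm_2_powr Lnorm_2_power2
  using exponents(5) by (simp add: Lnorm_powr bilap_def dirichlet_def mass_def \<sigma>_def)

lemma ratio_le:
  fixes u :: "'a \<Rightarrow> 'k"
  assumes u: "u \<in> H2_nonzero"
  shows "Lp_integral p u / (mass u powr \<sigma> * kinetic u) \<le> mixed_GN TYPE('a \<Rightarrow> 'k) p * \<kappa>"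
proof (cases "mass u powr \<sigma> * kinetic u = 0")
  case True
  \<comment> \<open>Division by zero gives 0, which is below the nonnegative bound.\<close>
  show ?thesis unfolding True using mixed_GN_nonneg young_const_pos by simp
next
  case False
  moreover have "0 \<le> mass u powr \<sigma> * kinetic u"
    using \<epsilon> functional_nonneg[of u] by simp
  ultimately have "0 < mass u powr \<sigma> * kinetic u" by linarith
  then show ?thesis
    using Lp_le_kinetic[of u] u by (simp only: pos_divide_le_eq H2_nonzero_iff)
qed

lemma ratio_le_best_K:
  fixes u :: "'a \<Rightarrow> 'k"
  assumes u: "u \<in> H2_nonzero"
  shows "Lp_integral p u / (mass u powr \<sigma> * kinetic u) \<le> best_K TYPE('a \<Rightarrow> 'k) p \<epsilon>"
  unfolding best_K_eq
proof (rule cSUP_upper[OF u])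
  show "bdd_above ((\<lambda>u :: 'a \<Rightarrow> 'k. Lp_integral p u / (mass u powr \<sigma> * kinetic u)) ` H2_nonzero)"
    using ratio_le by (intro bdd_aboveI2)
qed

lemma best_K_nonneg: "0 \<le> best_K TYPE('a \<Rightarrow> 'k) p \<epsilon>"
proof -
  obtain u :: "'a \<Rightarrow> 'k" where u: "u \<in> H2_nonzero"
    using exists_positive unfolding H2_nonzero_iff by blast
  have "0 \<le> Lp_integral p u / (mass u powr \<sigma> * kinetic u)"
    using \<epsilon> functional_nonneg[of u] Lp_integral_nonneg[of p u] by simp
  then show ?thesis using ratio_le_best_K[OF u] by linarith
qed

lemma best_K_inequality:
  fixes u :: "'a \<Rightarrow> 'k"
  assumes u: "u \<in> H2"
  shows "Lp_integral p u \<le> best_K TYPE('a \<Rightarrow> 'k) p \<epsilon> * (mass u powr \<sigma> * kinetic u)"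
proof (cases "mass u powr \<sigma> * kinetic u = 0")
  case True
  \<comment> \<open>The supremum is silent here, since the quotient is 0 by convention;
    \<open>Lp_le_kinetic\<close> shows that the numerator vanishes as well.\<close>
  show ?thesis using Lp_le_kinetic[OF u] unfolding True by simp
next
  case False
  moreover have "0 \<le> mass u powr \<sigma> * kinetic u"
    using \<epsilon> functional_nonneg[of u] by simp
  ultimately have pos: "0 < mass u powr \<sigma> * kinetic u" by linarith
  have "u \<in> H2_nonzero" using u False functional_nonneg(3)[of u] by (auto simp: H2_nonzero_iff less_le)
  from ratio_le_best_K[OF this] show ?thesis by (simp only: pos_divide_le_eq[OF pos])
qed

text \<open>Dilating \<open>u\<close> so that \<open>\<epsilon> bilap u / \<eta> = dirichlet u / \<theta>\<close> turns Young's inequality into an equality.\<close>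

lemma best_K_young:
  "best_K TYPE('a \<Rightarrow> 'k) p \<epsilon> = mixed_GN TYPE('a \<Rightarrow> 'k) p * \<kappa>"
proof (rule antisym)
  obtain u0 :: "'a \<Rightarrow> 'k" where "u0 \<in> H2_nonzero"
    using exists_positive unfolding H2_nonzero_iff by blast
  then show "best_K TYPE('a \<Rightarrow> 'k) p \<epsilon> \<le> mixed_GN TYPE('a \<Rightarrow> 'k) p * \<kappa>"
    unfolding best_K_eq by (intro cSUP_least ratio_le) auto
  \<comment> \<open>For the other direction it suffices that \<open>best_K\<close> divided by
    \<kappa> is an admissible constant in the infimum defining \<open>mixed_GN\<close>.\<close>
  have "mixed_GN TYPE('a \<Rightarrow> 'k) p \<le> best_K TYPE('a \<Rightarrow> 'k) p \<epsilon> / \<kappa>"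
  proof (rule mixed_GN_least)
    show "0 \<le> best_K TYPE('a \<Rightarrow> 'k) p \<epsilon> / \<kappa>"
      using best_K_nonneg young_const_pos by simp
    fix u :: "'a \<Rightarrow> 'k" assume u: "u \<in> H2"
    show "Lp_integral p u \<le> best_K TYPE('a \<Rightarrow> 'k) p \<epsilon> / \<kappa> * product u"
    proof (cases "product u = 0")
      case True
      show ?thesis using mixed_GN_inequality[OF u] unfolding True by simp
    next
      case False
      then have pos: "0 < bilap u" "0 < dirichlet u" "0 < mass u"
        using functional_nonneg[of u] by (auto simp: less_le)
      \<comment> \<open>Up to a common factor, dilation multiplies \<open>bilap\<close> by c^4 and
        \<open>dirichlet\<close> by c^2, so the desired balance determines c^2.\<close>
      define c where "c = sqrt (\<eta> * dirichlet u / (\<epsilon> * \<theta> * bilap u))"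
      have c: "0 < c" using pos exponents \<epsilon> by (simp add: c_def)
      have c2: "c\<^sup>2 = \<eta> * dirichlet u / (\<epsilon> * \<theta> * bilap u)"
        using pos exponents \<epsilon> by (simp add: c_def)
      define v where "v = dilate 1 c u"
      have v: "v \<in> H2" unfolding v_def by (rule H2_dilate[OF u c])
      define m where "m = dirichlet v / \<theta>"
      have m: "0 \<le> m" using functional_nonneg(2)[of v] exponents by (simp add: m_def)
      have dir: "dirichlet v = \<theta> * m" using exponents by (simp add: m_def)
      have c4: "c ^ 4 = c\<^sup>2 * c\<^sup>2" by (simp add: power2_eq_square power4_eq_xxxx)
      have bil: "bilap v = \<eta> / \<epsilon> * m"
      proof -
        have "bilap v = c\<^sup>2 * (c\<^sup>2 * bilap u) / c ^ DIM('a)"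
          unfolding v_def dilate_functionals[OF u c] c4 by simp
        also have "c\<^sup>2 * bilap u = \<eta> / \<epsilon> * (dirichlet u / \<theta>)"
          unfolding c2 using pos exponents \<epsilon> by (simp add: field_simps)
        finally show ?thesis
          unfolding m_def v_def dilate_functionals[OF u c] by (simp add: field_simps)
      qed
      have "\<epsilon> * bilap v + dirichlet v = (\<eta> + \<theta>) * m"
        unfolding dir bil using \<epsilon> by (simp add: distrib_right)
      then have kin: "kinetic v = m" using exponents(3) by simp
      have prod: "product v = \<kappa> * m * mass v powr \<sigma>"
        unfolding dir bil young_const_equality[OF m] ..
      have "best_K TYPE('a \<Rightarrow> 'k) p \<epsilon> * (mass v powr \<sigma> * kinetic v)
          = best_K TYPE('a \<Rightarrow> 'k) p \<epsilon> / \<kappa> * product v"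
        unfolding kin prod using young_const_pos by simp
      with best_K_inequality[OF v]
      have le: "Lp_integral p v \<le> best_K TYPE('a \<Rightarrow> 'k) p \<epsilon> / \<kappa> * product v" by simp
      have cN: "c ^ DIM('a) = c powr N" using c by (simp add: N_def powr_realpow)
      have "c ^ 4 / c ^ DIM('a) = c powr (4 - N)" "c\<^sup>2 / c ^ DIM('a) = c powr (2 - N)"
        "1 / c ^ DIM('a) = c powr (- N)"
        using c by (simp_all add: cN powr_diff powr_minus_divide)
      then have "product v = (c powr (4 - N) * bilap u) powr \<eta> * (c powr (2 - N) * dirichlet u) powr \<theta>
          * (c powr (- N) * mass u) powr \<sigma>"
        unfolding v_def dilate_functionals[OF u c] by simp
      also have "\<dots> = c powr ((4 - N) * \<eta> + (2 - N) * \<theta> + (- N) * \<sigma>) * product u"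
        unfolding powr_mult powr_powr powr_add by (simp only: mult_ac)
      \<comment> \<open>The product thus scales by c^(- N), exactly like the Lp integral, and the
        inequality for v returns to u.\<close>
      also have "(4 - N) * \<eta> + (2 - N) * \<theta> + (- N) * \<sigma> = - N"
      proof -
        have "(4 - N) * \<eta> + (2 - N) * \<theta> + (- N) * \<sigma> = (4 * \<eta> + 2 * \<theta> - N * \<sigma>) - N * (\<eta> + \<theta>)"
          by (simp add: algebra_simps)
        then show ?thesis using exponents(3,6) by simp
      qed
      finally have pv: "product v = 1 / c powr N * product u" by (simp add: powr_minus_divide)
      have "Lp_integral p v = 1 / c powr N * Lp_integral p u"
        unfolding v_def dilate_functionals[OF u c] cN by simp
      then have "1 / c powr N * Lp_integral p u
          \<le> 1 / c powr N * (best_K TYPE('a \<Rightarrow> 'k) p \<epsilon> / \<kappa> * product u)"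
        using le unfolding pv by (simp add: mult_ac)
      moreover have "0 < 1 / c powr N" using c by simp
      ultimately show ?thesis using mult_le_cancel_left_pos by blast
    qed
  qed
  then show "mixed_GN TYPE('a \<Rightarrow> 'k) p * \<kappa> \<le> best_K TYPE('a \<Rightarrow> 'k) p \<epsilon>"
    by (simp only: pos_le_divide_eq[OF young_const_pos])
qed

lemma best_K_pos: "0 < best_K TYPE('a \<Rightarrow> 'k) p \<epsilon>"
  unfolding best_K_young using mixed_GN_pos young_const_pos by simp

text \<open>Both sides are products of powers of positive numbers. Taking logarithms leaves a linear
  identity, in which \<eta> + \<theta> = 1 merges the powers of 2 / p.\<close>

lemma crit_mass_eq:
  "crit_mass TYPE('a \<Rightarrow> 'k) p \<epsilon> = (2 / p * best_K TYPE('a \<Rightarrow> 'k) p \<epsilon>) powr (- 2 / (p - 2))"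
proof -
  define G q where "G = mixed_GN TYPE('a \<Rightarrow> 'k) p" and "q = 2 / (p - 2)"
  have G: "0 < G" unfolding G_def by (rule mixed_GN_pos)
  have e: "N * (p - 2) - 4 = 4 * \<eta>" "8 - N * (p - 2) = 4 * \<theta>" by (simp_all add: \<eta>_def \<theta>_def)
  have f: "4 * \<eta> / (2 * (p - 2)) = \<eta> * q" "4 * \<theta> / (2 * (p - 2)) = \<theta> * q" "- 2 / (p - 2) = - q"
    using exponents(5) by (simp_all add: q_def field_simps)
  have g: "2 * p / (4 * \<eta>) = p / (2 * \<eta>)" "2 * p / (4 * \<theta>) = p / (2 * \<theta>)" by simp_all
  have lhs: "crit_mass TYPE('a \<Rightarrow> 'k) p \<epsilon>
      = G powr (- q) * (p / (2 * \<eta>)) powr (\<eta> * q) * (p / (2 * \<theta>)) powr (\<theta> * q) * \<epsilon> powr (\<eta> * q)"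
    unfolding crit_mass_def Let_def N_def[symmetric] e f g G_def ..
  have "ln (G powr (- q) * (p / (2 * \<eta>)) powr (\<eta> * q) * (p / (2 * \<theta>)) powr (\<theta> * q) * \<epsilon> powr (\<eta> * q))
      = - q * ln G + \<eta> * q * (ln p - ln 2 - ln \<eta>) + \<theta> * q * (ln p - ln 2 - ln \<theta>) + \<eta> * q * ln \<epsilon>"
    using G exponents \<epsilon> by (simp add: ln_mult ln_div ln_powr diff_diff_eq)
  also have "\<dots> = - q * (ln 2 * (\<eta> + \<theta>) - ln p * (\<eta> + \<theta>) + (ln G + (\<eta> * (ln \<eta> - ln \<epsilon>) + \<theta> * ln \<theta>)))"
    by (simp add: algebra_simps)
  also have "\<dots> = ln ((2 / p * (G * \<kappa>)) powr (- q))"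
    using G exponents \<epsilon> by (simp add: \<kappa>_def ln_mult ln_div ln_powr)
  finally have "G powr (- q) * (p / (2 * \<eta>)) powr (\<eta> * q) * (p / (2 * \<theta>)) powr (\<theta> * q) * \<epsilon> powr (\<eta> * q)
      = (2 / p * (G * \<kappa>)) powr (- q)"
    by (rule ln_inj_iff[THEN iffD1, rotated 2]) (use G exponents \<epsilon> young_const_pos in simp_all)
  then show ?thesis unfolding lhs best_K_young f(3) G_def .
qed

lemma crit_mass_pos: "0 < crit_mass TYPE('a \<Rightarrow> 'k) p \<epsilon>"
  unfolding crit_mass_eq using best_K_pos exponents(5) by simp

text \<open>This singles out the critical mass: on its sphere the sharp inequality bounds the Lp
  term of the energy by exactly the kinetic term.\<close>

lemma crit_mass_powr: "best_K TYPE('a \<Rightarrow> 'k) p \<epsilon> * crit_mass TYPE('a \<Rightarrow> 'k) p \<epsilon> powr \<sigma> = p / 2"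
proof -
  have "- 2 / (p - 2) * \<sigma> = - 1" using exponents(5) by (simp add: \<sigma>_def)
  then have "crit_mass TYPE('a \<Rightarrow> 'k) p \<epsilon> powr \<sigma> = (2 / p * best_K TYPE('a \<Rightarrow> 'k) p \<epsilon>) powr (- 1)"
    unfolding crit_mass_eq powr_powr by simp
  also have "\<dots> = 1 / (2 / p * best_K TYPE('a \<Rightarrow> 'k) p \<epsilon>)"
    using best_K_pos exponents(5) by (simp add: powr_minus_divide)
  finally show ?thesis using best_K_pos exponents(5) by simp
qed

section \<open>The energy at the critical mass\<close>

lemma energy_nonneg:
  fixes u :: "'a \<Rightarrow> 'k"
  assumes "u \<in> mass_sphere (crit_mass TYPE('a \<Rightarrow> 'k) p \<epsilon>)"
  shows "0 \<le> energy \<epsilon> p u"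
proof -
  have u: "u \<in> H2" and m: "mass u = crit_mass TYPE('a \<Rightarrow> 'k) p \<epsilon>" using assms by (simp_all add: mass_sphere_iff)
  have "Lp_integral p u \<le> p / 2 * kinetic u"
    using best_K_inequality[OF u] unfolding m mult.assoc[symmetric] crit_mass_powr .
  then show ?thesis unfolding energy_eq using exponents(5) by (simp add: field_simps)
qed

lemma min_energy_crit_mass: "min_energy TYPE('a \<Rightarrow> 'k) \<epsilon> p (crit_mass TYPE('a \<Rightarrow> 'k) p \<epsilon>) = 0"
proof (rule antisym)
  define cm where "cm = crit_mass TYPE('a \<Rightarrow> 'k) p \<epsilon>"
  have cm: "0 < cm" unfolding cm_def by (rule crit_mass_pos)
  show "0 \<le> min_energy TYPE('a \<Rightarrow> 'k) \<epsilon> p (crit_mass TYPE('a \<Rightarrow> 'k) p \<epsilon>)"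
    unfolding min_energy_def by (intro INF_greatest) (simp add: energy_nonneg)
  obtain u :: "'a \<Rightarrow> 'k" where u: "u \<in> H2" "0 < mass u" using exists_positive by blast
  define Q where "Q = cm / mass u * kinetic u / 2"
  have Q: "0 \<le> Q" unfolding Q_def using cm u \<epsilon> functional_nonneg[of u] by simp
  have small: "min_energy TYPE('a \<Rightarrow> 'k) \<epsilon> p cm \<le> 0 + ereal \<delta>" if \<delta>: "0 < \<delta>" for \<delta>
  proof -
    \<comment> \<open>For c <= 1 both c^4 and c^2 are at most c, so half the kinetic term of the
      dilation is at most Q c, which this choice keeps below \<delta>. The denominator Q + 1 is
      positive even if Q = 0.\<close>
    define c where "c = min 1 (\<delta> / (Q + 1))"
    have c: "0 < c" "c \<le> 1" "Q * c \<le> \<delta>"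
    proof -
      show "0 < c" "c \<le> 1" using \<delta> Q by (simp_all add: c_def)
      have "Q * c \<le> Q * (\<delta> / (Q + 1))" using Q by (intro mult_left_mono) (simp_all add: c_def)
      also have "\<dots> \<le> \<delta>" using Q \<delta> by (simp add: field_simps)
      finally show "Q * c \<le> \<delta>" .
    qed
    \<comment> \<open>The amplitude restores the mass \<open>cm\<close>, since dilation multiplies
      the mass by a^2 / c^N.\<close>
    define a where "a = sqrt (cm * c ^ DIM('a) / mass u)"
    have a2: "a\<^sup>2 = cm * c ^ DIM('a) / mass u" using cm c u by (simp add: a_def)
    define v where "v = dilate a c u"
    have "v \<in> mass_sphere cm"
      unfolding mass_sphere_iff v_def dilate_functionals[OF u(1) c(1)] a2
      using H2_dilate[OF u(1) c(1)] u c by simp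
    moreover have "energy \<epsilon> p v \<le> \<delta>"
    proof -
      \<comment> \<open>The Lp term enters with a negative sign and can only lower the energy, so it
        is dropped.\<close>
      have "energy \<epsilon> p v \<le> kinetic v / 2"
      proof -
        have "0 \<le> Lp_integral p v / p" using Lp_integral_nonneg[of p v] exponents(5) by simp
        then show ?thesis unfolding energy_eq by linarith
      qed
      also have "kinetic v = cm / mass u * (\<epsilon> * (c ^ 4 * bilap u) + c\<^sup>2 * dirichlet u)"
      proof -
        have ac: "a\<^sup>2 / c ^ DIM('a) = cm / mass u" unfolding a2 using c(1) by simp
        have bd: "bilap v = a\<^sup>2 / c ^ DIM('a) * (c ^ 4 * bilap u)" "dirichlet v = a\<^sup>2 / c ^ DIM('a) * (c\<^sup>2 * dirichlet u)"
          unfolding v_def dilate_functionals[OF u(1) c(1)] by simp_all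
        show ?thesis unfolding bd ac by (simp only: distrib_left mult.left_commute)
      qed
      also have "cm / mass u * (\<epsilon> * (c ^ 4 * bilap u) + c\<^sup>2 * dirichlet u) / 2
          \<le> cm / mass u * (\<epsilon> * (c * bilap u) + c * dirichlet u) / 2"
      proof -
        have "c ^ 4 \<le> c" "c\<^sup>2 \<le> c"
          using c power_decreasing[of 1 4 c] power_decreasing[of 1 2 c] by simp_all
        then have "c ^ 4 * bilap u \<le> c * bilap u" "c\<^sup>2 * dirichlet u \<le> c * dirichlet u"
          by (simp_all add: mult_right_mono functional_nonneg)
        then have "\<epsilon> * (c ^ 4 * bilap u) + c\<^sup>2 * dirichlet u \<le> \<epsilon> * (c * bilap u) + c * dirichlet u"
          using \<epsilon> by (intro add_mono mult_left_mono) simp_all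
        moreover have "0 \<le> cm / mass u" using cm u by simp
        ultimately show ?thesis by (intro divide_right_mono mult_left_mono) simp_all
      qed
      also have "\<dots> = Q * c"
      proof -
        have "k * (\<epsilon> * (c * x) + c * y) / 2 = k * (\<epsilon> * x + y) / 2 * c" for k x y :: real
          by (simp add: field_simps)
        then show ?thesis unfolding Q_def .
      qed
      finally show ?thesis using c(3) by linarith
    qed
    ultimately show ?thesis
      unfolding min_energy_def by (intro INF_lower2[of v]) auto
  qed
  have "min_energy TYPE('a \<Rightarrow> 'k) \<epsilon> p cm \<le> 0"
    by (rule ereal_le_epsilon2) (simp only: small)
  then show "min_energy TYPE('a \<Rightarrow> 'k) \<epsilon> p (crit_mass TYPE('a \<Rightarrow> 'k) p \<epsilon>) \<le> 0"
    unfolding cm_def .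
qed

text \<open>The mass condition is common to both sides. Under it u is automatically nonzero, and
  since K times the critical mass to the power \<sigma> is p / 2, equality in the sharp inequality
  is the equation that the energy equals its minimum 0.\<close>

lemma energy_GSS_iff:
  fixes u :: "'a \<Rightarrow> 'k"
  assumes u: "u \<in> H2"
  shows "energy_GSS \<epsilon> p (crit_mass TYPE('a \<Rightarrow> 'k) p \<epsilon>) u \<longleftrightarrow>
    (Lnorm 2 u)\<^sup>2 = crit_mass TYPE('a \<Rightarrow> 'k) p \<epsilon> \<and> is_optimizer p \<epsilon> u"
proof -
  have gss: "energy_GSS \<epsilon> p (crit_mass TYPE('a \<Rightarrow> 'k) p \<epsilon>) u \<longleftrightarrow>
      mass u = crit_mass TYPE('a \<Rightarrow> 'k) p \<epsilon> \<and> energy \<epsilon> p u = 0"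
    using u by (simp add: energy_GSS_def min_energy_crit_mass mass_sphere_iff)
  have "Lnorm 2 u powr (p - 2) = mass u powr \<sigma>" "(Lnorm 2 (laplacian u))\<^sup>2 = bilap u"
    "(Lnorm 2 (grad_abs u))\<^sup>2 = dirichlet u"
    by (simp_all add: Lnorm_2_powr Lnorm_2_power2 mass_def \<sigma>_def bilap_def dirichlet_def)
  then have opt: "is_optimizer p \<epsilon> u \<longleftrightarrow>
      0 < mass u \<and> Lp_integral p u = best_K TYPE('a \<Rightarrow> 'k) p \<epsilon> * mass u powr \<sigma> * kinetic u"
    using u exponents(5) by (simp add: is_optimizer_def H2_nonzero_iff Lnorm_powr)
  have "energy \<epsilon> p u = 0 \<longleftrightarrow> Lp_integral p u / p = kinetic u / 2"
    unfolding energy_eq by linarith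
  also have "\<dots> \<longleftrightarrow> Lp_integral p u = p / 2 * kinetic u"
    using exponents(5) by (simp add: divide_eq_eq mult.commute)
  finally have E0: "energy \<epsilon> p u = 0 \<longleftrightarrow> Lp_integral p u = p / 2 * kinetic u" .
  have at_crit: "best_K TYPE('a \<Rightarrow> 'k) p \<epsilon> * mass u powr \<sigma> * kinetic u = p / 2 * kinetic u" "0 < mass u"
    if "mass u = crit_mass TYPE('a \<Rightarrow> 'k) p \<epsilon>"
    unfolding that crit_mass_powr by (rule refl crit_mass_pos)+
  show ?thesis
    unfolding gss opt E0 Lnorm_2_power2 mass_def[symmetric]
    using at_crit by (intro conj_cong refl) (simp only: simp_thms)
qed

end

theorem theorem1p1:
  fixes p \<epsilon> :: real
  assumes "2 + 4 / real DIM('a) < p" and "p < 2 + 8 / real DIM('a)" and "\<epsilon> > 0"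
  shows "(\<forall>u \<in> (H2 :: ('a::euclidean_space \<Rightarrow> 'k::{real_normed_field, euclidean_space}) set).
            energy_GSS \<epsilon> p (crit_mass TYPE('a \<Rightarrow> 'k) p \<epsilon>) u \<longleftrightarrow>
              (Lnorm 2 u)\<^sup>2 = crit_mass TYPE('a \<Rightarrow> 'k) p \<epsilon> \<and> is_optimizer p \<epsilon> u)
       \<and> crit_mass TYPE('a \<Rightarrow> 'k) p \<epsilon>
            = (2 / p * best_K TYPE('a \<Rightarrow> 'k) p \<epsilon>) powr (- 2 / (p - 2))"
  using energy_GSS_iff[OF assms refl refl refl refl refl] crit_mass_eq[OF assms refl refl refl refl refl] by blast

end
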